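(* Suppose that the following two assumptions are satisfied. (I) There is a constant $c<1$ such that $\|K_n^{0}\|\le c$ for all $n\ge 1$. (II) There is a set $M$ of probability measures on $\mathrm{SL}(m,\mathbb{R})$ which is compact with respect to weak convergence and such that: (a) $\nu_n\in M$ for all $n\ge 1$; (b) for every $\nu\in M$ the group $G_\nu$ does not preserve any probability measure on $\mathcal{S}$. Then there is $\lambda>0$ such that with probability $1$ $$\liminf_{n\to\infty}\frac1n \ln\|g_n g_{n-1}\cdots g_1\|\ge \lambda .$$
   Context: Let $m$ be a positive integer, $\mathcal{S}$ the unit sphere in $\mathbb{R}^m$, and $\|\cdot\|$ the Euclidean norm of vectors and the corresponding operator norm of matrices. Markov chain. Let $(X,\mathcal{B})$ be a measurable space and $\xi=(\xi_n)_{n\ge1}$ a (not necessarily stationary) Markov chain with phase space $X$, initial distribution $\mu_1$ and transition kernels $k_n(x,B)=\mathbb{P}(\xi_{n+1}\in B\mid \xi_n=x)$, $B\in\mathcal{B}$. Let $\mu_n$ be the distribution of $\xi_n$. Let $H_n$ be the Hilbert space of real-valued $\mu_n$-square-integrable functions on $X$, and $H_n^0=\{f\in H_n:\int_X f\,d\mu_n=0\}$. Let $K_n:H_{n+1}\to H_n$, $(K_nf)(x)=\int_X k_n(x,dy)f(y)$. It maps $H_{n+1}^0$ into $H_n^0$, and $K_n^0:H_{n+1}^0\to H_n^0$ denotes its restriction; $\|K_n^0\|$ is its operator norm. Matrices. Let $\mathfrak{g}_n:X\to\mathrm{SL}(m,\mathbb{R})$, $n\ge1$, be $\mathcal{B}$-measurable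 functions, $g_n=\mathfrak{g}_n(\xi_n)$, and let $\nu_n$ be the distribution of $g_n$ on $\mathrm{SL}(m,\mathbb{R})$. Groups. For a probability measure $\nu$ on $\mathrm{SL}(m,\mathbb{R})$, $G_\nu$ is the closed group generated by $\{g\tilde g^{-1}: g,\tilde g\in\mathrm{supp}(\nu)\}$. For $g\in\mathrm{SL}(m,\mathbb{R})$ and $u\in\mathcal{S}$ set $g.u=gu/\|gu\|$; $g$ preserves a probability measure $\kappa$ on $\mathcal{S}$ if the image of $\kappa$ under $u\mapsto g.u$ is $\kappa$, and a group preserves $\kappa$ if each of its elements does. *)

theory Defs
  imports "HOL-Probability.Probability" "HOL-Algebra.Group"
begin

section \<open>Inhomogeneous Markov chains and their transition operators\<close>

text \<open>All sequences are indexed by the positive integers; values at index 0 are irrelevant.\<close>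

definition past_algebra :: "'w measure \<Rightarrow> 'x measure \<Rightarrow> (nat \<Rightarrow> 'w \<Rightarrow> 'x) \<Rightarrow> nat \<Rightarrow> 'w measure" where
  "past_algebra P X \<xi> n = vimage_algebra (space P) (\<lambda>\<omega>. \<lambda>i\<in>{1..n}. \<xi> i \<omega>) (PiM {1..n} (\<lambda>_. X))"

text \<open>The kernel \<open>k n\<close> governs the step from time \<open>n\<close> to time \<open>n + 1\<close>. The initial distribution
  is arbitrary: it is the law of \<open>\<xi> 1\<close>.\<close>

definition markov_chain ::
  "'w measure \<Rightarrow> 'x measure \<Rightarrow> (nat \<Rightarrow> 'x \<Rightarrow> 'x measure) \<Rightarrow> (nat \<Rightarrow> 'w \<Rightarrow> 'x) \<Rightarrow> bool" where
  "markov_chain P X k \<xi> \<longleftrightarrow>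
     prob_space P \<and>
     (\<forall>n\<ge>1. \<xi> n \<in> P \<rightarrow>\<^sub>M X) \<and>
     (\<forall>n\<ge>1. k n \<in> X \<rightarrow>\<^sub>M prob_algebra X) \<and>
     (\<forall>n\<ge>1. \<forall>B\<in>sets X. AE \<omega> in P.
        real_cond_exp P (past_algebra P X \<xi> n) (\<lambda>\<omega>. indicator B (\<xi> (Suc n) \<omega>)) \<omega>
          = measure (k n (\<xi> n \<omega>)) B)"

text \<open>Elements of the Hilbert space of square-integrable functions are represented by functions,
  without passing to classes modulo null sets; \<open>L2_norm\<close> is then a seminorm.\<close>

definition L2 :: "'x measure \<Rightarrow> ('x \<Rightarrow> real) set" where
  "L2 \<mu> = {f \<in> borel_measurable \<mu>. integrable \<mu> (\<lambda>x. (f x)\<^sup>2)}"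

definition L2_0 :: "'x measure \<Rightarrow> ('x \<Rightarrow> real) set" where
  "L2_0 \<mu> = {f \<in> L2 \<mu>. (\<integral>x. f x \<partial>\<mu>) = 0}"

definition L2_norm :: "'x measure \<Rightarrow> ('x \<Rightarrow> real) \<Rightarrow> real" where
  "L2_norm \<mu> f = sqrt (\<integral>x. (f x)\<^sup>2 \<partial>\<mu>)"

definition kernel_op :: "('x \<Rightarrow> 'x measure) \<Rightarrow> ('x \<Rightarrow> real) \<Rightarrow> 'x \<Rightarrow> real" where
  "kernel_op \<kappa> f x = (\<integral>y. f y \<partial>\<kappa> x)"

text \<open>Operator norm of the restriction of \<open>T\<close> to the mean-zero functions, from the space over
  \<open>\<mu>\<close> to the space over \<open>\<mu>'\<close>. As in \<^const>\<open>onorm\<close>, a quotient with denominator 0 counts as 0;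
  for a transition operator the numerator vanishes then as well. The supremum is taken in the
  extended reals, so that it is meaningful without a proof of boundedness.\<close>

definition L2_0_onorm ::
  "'x measure \<Rightarrow> 'x measure \<Rightarrow> (('x \<Rightarrow> real) \<Rightarrow> 'x \<Rightarrow> real) \<Rightarrow> ereal" where
  "L2_0_onorm \<mu> \<mu>' T = (SUP f\<in>L2_0 \<mu>. ereal (L2_norm \<mu>' (T f) / L2_norm \<mu> f))"


section \<open>Weak convergence of probability measures\<close>

definition weak_topology :: "'a::topological_space set \<Rightarrow> 'a measure topology" where
  "weak_topology S = topology_generated_by
     {{\<mu> \<in> space (prob_algebra (restrict_space borel S)). (\<integral>x. f x \<partial>\<mu>) \<in> U} | f U.
        continuous_on S (f :: 'a \<Rightarrow> real) \<and> bounded (f ` S) \<and> open U}"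

text \<open>The support of a measure on a subset of a topological space, relative to that subset.\<close>

definition measure_support :: "'a::topological_space measure \<Rightarrow> 'a set" where
  "measure_support \<nu> = {x \<in> space \<nu>. \<forall>U. open U \<longrightarrow> x \<in> U \<longrightarrow> emeasure \<nu> (U \<inter> space \<nu>) > 0}"


section \<open>The special linear group and its action on the unit sphere\<close>

definition SL :: "(real^'m^'m) set" where
  "SL = {A. det A = 1}"

definition SL_group :: "(real^'m^'m) monoid" where
  "SL_group = \<lparr>carrier = SL, mult = (**), one = mat 1\<rparr>"

lemma group_SL_group: "group (SL_group :: (real^'m^'m) monoid)"
proof (rule groupI)
  fix A :: "real^'m^'m"
  assume "A \<in> carrier SL_group"
  then have A: "det A = 1"
    by (simp add: SL_group_def SL_def)
  then obtain B where B: "B ** A = mat 1"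
    by (metis invertible_def invertible_det_nz zero_neq_one)
  then have "det B = 1"
    using A by (metis det_I det_mul mult.right_neutral)
  then show "\<exists>B\<in>carrier SL_group. B \<otimes>\<^bsub>SL_group\<^esub> A = \<one>\<^bsub>SL_group\<^esub>"
    using B by (auto simp: SL_group_def SL_def)
qed (auto simp: SL_group_def SL_def det_mul matrix_mul_assoc)

text \<open>The closed subgroup generated by the quotients of elements of the support.\<close>

definition G_of :: "(real^'m^'m) measure \<Rightarrow> (real^'m^'m) set" where
  "G_of \<nu> = (\<lambda>H. subgroup H SL_group \<and> closedin (top_of_set SL) H) hull
     {g \<otimes>\<^bsub>SL_group\<^esub> inv\<^bsub>SL_group\<^esub> h | g h. g \<in> measure_support \<nu> \<and> h \<in> measure_support \<nu>}"

definition sphere_act :: "real^'m^'m \<Rightarrow> real^'m \<Rightarrow> real^'m" where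
  "sphere_act g u = (g *v u) /\<^sub>R norm (g *v u)"

abbreviation sphere_borel :: "(real^'m) measure" where
  "sphere_borel \<equiv> restrict_space borel (sphere 0 1)"

definition preserves :: "real^'m^'m \<Rightarrow> (real^'m) measure \<Rightarrow> bool" where
  "preserves g \<kappa> \<longleftrightarrow> distr \<kappa> sphere_borel (sphere_act g) = \<kappa>"

text \<open>\<open>mat_prod g n\<close> is the product \<open>g n ** \<dots> ** g 1\<close>.\<close>

fun mat_prod :: "(nat \<Rightarrow> real^'m^'m) \<Rightarrow> nat \<Rightarrow> real^'m^'m" where
  "mat_prod g 0 = mat 1"
| "mat_prod g (Suc n) = g (Suc n) ** mat_prod g n"

end

theory Submission
  imports Defs
begin

text \<open>
  Let \<open>SL\<close> act on the square-integrable functions on \<open>\<real>\<^sup>m\<close> with Lebesgue measure by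
  \<open>(A a) z = a (A z)\<close>. Lebesgue measure is invariant under matrices of determinant 1, so this action
  preserves the square norm. The growth of a matrix \<open>A\<close> is visible in it: if \<open>B\<close> is the unit ball,
  the volume of \<open>{z \<in> B. A z \<in> B}\<close> is at least \<open>\<parallel>A\<parallel>\<^sup>-\<^sup>m vol B\<close> when \<open>\<parallel>A\<parallel> \<ge> 1\<close>. It is therefore
  enough that the expectation of this volume for \<open>A = g\<^sub>n \<dots> g\<^sub>1\<close> decays exponentially in \<open>n\<close>
  (\<open>expected_overlap_decay\<close>): then almost surely the volume itself decays exponentially.

  By the Markov property this expectation is computed backwards in time. Starting from the indicator
  of \<open>B\<close>, functions \<open>F x z\<close> on \<open>X \<times> \<real>\<^sup>m\<close> are transformed alternately by the rotation
  \<open>F x z \<mapsto> F x (\<gg>\<^sub>j x z)\<close> and by the transition operator \<open>K\<^sub>j\<close> in the variable \<open>x\<close>. Neither increases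
  the square norm with respect to \<open>\<mu>\<^sub>j\<close> and Lebesgue measure, and two consecutive rounds decrease it by
  a fixed factor (\<open>two_step_contraction\<close>). The reason is that \<open>K\<^sub>j\<close> shrinks the part of \<open>F\<close> that has
  mean zero in \<open>x\<close> by the factor \<open>c\<close>. What remains is the part \<open>a z\<close> that does not depend on \<open>x\<close>, and
  its rotation has the \<open>x\<close>-mean \<open>\<integral> a (A z) d\<nu>\<^sub>j(A)\<close>. If the square norm of this mean is at most
  \<open>1 - \<eta>\<close> times that of \<open>a\<close>, then the rotation creates a substantial mean-zero part, which the next
  transition operator shrinks.

  So everything rests on a spectral gap \<open>\<eta>\<close> for the averaging operators of the measures in the compact
  set \<open>M\<close> (\<open>uniform_gap\<close>). Suppose that the average \<open>b\<close> of the functions \<open>a (A z)\<close> over \<open>\<nu>\<close> has nearly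
  the square norm of \<open>a\<close>. Then most functions \<open>a (A z)\<close> are close to \<open>b\<close>. Let \<open>\<kappa>\<close> be the distribution
  of the direction \<open>z / \<parallel>z\<parallel>\<close> under the normalized density \<open>b\<^sup>2\<close>. Up to normalization, the image of \<open>\<kappa>\<close>
  under most \<open>A\<close> is close to the direction distribution for the density \<open>a\<^sup>2\<close>, which does not depend on
  \<open>A\<close>; hence these images are close to each other. But if no measure is invariant under \<open>G\<^sub>\<nu>\<close>, they cannot be close:
  a measure \<open>\<kappa>\<close> whose images under all \<open>A\<close> in the support of \<open>\<nu>\<close> coincide would make this common
  image invariant under all \<open>A B\<^sup>-\<^sup>1\<close>. Compactness of the set of probability measures on the sphere
  turns this into a quantitative statement about finitely many matrices in the support
  (\<open>uniform_separation\<close>). Small neighbourhoods of these matrices have positive mass for \<open>\<nu>\<close>, and not much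
  less for all measures weakly close to \<open>\<nu>\<close>, so the same gap holds in a weak neighbourhood of \<open>\<nu>\<close>
  (\<open>local_gap\<close>), and finitely many such neighbourhoods cover \<open>M\<close>.
\<close>

abbreviation (input) SL_borel :: "(real^'n^'n) measure" where
  "SL_borel \<equiv> restrict_space borel SL"

abbreviation (input) SL_probs :: "(real^'n^'n) measure set" where
  "SL_probs \<equiv> space (prob_algebra SL_borel)"

abbreviation (input) sphere_probs :: "(real^'n) measure set" where
  "sphere_probs \<equiv> space (prob_algebra sphere_borel)"

abbreviation (input) sq_norm :: "('a::euclidean_space \<Rightarrow> real) \<Rightarrow> real" where
  "sq_norm a \<equiv> \<integral>z. (a z)\<^sup>2 \<partial>lborel"

abbreviation (input) walk ::
  "(nat \<Rightarrow> 'x \<Rightarrow> real^'n^'n) \<Rightarrow> (nat \<Rightarrow> 'w \<Rightarrow> 'x) \<Rightarrow> nat \<Rightarrow> 'w \<Rightarrow> real^'n^'n" where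
  "walk g \<xi> n \<omega> \<equiv> mat_prod (\<lambda>i. g i (\<xi> i \<omega>)) n"

section \<open>Lebesgue measure is invariant under the special linear group\<close>

lemma lborel_distr_minus_left:
  fixes a :: "'a::euclidean_space"
  shows "distr lborel borel (\<lambda>x. a - x) = lborel"
  using lborel_affine[of "-1::real" a, symmetric] by (simp add: density_1)

text \<open>Uniqueness of Haar measure on a Euclidean space. Both sides are the integral of
  \<open>indicator A x * indicator B (x + y)\<close> over \<open>x\<close> and \<open>y\<close>, computed in the two orders of integration;
  in the second order \<open>x\<close> is first translated by \<open>- y\<close>.\<close>

lemma translation_invariant_proportional_lborel:
  fixes M :: "'a::euclidean_space measure"
  assumes sets_M [measurable_cong]: "sets M = sets borel"
    and sf: "sigma_finite_measure M"
    and inv: "\<And>a. distr M borel ((+) a) = M"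
    and A [measurable]: "A \<in> sets borel" and B [measurable]: "B \<in> sets borel"
  shows "emeasure M A * emeasure lborel B = emeasure M B * emeasure lborel A"
proof -
  interpret M: sigma_finite_measure M by fact
  interpret pair_sigma_finite lborel M
    by unfold_locales
  have eq1: "emeasure (distr lborel borel ((+) x)) B = (\<integral>\<^sup>+y. indicator B (x + y) \<partial>lborel)" for x
    by (simp add: nn_integral_indicator[symmetric] nn_integral_distr del: nn_integral_indicator)
  have eq2: "emeasure (distr lborel borel (\<lambda>y. x - y)) A
      = (\<integral>\<^sup>+y. indicator A (x - y) \<partial>lborel)" for x
    by (simp add: nn_integral_indicator[symmetric] nn_integral_distr del: nn_integral_indicator)
  have "emeasure M A * emeasure lborel B
      = (\<integral>\<^sup>+x. indicator A x * emeasure (distr lborel borel ((+) x)) B \<partial>M)"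
    by (simp add: lborel_distr_plus nn_integral_multc)
  also have "\<dots> = (\<integral>\<^sup>+x. (\<integral>\<^sup>+y. indicator A x * indicator B (x + y) \<partial>lborel) \<partial>M)"
    by (simp add: eq1 nn_integral_cmult)
  also have "\<dots> = (\<integral>\<^sup>+y. (\<integral>\<^sup>+x. indicator A x * indicator B (x + y) \<partial>M) \<partial>lborel)"
    by (rule Fubini') measurable
  also have "\<dots> = (\<integral>\<^sup>+y. (\<integral>\<^sup>+x. indicator A x * indicator B (x + y) \<partial>distr M borel ((+) (-y))) \<partial>lborel)"
    by (simp add: inv)
  also have "\<dots> = (\<integral>\<^sup>+y. (\<integral>\<^sup>+x. indicator A (x - y) * indicator B x \<partial>M) \<partial>lborel)"
    by (simp add: nn_integral_distr)
  also have "\<dots> = (\<integral>\<^sup>+x. (\<integral>\<^sup>+y. indicator A (x - y) * indicator B x \<partial>lborel) \<partial>M)"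
    by (rule Fubini'[symmetric]) measurable
  also have "\<dots> = (\<integral>\<^sup>+x. indicator B x * emeasure (distr lborel borel (\<lambda>y. x - y)) A \<partial>M)"
    by (simp add: eq2 nn_integral_cmult mult.commute[of _ "indicator B _"])
  also have "\<dots> = emeasure M B * emeasure lborel A"
    by (simp add: lborel_distr_minus_left nn_integral_multc)
  finally show ?thesis .
qed

lemma emeasure_unit_cube: "emeasure lborel (cbox 0 (1::real^'n)) = 1"
proof -
  have "cbox 0 (1::real^'n) \<noteq> {}" by (simp add: interval_ne_empty_cart)
  then have "measure lborel (cbox 0 (1::real^'n)) = 1" by (simp add: content_cbox_cart)
  then show ?thesis
    using emeasure_eq_ennreal_measure[of lborel "cbox 0 (1::real^'n)"] emeasure_lborel_cbox_finite[of 0 "1::real^'n"]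
    by (simp add: less_top)
qed

text \<open>The factor by which preimages under \<open>f\<close> change volume. For an invertible linear map it is the inverse of
  the absolute value of the determinant; that it exists at all follows from uniqueness of
  translation-invariant measures.\<close>

definition lin_scale :: "(real^'n \<Rightarrow> real^'n) \<Rightarrow> ennreal" where
  "lin_scale f = emeasure lborel (f -` cbox 0 1)"

text \<open>The image of Lebesgue measure under a linear bijection is translation invariant, because the map carries
  translations to translations. It is therefore a multiple of Lebesgue measure, and the unit cube gives the factor.\<close>

lemma lborel_linear_scale:
  fixes f :: "real^'n \<Rightarrow> real^'n"
  assumes f: "linear f" "inj f"
  shows "\<And>A. A \<in> sets borel \<Longrightarrow> emeasure lborel (f -` A) = lin_scale f * emeasure lborel A"
    and "lin_scale f < \<infinity>" and "lin_scale f > 0"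
proof -
  obtain h where h: "linear h" "h \<circ> f = id" "f \<circ> h = id"
    using linear_injective_left_inverse[OF f] left_inverse_linear linear_inverse_left f(1) by metis
  have [measurable]: "f \<in> borel \<rightarrow>\<^sub>M borel"
    using f by (intro borel_measurable_continuous_onI linear_continuous_on) (simp add: linear_linear)
  have vim: "f -` S = h ` S" for S
    using h(2,3) by (auto simp: fun_eq_iff image_iff) (metis)
  define M where "M = distr lborel borel f"
  have eM: "emeasure M S = emeasure lborel (f -` S)" if "S \<in> sets borel" for S
    unfolding M_def using that by (simp add: emeasure_distr)
  have fin: "emeasure M S < \<infinity>" if "compact S" for S
  proof -
    have "compact (f -` S)"
      unfolding vim using h(1) that
      by (intro compact_continuous_image linear_continuous_on) (simp_all add: linear_linear)
    then show ?thesis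
      using that emeasure_compact_finite[of "f -` S"] by (simp add: eM borel_compact)
  qed
  have "sigma_finite_measure M"
  proof
    show "\<exists>S. countable S \<and> S \<subseteq> sets M \<and> \<Union>S = space M \<and> (\<forall>a\<in>S. emeasure M a \<noteq> \<infinity>)"
    proof (intro exI conjI ballI)
      show "\<Union>(range (\<lambda>n. cball (0::real^'n) (real n))) = space M"
        using real_arch_simple by (fastforce simp: M_def)
    qed (use fin in \<open>auto simp: M_def less_top\<close>)
  qed
  note sf = this
  have tr: "distr M borel ((+) a) = M" for a
  proof -
    have "distr M borel ((+) a) = distr lborel borel (\<lambda>x. a + f x)"
      unfolding M_def by (subst distr_distr) (auto simp: comp_def)
    also have "(\<lambda>x. a + f x) = f \<circ> (\<lambda>x. h a + x)"
      using h(3) f(1) by (auto simp: fun_eq_iff linear_add)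
    also have "distr lborel borel \<dots> = distr (distr lborel borel ((+) (h a))) borel f"
      by (subst distr_distr) auto
    finally show ?thesis by (simp add: lborel_distr_plus M_def)
  qed
  have "sets M = sets borel" by (simp add: M_def)
  note proportional = translation_invariant_proportional_lborel[OF this sf tr]
  have unit: "emeasure lborel (cbox 0 (1::real^'n)) = 1"
    by (rule emeasure_unit_cube)
  have sc: "emeasure lborel (f -` S) = lin_scale f * emeasure lborel S" if "S \<in> sets borel" for S
    using proportional[OF that, of "cbox 0 1"] that unit by (simp add: eM lin_scale_def)
  then show "\<And>A. A \<in> sets borel \<Longrightarrow> emeasure lborel (f -` A) = lin_scale f * emeasure lborel A" .
  show "lin_scale f < \<infinity>"
    using fin[of "cbox 0 1"] by (simp add: eM lin_scale_def)
  have "lin_scale f \<noteq> 0"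
    using sc[of UNIV] by fastforce
  then show "lin_scale f > 0"
    by (simp add: zero_less_iff_neq_zero)
qed

lemma lin_scale_compose:
  fixes f g :: "real^'n \<Rightarrow> real^'n"
  assumes "linear f" "inj f" "linear g" "inj g"
  shows "lin_scale (f \<circ> g) = lin_scale f * lin_scale g"
proof -
  have [measurable]: "f \<in> borel \<rightarrow>\<^sub>M borel"
    using assms by (intro borel_measurable_continuous_onI linear_continuous_on) (simp add: linear_linear)
  have "f -` cbox 0 1 \<in> sets borel"
    using measurable_sets[of f borel borel "cbox 0 1"] by simp
  from lborel_linear_scale(1)[OF assms(3,4) this] show ?thesis
    unfolding lin_scale_def[of f] lin_scale_def[of "f \<circ> g"] vimage_comp[symmetric]
    by (simp only: mult.commute)
qed

lemma ennreal_square_eq_1: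
  fixes c :: ennreal assumes "c * c = 1" shows "c = 1"
proof (cases c)
  case (real r)
  then have "r * r = 1"
    using assms by (simp flip: ennreal_mult ennreal_1)
  then show ?thesis using real by (simp add: square_eq_1_iff)
next
  case top
  then show ?thesis using assms by (simp add: ennreal_top_mult)
qed

lemma matrix_det_compose:
  fixes f g :: "real^'n \<Rightarrow> real^'n"
  assumes "linear f" "linear g"
  shows "det (matrix (f \<circ> g)) = det (matrix f) * det (matrix g)"
  using matrix_compose[OF assms(2,1)] by (simp add: det_mul)

lemma lin_scale_id: "lin_scale (id :: real^'n \<Rightarrow> real^'n) = 1"
  unfolding lin_scale_def vimage_id id_apply by (rule emeasure_unit_cube)

lemma lin_scale_stretch:
  fixes c :: "'n::finite \<Rightarrow> real"
  assumes c: "\<And>i. c i \<noteq> 0"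
  shows "lin_scale (\<lambda>x::real^'n. \<chi> i. c i * x $ i) * ennreal \<bar>\<Prod>i\<in>UNIV. c i\<bar> = 1"
proof -
  let ?l = "(\<chi> i. min 0 (1 / c i)) :: real^'n" and ?u = "(\<chi> i. max 0 (1 / c i)) :: real^'n"
  have iff: "0 \<le> c i * t \<and> c i * t \<le> 1 \<longleftrightarrow> min 0 (1 / c i) \<le> t \<and> t \<le> max 0 (1 / c i)" for i t
  proof (cases "c i > 0")
    case True
    then show ?thesis by (auto simp: zero_le_mult_iff field_simps min_def max_def)
  next
    case False
    then have "c i < 0" using c[of i] by auto
    then show ?thesis by (auto simp: zero_le_mult_iff field_simps min_def max_def)
  qed
  have eq: "(\<lambda>x::real^'n. \<chi> i. c i * x $ i) -` cbox 0 1 = cbox ?l ?u"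
    by (auto simp: mem_box_cart iff)
  have "cbox ?l ?u \<noteq> {}"
    by (auto simp: interval_ne_empty_cart)
  then have "measure lborel (cbox ?l ?u) = (\<Prod>i\<in>UNIV. \<bar>1 / c i\<bar>)"
    by (subst content_cbox_cart) (assumption, intro prod.cong refl, auto simp: min_def max_def)
  then have "lin_scale (\<lambda>x::real^'n. \<chi> i. c i * x $ i) = ennreal (\<Prod>i\<in>UNIV. \<bar>1 / c i\<bar>)"
    unfolding lin_scale_def eq
    using emeasure_eq_ennreal_measure[of lborel "cbox ?l ?u"] emeasure_lborel_cbox_finite[of ?l ?u]
    by (simp add: less_top)
  also have "\<dots> * ennreal \<bar>\<Prod>i\<in>UNIV. c i\<bar> = ennreal ((\<Prod>i\<in>UNIV. \<bar>1 / c i\<bar>) * \<bar>\<Prod>i\<in>UNIV. c i\<bar>)"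
    by (simp add: ennreal_mult prod_nonneg)
  also have "(\<Prod>i\<in>UNIV. \<bar>1 / c i\<bar>) * \<bar>\<Prod>i\<in>UNIV. c i\<bar> = (\<Prod>i\<in>UNIV. \<bar>1 / c i\<bar> * \<bar>c i\<bar>)"
    by (simp only: abs_prod prod.distrib)
  also have "\<dots> = 1"
    using c by (intro prod.neutral) (simp add: field_simps)
  finally show ?thesis by simp
qed

text \<open>Both sides are multiplicative in \<open>f\<close>, so it is enough to treat elementary matrices. A diagonal matrix maps boxes
  to boxes. For a permutation and a shear the factor follows from an algebraic relation alone: the first is an
  involution, the second is conjugate to its square.\<close>

lemma lin_scale_det:
  fixes f :: "real^'n \<Rightarrow> real^'n"
  assumes "linear f" "det (matrix f) \<noteq> 0"
  shows "lin_scale f * ennreal \<bar>det (matrix f)\<bar> = 1"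
proof -
  have stretch_lin: "linear (\<lambda>x::real^'n. \<chi> i. c i * x $ i)" for c
    by (rule linearI) (simp_all add: vec_eq_iff algebra_simps)
  have stretch_det: "det (matrix (\<lambda>x::real^'n. \<chi> i. c i * x $ i)) = (\<Prod>i\<in>UNIV. c i)" for c
    by (simp add: matrix_def axis_def det_diagonal)
  have "linear f \<and> (det (matrix f) \<noteq> 0 \<longrightarrow> lin_scale f * ennreal \<bar>det (matrix f)\<bar> = 1)"
  proof (rule induct_linear_elementary[OF assms(1)])
    fix f g :: "real^'n \<Rightarrow> real^'n"
    assume fg: "linear f" "linear g"
      and f: "linear f \<and> (det (matrix f) \<noteq> 0 \<longrightarrow> lin_scale f * ennreal \<bar>det (matrix f)\<bar> = 1)"
      and g: "linear g \<and> (det (matrix g) \<noteq> 0 \<longrightarrow> lin_scale g * ennreal \<bar>det (matrix g)\<bar> = 1)"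
    show "linear (f \<circ> g) \<and> (det (matrix (f \<circ> g)) \<noteq> 0 \<longrightarrow>
        lin_scale (f \<circ> g) * ennreal \<bar>det (matrix (f \<circ> g))\<bar> = 1)"
    proof (intro conjI impI)
      show "linear (f \<circ> g)" using fg by (simp add: linear_compose)
      assume "det (matrix (f \<circ> g)) \<noteq> 0"
      then have nz: "det (matrix f) \<noteq> 0" "det (matrix g) \<noteq> 0"
        by (simp_all add: matrix_det_compose fg)
      then have "lin_scale (f \<circ> g) = lin_scale f * lin_scale g"
        using fg det_nz_iff_inj by (intro lin_scale_compose) auto
      then have "lin_scale (f \<circ> g) * ennreal \<bar>det (matrix (f \<circ> g))\<bar>
          = (lin_scale f * ennreal \<bar>det (matrix f)\<bar>) * (lin_scale g * ennreal \<bar>det (matrix g)\<bar>)"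
        by (simp add: matrix_det_compose fg abs_mult ennreal_mult mult_ac)
      then show "lin_scale (f \<circ> g) * ennreal \<bar>det (matrix (f \<circ> g))\<bar> = 1"
        using f g nz by simp
    qed
  next
    fix f :: "real^'n \<Rightarrow> real^'n" and i
    assume f: "linear f" and "\<And>x. f x $ i = 0"
    then have "\<not> surj f"
      by (metis (full_types) one_neq_zero surjE vec_component)
    then have "\<not> inj f"
      using f linear_injective_imp_surjective by blast
    then show "linear f \<and> (det (matrix f) \<noteq> 0 \<longrightarrow> lin_scale f * ennreal \<bar>det (matrix f)\<bar> = 1)"
      using det_nz_iff_inj[OF f] f by blast
  next
    fix c :: "'n \<Rightarrow> real"
    show "linear (\<lambda>x::real^'n. \<chi> i. c i * x $ i) \<and> (det (matrix (\<lambda>x::real^'n. \<chi> i. c i * x $ i)) \<noteq> 0 \<longrightarrow>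
        lin_scale (\<lambda>x::real^'n. \<chi> i. c i * x $ i) * ennreal \<bar>det (matrix (\<lambda>x::real^'n. \<chi> i. c i * x $ i))\<bar> = 1)"
      using stretch_lin lin_scale_stretch[of c] by (simp add: stretch_det)
  next
    fix m n :: 'n
    let ?h = "\<lambda>x::real^'n. \<chi> i. x $ Transposition.transpose m n i"
    have lin: "linear ?h"
      by (rule linearI) (simp_all add: vec_eq_iff)
    have hh: "?h \<circ> ?h = id"
      by (simp add: fun_eq_iff vec_eq_iff)
    then have inj: "inj ?h"
      by (metis inj_on_id inj_on_imageI2)
    have "lin_scale ?h * lin_scale ?h = 1"
      using lin_scale_compose[OF lin inj lin inj] by (simp add: hh lin_scale_id)
    then have 1: "lin_scale ?h = 1" by (rule ennreal_square_eq_1)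
    have "det (matrix ?h) * det (matrix ?h) = 1"
      using matrix_det_compose[OF lin lin] by (simp only: hh matrix_id_mat_1 det_I)
    then have "\<bar>det (matrix ?h)\<bar> = 1"
      by (auto simp: square_eq_1_iff)
    with 1 lin show "linear ?h \<and> (det (matrix ?h) \<noteq> 0 \<longrightarrow> lin_scale ?h * ennreal \<bar>det (matrix ?h)\<bar> = 1)"
      by simp
  next
    fix m n :: 'n
    assume "m \<noteq> n"
    let ?h = "\<lambda>x::real^'n. \<chi> i. if i = m then x $ m + x $ n else x $ i"
    let ?d = "\<lambda>x::real^'n. \<chi> i. (if i = m then 2 else 1) * x $ i"
    have lin: "linear ?h"
      by (rule linearI) (simp_all add: vec_eq_iff algebra_simps)
    \<comment> \<open>The shear is conjugate to its own square, so its volume factor and its determinant are idempotent.\<close>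
    have comm: "?d \<circ> ?h = ?h \<circ> (?h \<circ> ?d)"
      using \<open>m \<noteq> n\<close> by (simp add: fun_eq_iff vec_eq_iff)
    have lind: "linear ?d" by (rule stretch_lin)
    have detd: "det (matrix ?d) \<noteq> 0"
      by (subst stretch_det) simp
    have injd: "inj ?d"
      using det_nz_iff_inj[OF lind] detd by simp
    show "linear ?h \<and> (det (matrix ?h) \<noteq> 0 \<longrightarrow> lin_scale ?h * ennreal \<bar>det (matrix ?h)\<bar> = 1)"
    proof (intro conjI impI lin)
      assume nz: "det (matrix ?h) \<noteq> 0"
      then have inj: "inj ?h"
        using det_nz_iff_inj[OF lin] by simp
      have "lin_scale ?d * lin_scale ?h = lin_scale ?h * (lin_scale ?h * lin_scale ?d)"
        using arg_cong[OF comm, of lin_scale]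
        by (simp add: lin_scale_compose lin inj lind injd linear_compose inj_compose del: o_apply)
      then have "lin_scale ?h * (lin_scale ?h * lin_scale ?d) = 1 * (lin_scale ?h * lin_scale ?d)"
        by (simp add: mult.commute)
      moreover have "lin_scale ?h * lin_scale ?d \<noteq> 0" "lin_scale ?h * lin_scale ?d \<noteq> \<infinity>"
        using lborel_linear_scale(2,3)[OF lin inj] lborel_linear_scale(2,3)[OF lind injd]
        by (simp_all add: ennreal_mult_eq_top_iff zero_less_iff_neq_zero less_top)
      ultimately have 1: "lin_scale ?h = 1"
        using ennreal_mult_cancel_left[of "lin_scale ?h * lin_scale ?d" "lin_scale ?h" 1]
        by (simp only: mult.commute[of _ "lin_scale ?h * lin_scale ?d"] infinity_ennreal_def) blast
      have "det (matrix ?d) * det (matrix ?h) = det (matrix ?h) * (det (matrix ?h) * det (matrix ?d))"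
        using arg_cong[OF comm, of "\<lambda>f. det (matrix f)"]
        by (simp add: matrix_det_compose lin lind linear_compose del: o_apply)
      then have "det (matrix ?h) = 1"
        using nz detd by auto
      with 1 show "lin_scale ?h * ennreal \<bar>det (matrix ?h)\<bar> = 1" by simp
    qed
  qed
  then show ?thesis using assms(2) by blast
qed

lemma lborel_distr_SL:
  fixes A :: "real^'n^'n"
  assumes "A \<in> SL"
  shows "distr lborel borel ((*v) A) = lborel"
proof (rule measure_eqI)
  have det: "det A = 1" using assms by (simp add: SL_def)
  have lin: "linear ((*v) A)" by simp
  have inj: "inj ((*v) A)" using det_nz_iff_inj[OF lin] det by simp
  have scale: "lin_scale ((*v) A) = 1"
    using lin_scale_det[OF lin] det by simp
  have [measurable]: "(*v) A \<in> borel \<rightarrow>\<^sub>M borel"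
    by (intro borel_measurable_continuous_onI linear_continuous_on) (simp add: linear_linear)
  fix S assume "S \<in> sets (distr lborel borel ((*v) A))"
  then show "emeasure (distr lborel borel ((*v) A)) S = emeasure lborel S"
    using lborel_linear_scale(1)[OF lin inj, of S] scale by (simp add: emeasure_distr)
qed simp

section \<open>Weak compactness of the probability measures on the sphere\<close>

text \<open>The point of the Cantor set with ternary digits \<open>2 * b j\<close>. Its shifts are recovered by multiplication
  by powers of 3 up to even integers, which the 2-periodic function \<open>plateau\<close> below ignores.\<close>

definition ternary :: "(nat \<Rightarrow> real) \<Rightarrow> real" where
  "ternary b = (\<Sum>j. 2 * b j / 3 ^ Suc j)"

lemma ternary_summable:
  assumes "\<And>j. b j \<in> {0, 1}"
  shows "summable (\<lambda>j. 2 * b j / 3 ^ Suc j :: real)"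
proof (rule summable_comparison_test')
  show "summable (\<lambda>j. (2/3) * (1/3::real) ^ j)"
    by (intro summable_mult summable_geometric) simp
  show "norm (2 * b n / 3 ^ Suc n) \<le> (2/3) * (1/3::real) ^ n" for n
    using assms[of n] by (auto simp: power_one_over field_simps)
qed

lemma ternary_bounds:
  assumes "\<And>j. b j \<in> {0, 1}"
  shows "0 \<le> ternary b" "ternary b \<le> 1"
proof -
  have pos: "0 \<le> b j" "b j \<le> 1" for j using assms[of j] by auto
  show "0 \<le> ternary b"
    unfolding ternary_def by (intro suminf_nonneg ternary_summable assms) (simp add: pos)
  have geo: "(\<lambda>j. (2/3) * (1/3::real) ^ j) sums 1"
    using sums_mult[OF geometric_sums[of "1/3::real"], of "2/3"] by simp
  have "ternary b \<le> (\<Sum>j. (2/3) * (1/3::real) ^ j)"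
    unfolding ternary_def
  proof (rule suminf_le)
    show "2 * b n / 3 ^ Suc n \<le> (2/3) * (1/3::real) ^ n" for n
      using pos[of n] by (auto simp: power_one_over field_simps)
  qed (use geo ternary_summable[OF assms] in \<open>auto simp: sums_iff\<close>)
  also have "\<dots> = 1" using geo by (simp add: sums_iff)
  finally show "ternary b \<le> 1" .
qed

lemma ternary_shift:
  assumes "\<And>j. b j \<in> {0, 1}"
  shows "3 * ternary b = 2 * b 0 + ternary (\<lambda>j. b (Suc j))"
proof -
  have "ternary b = (\<Sum>j. 2 * b (Suc j) / 3 ^ Suc (Suc j)) + 2 * b 0 / 3"
    unfolding ternary_def by (subst suminf_split_head[OF ternary_summable[OF assms]]) simp
  also have "(\<Sum>j. 2 * b (Suc j) / 3 ^ Suc (Suc j)) = (\<Sum>j. (1/3) * (2 * b (Suc j) / 3 ^ Suc j))"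
    by simp
  also have "\<dots> = (1/3) * ternary (\<lambda>j. b (Suc j))"
    unfolding ternary_def using ternary_summable[of "\<lambda>j. b (Suc j)"] assms
    by (intro suminf_mult) auto
  finally show ?thesis by simp
qed

lemma ternary_shift_iterated:
  assumes "\<And>j. b j \<in> {0, 1}"
  shows "\<exists>q::int. 3 ^ n * ternary b = 2 * of_int q + ternary (\<lambda>j. b (n + j))"
proof (induction n)
  case 0
  show ?case by (rule exI[of _ 0]) simp
next
  case (Suc n)
  then obtain q :: int where q: "3 ^ n * ternary b = 2 * of_int q + ternary (\<lambda>j. b (n + j))" by blast
  obtain d :: int where d: "b n = of_int d" using assms[of n] by (metis insert_iff singletonD of_int_0 of_int_1)
  have "3 ^ Suc n * ternary b = 3 * (3 ^ n * ternary b)" by simp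
  also have "\<dots> = 2 * of_int (3 * q + d) + ternary (\<lambda>j. b (Suc n + j))"
    using ternary_shift[of "\<lambda>j. b (n + j)"] assms by (simp add: q d)
  finally show ?case by blast
qed

text \<open>A continuous 2-periodic function that is 0 on \<open>[0, 1/3]\<close> and 1 on \<open>[2/3, 1]\<close>.\<close>

definition plateau :: "real \<Rightarrow> real" where
  "plateau t = max 0 (min 1 (1/2 - cos (pi * t)))"

text \<open>Modulo 2, the number \<open>3 ^ n * ternary b\<close> is the Cantor point of the shifted sequence, which lies in
  \<open>[0, 1/3]\<close> or \<open>[2/3, 1]\<close> according to its first digit \<open>b n\<close>.\<close>

lemma plateau_reads_digit:
  assumes b: "\<And>j. b j \<in> {0, 1}"
  shows "plateau (3 ^ n * ternary b) = b n"
proof -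
  obtain q :: int where q: "3 ^ n * ternary b = 2 * of_int q + ternary (\<lambda>j. b (n + j))"
    using ternary_shift_iterated[of b n] b by blast
  define t where "t = ternary (\<lambda>j. b (n + j))"
  define r where "r = ternary (\<lambda>j. b (Suc n + j))"
  have t: "t = (2 * b n + r) / 3"
    using ternary_shift[of "\<lambda>j. b (n + j)"] b by (simp add: t_def r_def)
  have r: "0 \<le> r" "r \<le> 1"
    unfolding r_def using b by (auto intro!: ternary_bounds)
  have "cos (pi * (2 * of_int q + t)) = cos (pi * t + 2 * pi * of_int q)"
    by (simp add: algebra_simps)
  also have "\<dots> = cos (pi * t)"
    using cos_int_2pin[of q] sin_int_2pin[of q] by (simp add: cos_add mult.assoc)
  finally have cos: "cos (pi * (3 ^ n * ternary b)) = cos (pi * t)"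
    by (simp add: q t_def)
  show ?thesis
  proof (cases "b n = 0")
    case True
    then have "0 \<le> pi * t" "pi * t \<le> pi / 3" using r by (auto simp: t)
    then have "cos (pi / 3) \<le> cos (pi * t)"
      by (intro cos_monotone_0_pi_le) (use pi_gt_zero in linarith)+
    then show ?thesis using True by (simp add: plateau_def cos cos_60)
  next
    case False
    then have 1: "b n = 1" using b[of n] by auto
    then have "2 * pi / 3 \<le> pi * t" "pi * t \<le> pi" using r by (auto simp: t field_simps)
    then have "cos (pi * t) \<le> cos (2 * pi / 3)"
      by (intro cos_monotone_0_pi_le) (use pi_gt_zero in linarith)+
    also have "cos (2 * pi / 3) = - 1/2"
      using cos_120 by simp
    finally show ?thesis using 1 by (simp add: plateau_def cos)
  qed
qed

definition bin_digit :: "nat \<Rightarrow> real \<Rightarrow> real" where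
  "bin_digit k x = of_int (\<lfloor>2 ^ Suc k * x\<rfloor> - 2 * \<lfloor>2 ^ k * x\<rfloor>)"

lemma bin_digit_01: "bin_digit k x \<in> {0, 1}"
proof -
  have "\<lfloor>2 ^ Suc k * x\<rfloor> = 2 * \<lfloor>2 ^ k * x\<rfloor> \<or> \<lfloor>2 ^ Suc k * x\<rfloor> = 2 * \<lfloor>2 ^ k * x\<rfloor> + 1"
    unfolding power_Suc mult.assoc by linarith
  then show ?thesis unfolding bin_digit_def by auto
qed

text \<open>The partial sums telescope to \<open>\<lfloor>2 ^ n * x\<rfloor> / 2 ^ n\<close>.\<close>

lemma bin_digit_sums:
  assumes "0 \<le> x" "x < 1"
  shows "(\<lambda>k. bin_digit k x / 2 ^ Suc k) sums x"
proof -
  have part: "(\<Sum>k<n. bin_digit k x / 2 ^ Suc k) = of_int \<lfloor>2 ^ n * x\<rfloor> / 2 ^ n" for n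
  proof (induction n)
    case 0
    then show ?case using assms by (simp add: floor_eq_iff)
  next
    case (Suc n)
    then show ?case by (simp add: bin_digit_def field_simps)
  qed
  have "(\<lambda>n. of_int \<lfloor>2 ^ n * x\<rfloor> / 2 ^ n) \<longlonglongrightarrow> x"
  proof (rule LIM_zero_cancel, rule tendsto_rabs_zero_cancel,
      rule tendsto_sandwich[of "\<lambda>_. 0" _ _ "\<lambda>n. (1/2) ^ n"])
    show "(\<lambda>n. (1/2::real) ^ n) \<longlonglongrightarrow> 0" by (rule LIMSEQ_power_zero) simp
    show "\<forall>\<^sub>F n in sequentially. \<bar>of_int \<lfloor>2 ^ n * x\<rfloor> / 2 ^ n - x\<bar> \<le> (1/2) ^ n"
    proof (intro always_eventually allI)
      fix n
      have "\<bar>of_int \<lfloor>2 ^ n * x\<rfloor> - 2 ^ n * x\<bar> \<le> 1" by linarith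
      then have "\<bar>of_int \<lfloor>2 ^ n * x\<rfloor> - 2 ^ n * x\<bar> / 2 ^ n \<le> 1 / 2 ^ n"
        by (intro divide_right_mono) auto
      moreover have "of_int \<lfloor>2 ^ n * x\<rfloor> / 2 ^ n - x = (of_int \<lfloor>2 ^ n * x\<rfloor> - 2 ^ n * x) / 2 ^ n"
        by (simp add: field_simps)
      ultimately show "\<bar>of_int \<lfloor>2 ^ n * x\<rfloor> / 2 ^ n - x\<bar> \<le> (1/2) ^ n"
        by (simp add: power_one_over)
    qed
  qed auto
  then show ?thesis unfolding sums_def part .
qed

text \<open>Schoenberg's space-filling curve: the binary digits of all coordinates of a point are interleaved into
  one sequence, encoded as a Cantor point \<open>s x\<close>, and read off continuously by \<open>plateau\<close>. Only the
  section \<open>s\<close> is discontinuous, and it is a Borel function. This transfers questions about weak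
  convergence from the ball to the real line.\<close>

lemma space_filling_with_section:
  obtains p :: "real \<Rightarrow> real^'n" and s :: "real^'n \<Rightarrow> real"
  where "continuous_on UNIV p" and "s \<in> borel_measurable borel"
    and "\<And>x. 0 \<le> s x \<and> s x \<le> 1" and "\<And>x. norm x \<le> 1 \<Longrightarrow> p (s x) = x"
proof -
  obtain e :: "'n \<Rightarrow> nat" where e: "inj e"
    using finite_imp_inj_to_nat_seg[of "UNIV :: 'n set"] by auto
  \<comment> \<open>The affine map takes coordinates in \<open>[-1, 1]\<close> into \<open>[1/4, 3/4]\<close>, away from the end point 1, which the expansion misses.\<close>
  define b where "b x j = bin_digit (fst (prod_decode j)) ((x $ (inv_into UNIV e (snd (prod_decode j))) + 2) / 4)"
    for x :: "real^'n" and j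
  define s where "s x = ternary (b x)" for x
  define p where "p t = (\<chi> i. 4 * (\<Sum>k. plateau (3 ^ prod_encode (k, e i) * t) / 2 ^ Suc k) - 2)" for t
  have b01: "b x j \<in> {0, 1}" for x j
    unfolding b_def by (rule bin_digit_01)
  have cont_series: "continuous_on UNIV (\<lambda>t. \<Sum>k. plateau (3 ^ prod_encode (k, e i) * t) / 2 ^ Suc k)" for i
  proof (rule uniform_limit_theorem)
    show "\<forall>\<^sub>F n in sequentially. continuous_on UNIV
        (\<lambda>t. \<Sum>k<n. plateau (3 ^ prod_encode (k, e i) * t) / 2 ^ Suc k)"
      unfolding plateau_def by (intro always_eventually allI continuous_intros) auto
    show "uniform_limit UNIV (\<lambda>n t. \<Sum>k<n. plateau (3 ^ prod_encode (k, e i) * t) / 2 ^ Suc k)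
        (\<lambda>t. \<Sum>k. plateau (3 ^ prod_encode (k, e i) * t) / 2 ^ Suc k) sequentially"
    proof (rule Weierstrass_m_test)
      show "summable (\<lambda>k. (1/2) * (1/2::real) ^ k)"
        by (intro summable_mult summable_geometric) simp
      show "norm (plateau (3 ^ prod_encode (k, e i) * t) / 2 ^ Suc k) \<le> (1/2) * (1/2) ^ k" for k t
        by (auto simp: plateau_def power_one_over field_simps)
    qed
  qed simp
  show ?thesis
  proof
    show "continuous_on UNIV p"
      unfolding p_def by (intro continuous_on_vec_lambda continuous_intros cont_series)
    show "s \<in> borel_measurable borel"
      unfolding s_def ternary_def b_def bin_digit_def by measurable
    show "0 \<le> s x \<and> s x \<le> 1" for x
      unfolding s_def using ternary_bounds[OF b01] by auto
    fix x :: "real^'n" assume x: "norm x \<le> 1"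
    show "p (s x) = x"
    proof (subst vec_eq_iff, intro allI)
      fix i
      have "\<bar>x $ i\<bar> \<le> 1" using component_le_norm_cart[of x i] x by linarith
      then have "(\<lambda>k. bin_digit k ((x $ i + 2) / 4) / 2 ^ Suc k) sums ((x $ i + 2) / 4)"
        by (intro bin_digit_sums) auto
      moreover have "plateau (3 ^ prod_encode (k, e i) * s x) = bin_digit k ((x $ i + 2) / 4)" for k
        unfolding s_def plateau_reads_digit[OF b01] using e by (simp add: b_def)
      ultimately show "p (s x) $ i = x $ i"
        by (simp add: p_def sums_iff)
    qed
  qed
qed

text \<open>The section of the space-filling curve carries the measures to the interval \<open>[0, 1]\<close>, where they are
  tight, so that Helly's selection theorem gives a weakly convergent subsequence. The continuous curve
  carries the limit back.\<close>

lemma sphere_prob_weakly_compact: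
  fixes \<kappa> :: "nat \<Rightarrow> (real^'n) measure"
  assumes \<kappa>: "\<And>n. \<kappa> n \<in> sphere_probs"
  obtains r :: "nat \<Rightarrow> nat" and \<kappa>' where "strict_mono r" "\<kappa>' \<in> sphere_probs"
    "\<And>\<phi>. continuous_on (sphere 0 1) \<phi> \<Longrightarrow>
       (\<lambda>n. \<integral>u. \<phi> u \<partial>\<kappa> (r n)) \<longlonglongrightarrow> (\<integral>u. (\<phi> u :: real) \<partial>\<kappa>')"
proof -
  obtain p :: "real \<Rightarrow> real^'n" and s where ps: "continuous_on UNIV p" "s \<in> borel_measurable borel"
      "\<And>x. 0 \<le> s x \<and> s x \<le> 1" "\<And>x. norm x \<le> 1 \<Longrightarrow> p (s x) = x"
    using space_filling_with_section by metis
  note [measurable] = ps(2)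
  have p_meas [measurable]: "p \<in> borel \<rightarrow>\<^sub>M borel"
    using ps(1) by (rule borel_measurable_continuous_onI)
  have sets_\<kappa> [measurable_cong]: "sets (\<kappa> n) = sets sphere_borel" and prob: "prob_space (\<kappa> n)" for n
    using \<kappa>[of n] by (auto simp: space_prob_algebra)
  have space_\<kappa>: "space (\<kappa> n) = sphere 0 1" for n
    using sets_eq_imp_space_eq[OF sets_\<kappa>[of n]] by (simp add: space_restrict_space)
  have s_meas [measurable]: "s \<in> borel_measurable (\<kappa> n)" for n
  proof -
    have "s \<in> borel_measurable sphere_borel" by (intro measurable_restrict_space1) simp
    then show ?thesis by (simp add: measurable_cong_sets[OF sets_\<kappa> refl])
  qed
  define L where "L n = distr (\<kappa> n) borel s" for n
  have L: "real_distribution (L n)" for n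
  proof -
    interpret prob_space "\<kappa> n" by (rule prob)
    show ?thesis unfolding L_def by (intro real_distribution_distr) simp
  qed
  have "tight L"
    unfolding tight_def
  proof (intro conjI allI impI)
    fix \<epsilon> :: real assume "\<epsilon> > 0"
    have "measure (L n) {-1<..1} = 1" for n
    proof -
      interpret prob_space "\<kappa> n" by (rule prob)
      have "s -` {-1<..1} \<inter> space (\<kappa> n) = space (\<kappa> n)"
        using ps(3) by (auto simp: less_le_trans[of "-1" 0])
      then show ?thesis unfolding L_def by (subst measure_distr) (auto simp: prob_space)
    qed
    then show "\<exists>a b. a < b \<and> (\<forall>n. 1 - \<epsilon> < measure (L n) {a<..b})"
      using \<open>\<epsilon> > 0\<close> by (intro exI[of _ "-1"] exI[of _ 1]) auto
  qed (rule L)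
  from tight_imp_convergent_subsubsequence[OF this strict_mono_id]
  obtain r M where r: "strict_mono r" and M: "real_distribution M" and conv: "weak_conv_m (L \<circ> r) M"
    by (auto simp: comp_def)
  interpret M: real_distribution M by fact
  have lim: "(\<lambda>n. \<integral>u. \<phi> u \<partial>\<kappa> (r n)) \<longlonglongrightarrow> (\<integral>t. \<phi> (p t) \<partial>M)"
    if \<phi>: "continuous_on UNIV \<phi>" and bd: "\<And>x. \<bar>\<phi> x\<bar> \<le> C" for \<phi> :: "real^'n \<Rightarrow> real" and C
  proof -
    have [measurable]: "\<phi> \<in> borel_measurable borel"
      using \<phi> by (rule borel_measurable_continuous_onI)
    have "(\<lambda>n. \<integral>t. \<phi> (p t) \<partial>(L \<circ> r) n) \<longlonglongrightarrow> (\<integral>t. \<phi> (p t) \<partial>M)"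
    proof (rule weak_conv_imp_integral_bdd_continuous_conv[OF _ M conv])
      show "real_distribution ((L \<circ> r) n)" for n by (simp add: L)
      have "continuous_on UNIV (\<lambda>t. \<phi> (p t))"
        by (intro continuous_on_compose2[OF \<phi> ps(1)]) auto
      then show "isCont (\<lambda>t. \<phi> (p t)) x" for x
        by (simp add: continuous_on_eq_continuous_at)
      show "norm (\<phi> (p x)) \<le> C" for x using bd by simp
    qed
    also have "(\<lambda>n. \<integral>t. \<phi> (p t) \<partial>(L \<circ> r) n) = (\<lambda>n. \<integral>u. \<phi> u \<partial>\<kappa> (r n))"
    proof
      fix n
      have "(\<integral>t. \<phi> (p t) \<partial>(L \<circ> r) n) = (\<integral>u. \<phi> (p (s u)) \<partial>\<kappa> (r n))"
        unfolding L_def comp_def by (subst integral_distr) auto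
      also have "\<dots> = (\<integral>u. \<phi> u \<partial>\<kappa> (r n))"
        by (intro Bochner_Integration.integral_cong refl) (simp add: space_\<kappa> ps(4))
      finally show "(\<integral>t. \<phi> (p t) \<partial>(L \<circ> r) n) = (\<integral>u. \<phi> u \<partial>\<kappa> (r n))" .
    qed
    finally show ?thesis .
  qed
  \<comment> \<open>The limit is concentrated on the preimage of the sphere because the distance to the sphere has integral 0.\<close>
  have on_sphere: "AE t in M. norm (p t) = 1"
  proof -
    let ?\<phi> = "\<lambda>x::real^'n. min 1 \<bar>norm x - 1\<bar>"
    have "(\<lambda>n. \<integral>u. ?\<phi> u \<partial>\<kappa> (r n)) \<longlonglongrightarrow> (\<integral>t. ?\<phi> (p t) \<partial>M)"
      by (rule lim[of _ 1]) (auto intro!: continuous_intros)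
    moreover have "(\<integral>u. ?\<phi> u \<partial>\<kappa> (r n)) = 0" for n
      by (rule integral_eq_zero_AE, rule AE_I2) (simp add: space_\<kappa>)
    ultimately have "(\<integral>t. ?\<phi> (p t) \<partial>M) = 0"
      by (simp add: LIMSEQ_const_iff)
    moreover have "integrable M (\<lambda>t. ?\<phi> (p t))"
      by (rule M.integrable_const_bound[where B = 1]) auto
    ultimately have "AE t in M. ?\<phi> (p t) = 0"
      by (subst (asm) integral_nonneg_eq_0_iff_AE) auto
    then show ?thesis by eventually_elim (auto simp: min_def split: if_splits)
  qed
  define q where "q t = (if norm (p t) = 1 then p t else axis undefined 1)" for t
  have q_sphere: "q t \<in> sphere 0 1" for t
    by (simp add: q_def norm_axis_1)
  have q_meas [measurable]: "q \<in> M \<rightarrow>\<^sub>M sphere_borel"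
  proof (rule measurable_restrict_space2)
    show "q \<in> M \<rightarrow>\<^sub>M borel" unfolding q_def by measurable
  qed (use q_sphere in blast)
  define \<kappa>' where "\<kappa>' = distr M sphere_borel q"
  show ?thesis
  proof
    show "strict_mono r" by fact
    show "\<kappa>' \<in> sphere_probs"
      unfolding \<kappa>'_def space_prob_algebra using M.prob_space_distr[OF q_meas] by simp
    fix \<phi> :: "real^'n \<Rightarrow> real" assume \<phi>: "continuous_on (sphere 0 1) \<phi>"
    have "compact (\<phi> ` sphere 0 1)" by (intro compact_continuous_image \<phi>) simp
    then obtain C where C: "C > 0" "\<And>x. x \<in> sphere 0 1 \<Longrightarrow> \<bar>\<phi> x\<bar> \<le> C"
      by (auto dest!: compact_imp_bounded simp: bounded_pos)
    obtain \<phi>' where \<phi>': "continuous_on UNIV \<phi>'" "\<And>x. x \<in> sphere 0 1 \<Longrightarrow> \<phi>' x = \<phi> x"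
        "\<And>x. \<bar>\<phi>' x\<bar> \<le> C"
      by (rule Tietze[OF \<phi>, of UNIV C]) (use C in auto)
    have [measurable]: "\<phi>' \<in> borel_measurable borel"
      using \<phi>'(1) by (rule borel_measurable_continuous_onI)
    have [measurable]: "\<phi> \<in> borel_measurable sphere_borel"
      using \<phi> by (rule borel_measurable_continuous_on_restrict)
    have "(\<integral>u. \<phi> u \<partial>\<kappa>') = (\<integral>t. \<phi> (q t) \<partial>M)"
      unfolding \<kappa>'_def by (rule integral_distr) auto
    also have "\<dots> = (\<integral>t. \<phi>' (p t) \<partial>M)"
    proof (rule integral_cong_AE)
      show "AE t in M. \<phi> (q t) = \<phi>' (p t)"
        using on_sphere by eventually_elim (simp add: q_def \<phi>'(2))
    qed measurable
    finally have 1: "(\<integral>u. \<phi> u \<partial>\<kappa>') = (\<integral>t. \<phi>' (p t) \<partial>M)" .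
    have "(\<integral>u. \<phi> u \<partial>\<kappa> n) = (\<integral>u. \<phi>' u \<partial>\<kappa> n)" for n
      by (intro Bochner_Integration.integral_cong refl) (simp add: space_\<kappa> \<phi>'(2))
    then show "(\<lambda>n. \<integral>u. \<phi> u \<partial>\<kappa> (r n)) \<longlonglongrightarrow> (\<integral>u. \<phi> u \<partial>\<kappa>')"
      using lim[OF \<phi>'(1,3)] 1 by simp
  qed
qed

section \<open>Measures on the sphere invariant under the group of a support\<close>

lemma SL_mult_nonzero:
  assumes "A \<in> SL" "u \<noteq> 0"
  shows "A *v u \<noteq> 0"
proof -
  have "inj ((*v) A)"
    using assms(1) det_nz_iff_inj[of "(*v) A"] by (simp add: SL_def)
  then show ?thesis
    using assms(2) by (metis injD matrix_vector_mult_0_right)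
qed

lemma sphere_act_in_sphere:
  assumes "A \<in> SL" "u \<noteq> 0"
  shows "sphere_act A u \<in> sphere 0 1"
  using SL_mult_nonzero[OF assms] by (simp add: sphere_act_def)

lemma continuous_on_sphere_act:
  assumes "A \<in> SL"
  shows "continuous_on (sphere 0 1) (sphere_act A)"
proof -
  have "A *v u \<noteq> 0" if "u \<in> sphere 0 1" for u
    using that by (intro SL_mult_nonzero[OF assms]) auto
  then show ?thesis
    unfolding sphere_act_def
    by (intro continuous_intros linear_continuous_on) (auto simp: linear_linear)
qed

lemma measurable_sphere_act [measurable]:
  assumes "A \<in> SL"
  shows "sphere_act A \<in> sphere_borel \<rightarrow>\<^sub>M sphere_borel"
proof (rule measurable_restrict_space2)
  show "sphere_act A \<in> space sphere_borel \<rightarrow> sphere 0 1"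
  proof
    fix u :: "real^'a" assume "u \<in> space sphere_borel"
    then have "u \<noteq> 0" by (auto simp: space_restrict_space)
    then show "sphere_act A u \<in> sphere 0 1" by (rule sphere_act_in_sphere[OF assms])
  qed
  show "sphere_act A \<in> borel_measurable sphere_borel"
    by (intro borel_measurable_continuous_on_restrict continuous_on_sphere_act assms)
qed

lemma sphere_act_mult:
  assumes "A \<in> SL" "B \<in> SL" "u \<noteq> 0"
  shows "sphere_act A (sphere_act B u) = sphere_act (A ** B) u"
  using SL_mult_nonzero[OF assms(2,3)]
  by (simp add: sphere_act_def matrix_vector_mult_scaleR matrix_vector_mul_assoc field_simps)

lemma SL_mult_closed: "A \<in> SL \<Longrightarrow> B \<in> SL \<Longrightarrow> A ** B \<in> SL"
  by (simp add: SL_def det_mul)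

definition push :: "real^'n^'n \<Rightarrow> (real^'n) measure \<Rightarrow> (real^'n) measure" where
  "push A \<kappa> = distr \<kappa> sphere_borel (sphere_act A)"

lemma space_sphere_prob:
  assumes "\<kappa> \<in> sphere_probs"
  shows "sets \<kappa> = sets sphere_borel" "space \<kappa> = sphere 0 1" "prob_space \<kappa>"
  using assms sets_eq_imp_space_eq[of \<kappa> sphere_borel]
  by (auto simp: space_prob_algebra space_restrict_space)

lemma measurable_sphere_prob:
  assumes "\<kappa> \<in> sphere_probs" "f \<in> sphere_borel \<rightarrow>\<^sub>M M"
  shows "f \<in> \<kappa> \<rightarrow>\<^sub>M M"
  using assms(2) measurable_cong_sets[OF space_sphere_prob(1)[OF assms(1)] refl, of M] by simp

lemma push_prob:
  assumes "A \<in> SL" "\<kappa> \<in> sphere_probs"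
  shows "push A \<kappa> \<in> sphere_probs"
proof -
  interpret prob_space \<kappa> by (rule space_sphere_prob(3)[OF assms(2)])
  show ?thesis
    unfolding push_def space_prob_algebra
    using prob_space_distr[OF measurable_sphere_prob[OF assms(2) measurable_sphere_act[OF assms(1)]]] by simp
qed

lemma push_mult:
  assumes "A \<in> SL" "B \<in> SL" "\<kappa> \<in> sphere_probs"
  shows "push A (push B \<kappa>) = push (A ** B) \<kappa>"
  unfolding push_def
  apply (subst distr_distr)
    apply (rule measurable_sphere_act[OF assms(1)])
   apply (rule measurable_sphere_prob[OF assms(3) measurable_sphere_act[OF assms(2)]])
  apply (intro distr_cong refl)
  using space_sphere_prob(2)[OF assms(3)] assms(1,2) by (auto intro!: sphere_act_mult)

lemma push_id:
  assumes "\<kappa> \<in> sphere_probs"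
  shows "push (mat 1) \<kappa> = \<kappa>"
proof -
  have "push (mat 1) \<kappa> = distr \<kappa> \<kappa> (\<lambda>x. x)"
    unfolding push_def using space_sphere_prob[OF assms]
    by (intro distr_cong) (auto simp: sphere_act_def)
  then show ?thesis by (simp add: distr_id)
qed

lemma integral_push:
  assumes "A \<in> SL" "\<kappa> \<in> sphere_probs" "continuous_on (sphere 0 1) \<phi>"
  shows "(\<integral>u. \<phi> u \<partial>push A \<kappa>) = (\<integral>u. (\<phi> (sphere_act A u) :: real) \<partial>\<kappa>)"
  unfolding push_def
  by (intro integral_distr measurable_sphere_prob[OF assms(2)] measurable_sphere_act assms(1)
      borel_measurable_continuous_on_restrict assms(3))

text \<open>Bounded Lipschitz test functions, normalized so that they are uniformly equicontinuous; closeness of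
  the integrals of all of them metrizes weak convergence.\<close>

definition lip1 :: "('a::metric_space \<Rightarrow> real) \<Rightarrow> bool" where
  "lip1 \<phi> \<longleftrightarrow> (\<forall>x y. \<bar>\<phi> x - \<phi> y\<bar> \<le> dist x y) \<and> (\<forall>x. \<bar>\<phi> x\<bar> \<le> 1)"

text \<open>The integral of \<open>\<phi>\<close> with respect to the image of \<open>\<kappa>\<close> under the action of \<open>A\<close>.\<close>

abbreviation (input) act_mean :: "(real^'n \<Rightarrow> real) \<Rightarrow> real^'n^'n \<Rightarrow> (real^'n) measure \<Rightarrow> real" where
  "act_mean \<phi> A \<kappa> \<equiv> \<integral>u. \<phi> (sphere_act A u) \<partial>\<kappa>"

text \<open>In the bounded Lipschitz metric, every measure on the sphere has two images under \<open>F\<close> more than \<open>\<delta>\<close> apart.\<close>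

abbreviation (input) separates :: "(real^'n^'n) set \<Rightarrow> real \<Rightarrow> bool" where
  "separates F \<delta> \<equiv> \<forall>\<kappa>\<in>sphere_probs. \<exists>A\<in>F. \<exists>B\<in>F. \<exists>\<phi>. lip1 \<phi> \<and> \<delta> < \<bar>act_mean \<phi> A \<kappa> - act_mean \<phi> B \<kappa>\<bar>"

lemma lip1_continuous: "lip1 \<phi> \<Longrightarrow> continuous_on S \<phi>"
proof -
  assume "lip1 \<phi>"
  then have "1-lipschitz_on S \<phi>"
    by (intro lipschitz_onI) (auto simp: lip1_def dist_real_def)
  then show ?thesis by (rule lipschitz_on_continuous_on)
qed

lemma lip1_bump:
  assumes "n \<ge> 1"
  shows "lip1 (\<lambda>x. (1 / real n) * max 0 (1 - real n * infdist x C))"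
  unfolding lip1_def
proof (intro conjI allI)
  have n: "real n > 0" using assms by simp
  fix x y
  have "\<bar>infdist x C - infdist y C\<bar> \<le> dist x y"
    using infdist_triangle_abs by blast
  then have "\<bar>max 0 (1 - real n * infdist x C) - max 0 (1 - real n * infdist y C)\<bar> \<le> real n * dist x y"
  proof -
    assume *: "\<bar>infdist x C - infdist y C\<bar> \<le> dist x y"
    have "\<bar>real n * infdist x C - real n * infdist y C\<bar> \<le> real n * dist x y"
      using mult_left_mono[OF *, of "real n"] n by (simp add: abs_mult right_diff_distrib[symmetric])
    then show ?thesis by linarith
  qed
  then have "(1 / real n) * \<bar>max 0 (1 - real n * infdist x C) - max 0 (1 - real n * infdist y C)\<bar> \<le> dist x y"
    using n by (simp add: field_simps)
  then show "\<bar>1 / real n * max 0 (1 - real n * infdist x C) - 1 / real n * max 0 (1 - real n * infdist y C)\<bar> \<le> dist x y"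
    using n by (simp only: right_diff_distrib[symmetric] abs_mult) simp
  have "0 \<le> real n * infdist x C" by (simp add: infdist_nonneg)
  then have "max 0 (1 - real n * infdist x C) \<le> 1" by linarith
  then have "(1 / real n) * max 0 (1 - real n * infdist x C) \<le> 1 * 1"
    using assms by (intro mult_mono) auto
  then show "\<bar>1 / real n * max 0 (1 - real n * infdist x C)\<bar> \<le> 1" by simp
qed

lemma bump_tendsto_indicator:
  assumes "closed C" "C \<noteq> {}"
  shows "(\<lambda>n. max 0 (1 - real (Suc n) * infdist x C)) \<longlonglongrightarrow> indicator C x"
proof (cases "x \<in> C")
  case True
  then show ?thesis by simp
next
  case False
  then have pos: "infdist x C > 0"
    using assms infdist_nonneg[of x C] in_closed_iff_infdist_zero by fastforce
  obtain N where N: "1 / infdist x C < real N" using reals_Archimedean2 by blast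
  have "max 0 (1 - real (Suc n) * infdist x C) = 0" if "n \<ge> N" for n
  proof -
    have "1 < real N * infdist x C" using N pos by (simp add: field_simps)
    also have "\<dots> \<le> real (Suc n) * infdist x C" using that pos by (intro mult_right_mono) auto
    finally show ?thesis by simp
  qed
  then have "\<forall>\<^sub>F n in sequentially. max 0 (1 - real (Suc n) * infdist x C) = 0"
    unfolding eventually_sequentially by blast
  then show ?thesis using False by (simp add: tendsto_eventually)
qed

text \<open>The indicator of a closed set \<open>C\<close> is the limit of the functions \<open>max 0 (1 - n * infdist x C)\<close>, which
  are multiples of normalized Lipschitz functions, and closed sets generate the Borel sets.\<close>

lemma sphere_prob_eqI:
  fixes \<kappa> \<kappa>' :: "(real^'n) measure"
  assumes \<kappa>: "\<kappa> \<in> sphere_probs" "\<kappa>' \<in> sphere_probs"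
    and eq: "\<And>\<phi>. lip1 \<phi> \<Longrightarrow> (\<integral>u. \<phi> u \<partial>\<kappa>) = (\<integral>u. \<phi> u \<partial>\<kappa>')"
  shows "\<kappa> = \<kappa>'"
proof -
  have closed_eq: "measure \<eta> (C \<inter> sphere 0 1)
      = lim (\<lambda>n. real (Suc n) * (\<integral>u. (1 / real (Suc n)) * max 0 (1 - real (Suc n) * infdist u C) \<partial>\<eta>))"
    if \<eta>: "\<eta> \<in> sphere_probs" and C: "closed C" "C \<noteq> {}" for \<eta> :: "(real^'n) measure" and C
  proof -
    interpret prob_space \<eta> by (rule space_sphere_prob(3)[OF \<eta>])
    have meas: "f \<in> borel_measurable \<eta>" if "f \<in> borel_measurable borel" for f :: "_ \<Rightarrow> real"
      using that by (intro measurable_sphere_prob[OF \<eta>] measurable_restrict_space1)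
    have sp: "C \<inter> sphere 0 1 \<in> sets \<eta>"
      unfolding space_sphere_prob(1)[OF \<eta>] sets_restrict_space
      by (rule image_eqI[of _ _ C]) (simp_all add: Int_commute C)
    have "(\<lambda>n. \<integral>u. max 0 (1 - real (Suc n) * infdist u C) \<partial>\<eta>) \<longlonglongrightarrow> (\<integral>u. indicator C u \<partial>\<eta>)"
    proof (rule integral_dominated_convergence[where w = "\<lambda>_. 1"])
      show "(indicator C :: _ \<Rightarrow> real) \<in> borel_measurable \<eta>"
        using C by (intro meas) simp
      show "(\<lambda>u. max 0 (1 - real (Suc n) * infdist u C)) \<in> borel_measurable \<eta>" for n
        by (intro meas borel_measurable_continuous_onI continuous_intros)
      show "AE u in \<eta>. norm (max 0 (1 - real (Suc n) * infdist u C)) \<le> 1" for n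
        by (intro AE_I2) (auto simp: max_def infdist_nonneg)
    qed (use bump_tendsto_indicator[OF C] in auto)
    then have L: "lim (\<lambda>n. \<integral>u. max 0 (1 - real (Suc n) * infdist u C) \<partial>\<eta>) = (\<integral>u. indicator C u \<partial>\<eta>)"
      by (rule limI)
    have "(\<integral>u. indicator C u \<partial>\<eta>) = measure \<eta> (C \<inter> sphere 0 1)"
      by (simp add: space_sphere_prob(2)[OF \<eta>])
    moreover have "real (Suc n) * (\<integral>u. (1 / real (Suc n)) * max 0 (1 - real (Suc n) * infdist u C) \<partial>\<eta>)
        = (\<integral>u. max 0 (1 - real (Suc n) * infdist u C) \<partial>\<eta>)" for n
      by (subst integral_mult_right_zero) (simp del: of_nat_Suc)
    ultimately show ?thesis
      using L by (simp only:)
  qed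
  let ?D = "\<lambda>\<eta>. distr \<eta> borel (\<lambda>x::real^'n. x)"
  have id_meas: "(\<lambda>x. x) \<in> borel_measurable \<eta>" if "\<eta> \<in> sphere_probs" for \<eta> :: "(real^'n) measure"
    by (intro measurable_sphere_prob[OF that] measurable_restrict_space1) simp
  have D: "emeasure (?D \<eta>) B = emeasure \<eta> (B \<inter> sphere 0 1)"
    if "\<eta> \<in> sphere_probs" "B \<in> sets borel" for \<eta> :: "(real^'n) measure" and B
    using that by (subst emeasure_distr) (auto simp: id_meas space_sphere_prob(2)[OF that(1)])
  have "?D \<kappa> = ?D \<kappa>'"
  proof (rule measure_eqI_generator_eq[where E = "Collect closed" and A = "\<lambda>_. UNIV" and \<Omega> = UNIV])
    show "Int_stable (Collect closed :: (real^'n) set set)" by (auto simp: Int_stable_def)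
    show "sets (?D \<kappa>) = sigma_sets UNIV (Collect closed)" "sets (?D \<kappa>') = sigma_sets UNIV (Collect closed)"
      by (simp_all add: borel_eq_closed)
    interpret K: prob_space "?D \<kappa>"
      using \<kappa>(1) by (intro prob_space.prob_space_distr space_sphere_prob(3) id_meas)
    show "emeasure (?D \<kappa>) UNIV \<noteq> \<infinity>" for i :: nat
      by (metis K.emeasure_finite infinity_ennreal_def)
    fix C :: "(real^'n) set" assume "C \<in> Collect closed"
    then have C: "closed C" by simp
    show "emeasure (?D \<kappa>) C = emeasure (?D \<kappa>') C"
    proof (cases "C = {}")
      case False
      have "(\<integral>u. (1 / real (Suc n)) * max 0 (1 - real (Suc n) * infdist u C) \<partial>\<kappa>)
          = (\<integral>u. (1 / real (Suc n)) * max 0 (1 - real (Suc n) * infdist u C) \<partial>\<kappa>')" for n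
        by (rule eq[OF lip1_bump]) simp
      then have "measure \<kappa> (C \<inter> sphere 0 1) = measure \<kappa>' (C \<inter> sphere 0 1)"
        unfolding closed_eq[OF \<kappa>(1) C False] closed_eq[OF \<kappa>(2) C False]
        by (simp only:)
      moreover have "finite_measure \<kappa>" "finite_measure \<kappa>'"
        using space_sphere_prob(3)[OF \<kappa>(1)] space_sphere_prob(3)[OF \<kappa>(2)] by (simp_all add: prob_space_def)
      ultimately show ?thesis
        unfolding D[OF \<kappa>(1) borel_closed[OF C]] D[OF \<kappa>(2) borel_closed[OF C]]
        by (simp add: finite_measure.emeasure_eq_measure)
    qed simp
  qed auto
  show ?thesis
  proof (rule measure_eqI)
    show "sets \<kappa> = sets \<kappa>'" by (simp add: space_sphere_prob(1) \<kappa>)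
    fix A assume "A \<in> sets \<kappa>"
    then have "A \<in> (\<inter>) (sphere 0 1) ` sets borel"
      by (simp only: space_sphere_prob(1)[OF \<kappa>(1)] sets_restrict_space)
    then obtain B where "B \<in> sets borel" "A = B \<inter> sphere 0 1"
      by blast
    then show "emeasure \<kappa> A = emeasure \<kappa>' A"
      using D[OF \<kappa>(1), of B] D[OF \<kappa>(2), of B] \<open>?D \<kappa> = ?D \<kappa>'\<close> by metis
  qed
qed

lemma push_integral_tendsto:
  fixes A :: "nat \<Rightarrow> real^'n^'n"
  assumes "\<And>n. A n \<in> SL" "B \<in> SL" "A \<longlonglongrightarrow> B" "\<kappa> \<in> sphere_probs" "lip1 \<phi>"
  shows "(\<lambda>n. act_mean \<phi> (A n) \<kappa>) \<longlonglongrightarrow> act_mean \<phi> B \<kappa>"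
proof -
  interpret prob_space \<kappa> by (rule space_sphere_prob(3)[OF assms(4)])
  have \<phi>: "\<phi> \<in> borel_measurable sphere_borel"
    by (intro borel_measurable_continuous_on_restrict lip1_continuous assms(5))
  have meas: "(\<lambda>u. \<phi> (sphere_act h u)) \<in> borel_measurable \<kappa>" if "h \<in> SL" for h
    using measurable_compose[OF measurable_sphere_act[OF that] \<phi>]
    by (rule measurable_sphere_prob[OF assms(4)])
  show ?thesis
  proof (rule integral_dominated_convergence[where w = "\<lambda>_. 1"])
    show "AE u in \<kappa>. (\<lambda>n. \<phi> (sphere_act (A n) u)) \<longlonglongrightarrow> \<phi> (sphere_act B u)"
    proof (rule AE_I2)
      fix u assume "u \<in> space \<kappa>"
      then have "u \<noteq> 0" using space_sphere_prob(2)[OF assms(4)] by auto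
      then have "B *v u \<noteq> 0" by (rule SL_mult_nonzero[OF assms(2)])
      have "(\<lambda>n. A n *v u) \<longlonglongrightarrow> B *v u"
      proof (rule vec_tendstoI)
        fix i
        show "(\<lambda>n. (A n *v u) $ i) \<longlonglongrightarrow> (B *v u) $ i"
          unfolding matrix_vector_mult_def vec_lambda_beta
          by (intro tendsto_sum tendsto_mult tendsto_const tendsto_vec_nth assms(3))
      qed
      then have "(\<lambda>n. sphere_act (A n) u) \<longlonglongrightarrow> sphere_act B u"
        unfolding sphere_act_def using \<open>B *v u \<noteq> 0\<close> by (intro tendsto_intros) auto
      then show "(\<lambda>n. \<phi> (sphere_act (A n) u)) \<longlonglongrightarrow> \<phi> (sphere_act B u)"
        using lip1_continuous[OF assms(5), of UNIV] continuous_on_tendsto_compose by fastforce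
    qed
  qed (use assms meas in \<open>auto simp: lip1_def\<close>)
qed

lemma push_eqI:
  assumes "A \<in> SL" "B \<in> SL" "\<kappa> \<in> sphere_probs" "\<kappa>' \<in> sphere_probs"
    and "\<And>\<phi>. lip1 \<phi> \<Longrightarrow> act_mean \<phi> A \<kappa> = act_mean \<phi> B \<kappa>'"
  shows "push A \<kappa> = push B \<kappa>'"
  using assms by (intro sphere_prob_eqI push_prob) (auto simp: integral_push lip1_continuous)

lemma mult_SL: "A \<otimes>\<^bsub>SL_group\<^esub> B = A ** B"
  and one_SL: "\<one>\<^bsub>SL_group\<^esub> = mat 1"
  by (simp_all add: SL_group_def)

text \<open>Closedness holds because, for a fixed test function, the integral against the image of \<open>\<kappa>\<close> is continuous in
  the matrix (\<open>push_integral_tendsto\<close>).\<close>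

lemma stabilizer_closed_subgroup:
  fixes \<kappa> :: "(real^'n) measure"
  assumes \<kappa>: "\<kappa> \<in> sphere_probs"
  defines "H \<equiv> {A \<in> SL. preserves A \<kappa>}"
  shows "subgroup H SL_group \<and> closedin (top_of_set SL) H"
proof
  interpret group "SL_group :: (real^'n^'n) monoid" by (rule group_SL_group)
  have pres: "preserves A \<kappa> \<longleftrightarrow> push A \<kappa> = \<kappa>" for A by (simp add: preserves_def push_def)
  have car: "carrier SL_group = (SL :: (real^'n^'n) set)" by (simp add: SL_group_def)
  show "subgroup H SL_group"
  proof (rule subgroupI)
    show "H \<subseteq> carrier SL_group" by (auto simp: H_def car)
    have "mat 1 \<in> H" by (simp add: H_def pres push_id[OF \<kappa>] SL_def)
    then show "H \<noteq> {}" by blast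
  next
    fix A assume "A \<in> H"
    then have A: "A \<in> SL" "push A \<kappa> = \<kappa>" by (auto simp: H_def pres)
    have iA: "inv\<^bsub>SL_group\<^esub> A \<in> SL" using inv_closed[of A] A by (simp add: car)
    have "inv\<^bsub>SL_group\<^esub> A ** A = mat 1" using l_inv[of A] A by (simp add: car mult_SL one_SL)
    then have "push (inv\<^bsub>SL_group\<^esub> A) (push A \<kappa>) = \<kappa>"
      using push_mult[OF iA A(1) \<kappa>] push_id[OF \<kappa>] by simp
    then show "inv\<^bsub>SL_group\<^esub> A \<in> H" using A iA by (simp add: H_def pres)
  next
    fix A B assume "A \<in> H" "B \<in> H"
    then have "A \<in> SL" "B \<in> SL" "push A \<kappa> = \<kappa>" "push B \<kappa> = \<kappa>" by (auto simp: H_def pres)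
    then show "A \<otimes>\<^bsub>SL_group\<^esub> B \<in> H"
      using push_mult[of A B \<kappa>] \<kappa> by (simp add: H_def pres SL_group_def SL_mult_closed)
  qed
  show "closedin (top_of_set SL) H"
    unfolding closedin_limpt
  proof (intro conjI allI impI)
    show "H \<subseteq> SL" by (auto simp: H_def)
    fix B assume B: "B islimpt H \<and> B \<in> SL"
    then obtain A where *: "(\<forall>n::nat. A n \<in> H) \<and> A \<longlonglongrightarrow> B \<and> B \<in> SL"
      unfolding islimpt_sequential by auto
    then have A: "A n \<in> SL" "push (A n) \<kappa> = \<kappa>" for n by (auto simp: H_def pres)
    have "push B \<kappa> = push (mat 1) \<kappa>"
    proof (rule push_eqI)
      fix \<phi> :: "real^'n \<Rightarrow> real" assume \<phi>: "lip1 \<phi>"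
      have "(\<lambda>n. act_mean \<phi> (A n) \<kappa>) \<longlonglongrightarrow> act_mean \<phi> B \<kappa>"
        using * A \<kappa> \<phi> by (intro push_integral_tendsto) auto
      moreover have "(act_mean \<phi> (A n) \<kappa>) = (act_mean \<phi> (mat 1) \<kappa>)" for n
        using integral_push[OF A(1) \<kappa> lip1_continuous[OF \<phi>], of n]
          integral_push[OF _ \<kappa> lip1_continuous[OF \<phi>], of "mat 1"] A(2)[of n] push_id[OF \<kappa>]
        by (simp add: SL_def)
      ultimately show "act_mean \<phi> B \<kappa> = (act_mean \<phi> (mat 1) \<kappa>)"
        by (simp add: LIMSEQ_const_iff)
    qed (use * \<kappa> in \<open>auto simp: SL_def\<close>)
    then show "B \<in> H" using * by (simp add: H_def pres push_id[OF \<kappa>])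
  qed
qed

text \<open>If \<open>A\<close> and \<open>B\<close> carry \<open>\<kappa>\<close> to the same measure \<open>\<kappa>'\<close>, then \<open>A B\<^sup>-\<^sup>1\<close> fixes \<open>\<kappa>'\<close>. The stabilizer of \<open>\<kappa>'\<close> is a
  closed subgroup, so it contains the group generated by these quotients.\<close>

lemma common_image_imp_invariant:
  fixes \<nu> :: "(real^'n^'n) measure"
  assumes supp: "measure_support \<nu> \<subseteq> SL"
    and \<kappa>: "\<kappa> \<in> sphere_probs"
    and eq: "\<And>A B. A \<in> measure_support \<nu> \<Longrightarrow> B \<in> measure_support \<nu> \<Longrightarrow> push A \<kappa> = push B \<kappa>"
  shows "\<exists>\<kappa>'\<in>sphere_probs. \<forall>A\<in>G_of \<nu>. preserves A \<kappa>'"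
proof -
  interpret group "SL_group :: (real^'n^'n) monoid" by (rule group_SL_group)
  have car: "carrier SL_group = (SL :: (real^'n^'n) set)" by (simp add: SL_group_def)
  obtain \<kappa>' where \<kappa>': "\<kappa>' \<in> sphere_probs" "\<And>A. A \<in> measure_support \<nu> \<Longrightarrow> push A \<kappa> = \<kappa>'"
  proof (cases "measure_support \<nu> = {}")
    case False
    then obtain B where "B \<in> measure_support \<nu>" by blast
    then show ?thesis using that[of "push B \<kappa>"] eq push_prob[OF _ \<kappa>] supp by blast
  qed (use \<kappa> that in blast)
  have "G_of \<nu> \<subseteq> {A \<in> SL. preserves A \<kappa>'}"
    unfolding G_of_def
  proof (rule hull_minimal)
    show "subgroup {A \<in> SL. preserves A \<kappa>'} SL_group \<and> closedin (top_of_set SL) {A \<in> SL. preserves A \<kappa>'}"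
      by (rule stabilizer_closed_subgroup[OF \<kappa>'(1)])
    show "{A \<otimes>\<^bsub>SL_group\<^esub> inv\<^bsub>SL_group\<^esub> B |A B. A \<in> measure_support \<nu> \<and> B \<in> measure_support \<nu>}
        \<subseteq> {A \<in> SL. preserves A \<kappa>'}"
    proof safe
      fix A B assume AB: "A \<in> measure_support \<nu>" "B \<in> measure_support \<nu>"
      then have SL: "A \<in> SL" "B \<in> SL" using supp by auto
      let ?I = "inv\<^bsub>SL_group\<^esub> B"
      have I: "?I \<in> SL" using inv_closed[of B] SL by (simp add: car)
      have IB: "?I ** B = mat 1" using l_inv[of B] SL by (simp add: car mult_SL one_SL)
      have mult: "A \<otimes>\<^bsub>SL_group\<^esub> ?I = A ** ?I" by (simp add: SL_group_def)
      show "A \<otimes>\<^bsub>SL_group\<^esub> ?I \<in> SL" unfolding mult by (intro SL_mult_closed SL I)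
      have "push (A ** ?I) (push B \<kappa>) = push (A ** (?I ** B)) \<kappa>"
        by (subst push_mult) (simp_all add: SL_mult_closed SL I \<kappa> matrix_mul_assoc)
      then show "preserves (A \<otimes>\<^bsub>SL_group\<^esub> ?I) \<kappa>'"
        unfolding mult IB preserves_def push_def[symmetric] using \<kappa>'(2) AB by simp
    qed
  qed
  then show ?thesis using \<kappa>'(1) by blast
qed

text \<open>If finitely many matrices never suffice, exhaust a countable dense subset of the support by finite sets and
  choose measures that the first \<open>n\<close> matrices fail to separate by \<open>1 / n\<close>. All matrices of the dense subset,
  and by continuity all of the support, have the same image of a weak limit of these measures, which is
  excluded by \<open>common_image_imp_invariant\<close>.\<close>

lemma uniform_separation:
  fixes \<nu> :: "(real^'n^'n) measure"
  assumes supp: "measure_support \<nu> \<subseteq> SL"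
    and no_inv: "\<not> (\<exists>\<kappa>\<in>sphere_probs. \<forall>A\<in>G_of \<nu>. preserves A \<kappa>)"
  shows "\<exists>F \<delta>. finite F \<and> F \<subseteq> measure_support \<nu> \<and> 0 < (\<delta>::real) \<and>
    separates F \<delta>"
proof (rule ccontr)
  assume none: "\<not> ?thesis"
  have neg: "\<exists>\<kappa>\<in>sphere_probs. \<forall>A\<in>F. \<forall>B\<in>F. \<forall>\<phi>. lip1 \<phi> \<longrightarrow>
         \<bar>act_mean \<phi> A \<kappa> - act_mean \<phi> B \<kappa>\<bar> \<le> \<delta>"
    if "finite F" "F \<subseteq> measure_support \<nu>" "0 < \<delta>" for F and \<delta> :: real
  proof (rule ccontr)
    assume "\<not> ?thesis"
    then have "separates F \<delta>"
      by (simp add: not_le)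
    then show False using none that by blast
  qed
  obtain D where D: "countable D" "D \<subseteq> measure_support \<nu>" "measure_support \<nu> \<subseteq> closure D"
    using separable by blast
  define F where "F n = (if D = {} then {} else from_nat_into D ` {..n})" for n :: nat
  have F: "finite (F n)" "F n \<subseteq> measure_support \<nu>" for n
    using D(2) from_nat_into[of D] by (auto simp: F_def)
  have F_mem: "\<exists>N. \<forall>n\<ge>N. A \<in> F n" if "A \<in> D" for A
  proof (intro exI allI impI)
    fix n assume "n \<ge> to_nat_on D A"
    then show "A \<in> F n" using that D(1) by (auto simp: F_def intro!: image_eqI[of _ _ "to_nat_on D A"])
  qed
  define Q where "Q n \<kappa> \<longleftrightarrow> \<kappa> \<in> sphere_probs \<and> (\<forall>A\<in>F n. \<forall>B\<in>F n. \<forall>\<phi>. lip1 \<phi> \<longrightarrow>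
         \<bar>act_mean \<phi> A \<kappa> - act_mean \<phi> B \<kappa>\<bar> \<le> 1 / real (Suc n))" for n \<kappa>
  have "\<forall>n. \<exists>\<kappa>. Q n \<kappa>"
    unfolding Q_def Bex_def[symmetric] using neg[OF F] by simp
  then obtain \<kappa> where Q: "\<And>n. Q n (\<kappa> n)"
    using choice[of Q] by blast
  have \<kappa>: "\<And>n. \<kappa> n \<in> sphere_probs"
    "\<And>n A B \<phi>. A \<in> F n \<Longrightarrow> B \<in> F n \<Longrightarrow> lip1 \<phi> \<Longrightarrow>
      \<bar>(act_mean \<phi> A (\<kappa> n)) - (act_mean \<phi> B (\<kappa> n))\<bar> \<le> 1 / real (Suc n)"
    using Q unfolding Q_def by blast+
  obtain r \<kappa>' where r: "strict_mono r" and \<kappa>': "\<kappa>' \<in> sphere_probs"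
    and lim: "\<And>\<phi>. continuous_on (sphere 0 1) \<phi> \<Longrightarrow>
       (\<lambda>n. \<integral>u. \<phi> u \<partial>\<kappa> (r n)) \<longlonglongrightarrow> (\<integral>u. (\<phi> u :: real) \<partial>\<kappa>')"
    by (rule sphere_prob_weakly_compact[OF \<kappa>(1)]) (rule that)
  have lim': "(\<lambda>n. act_mean \<phi> A (\<kappa> (r n))) \<longlonglongrightarrow> act_mean \<phi> A \<kappa>'"
    if "A \<in> SL" "lip1 \<phi>" for A \<phi>
    by (intro lim continuous_on_compose2[OF lip1_continuous[OF that(2), of UNIV] continuous_on_sphere_act[OF that(1)]]) auto
  have eq_D: "act_mean \<phi> A \<kappa>' = act_mean \<phi> B \<kappa>'"
    if AB: "A \<in> D" "B \<in> D" and \<phi>: "lip1 \<phi>" for A B \<phi>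
  proof -
    have SL: "A \<in> SL" "B \<in> SL" using AB D(2) supp by auto
    obtain N1 N2 where N: "\<And>n. n \<ge> N1 \<Longrightarrow> A \<in> F n" "\<And>n. n \<ge> N2 \<Longrightarrow> B \<in> F n"
      using F_mem AB by meson
    have "(\<lambda>n. (act_mean \<phi> A (\<kappa> (r n))) - (act_mean \<phi> B (\<kappa> (r n)))) \<longlonglongrightarrow> 0"
    proof (rule Lim_null_comparison)
      show "\<forall>\<^sub>F n in sequentially. norm ((act_mean \<phi> A (\<kappa> (r n))) - (act_mean \<phi> B (\<kappa> (r n)))) \<le> 1 / real (Suc n)"
        unfolding eventually_sequentially
      proof (intro exI allI impI)
        fix n assume n: "n \<ge> max N1 N2"
        have "n \<le> r n" by (rule seq_suble[OF r])
        then have "norm ((act_mean \<phi> A (\<kappa> (r n))) - (act_mean \<phi> B (\<kappa> (r n)))) \<le> 1 / real (Suc (r n))"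
          using \<kappa>(2)[OF N(1) N(2) \<phi>, of "r n"] n by simp
        also have "\<dots> \<le> 1 / real (Suc n)" using \<open>n \<le> r n\<close> by (simp add: field_simps)
        finally show "norm ((act_mean \<phi> A (\<kappa> (r n))) - (act_mean \<phi> B (\<kappa> (r n)))) \<le> 1 / real (Suc n)" .
      qed
      show "(\<lambda>n. 1 / real (Suc n)) \<longlonglongrightarrow> 0"
        using LIMSEQ_inverse_real_of_nat by (simp add: inverse_eq_divide)
    qed
    moreover have "(\<lambda>n. (act_mean \<phi> A (\<kappa> (r n))) - (act_mean \<phi> B (\<kappa> (r n))))
        \<longlonglongrightarrow> act_mean \<phi> A \<kappa>' - act_mean \<phi> B \<kappa>'"
      by (intro tendsto_diff lim' SL \<phi>)
    ultimately have "0 = act_mean \<phi> A \<kappa>' - act_mean \<phi> B \<kappa>'"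
      by (rule LIMSEQ_unique)
    then show ?thesis by simp
  qed
  have eq_supp: "act_mean \<phi> A \<kappa>' = act_mean \<phi> B \<kappa>'"
    if A: "A \<in> measure_support \<nu>" and B: "B \<in> D" and \<phi>: "lip1 \<phi>" for A B \<phi>
  proof -
    obtain h where h: "\<And>n. h n \<in> D" "h \<longlonglongrightarrow> A"
      using D(3) A closure_sequential[of A D] by blast
    have "(\<lambda>n. act_mean \<phi> (h n) \<kappa>') \<longlonglongrightarrow> act_mean \<phi> A \<kappa>'"
    proof (rule push_integral_tendsto[OF _ _ h(2) \<kappa>' \<phi>])
      show "h n \<in> SL" for n using h(1)[of n] D(2) supp by blast
      show "A \<in> SL" using A supp by blast
    qed
    then have "(\<lambda>n. act_mean \<phi> B \<kappa>') \<longlonglongrightarrow> act_mean \<phi> A \<kappa>'"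
      by (simp only: eq_D[OF h(1) B \<phi>])
    then show ?thesis by (simp only: LIMSEQ_const_iff)
  qed
  have "\<exists>\<kappa>\<in>sphere_probs. \<forall>A\<in>G_of \<nu>. preserves A \<kappa>"
  proof (rule common_image_imp_invariant[OF supp \<kappa>'])
    fix A B assume AB: "A \<in> measure_support \<nu>" "B \<in> measure_support \<nu>"
    then obtain E where "E \<in> D" using D(3) by fastforce
    show "push A \<kappa>' = push B \<kappa>'"
    proof (rule push_eqI)
      show "A \<in> SL" "B \<in> SL" using AB supp by auto
      show "act_mean \<phi> A \<kappa>' = act_mean \<phi> B \<kappa>'" if "lip1 \<phi>" for \<phi>
        using eq_supp[OF AB(1) \<open>E \<in> D\<close> that] eq_supp[OF AB(2) \<open>E \<in> D\<close> that] by simp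
    qed (rule \<kappa>')+
  qed
  then show False using no_inv by blast
qed

section \<open>Averaging over separated matrices shrinks the square norm\<close>

lemma variance_bounded:
  fixes f :: "'a \<Rightarrow> real"
  assumes "prob_space M" and f [measurable]: "f \<in> borel_measurable M" and bd: "\<And>x. \<bar>f x\<bar> \<le> C"
  defines "m \<equiv> \<integral>x. f x \<partial>M"
  shows "(\<integral>x. (f x - m)\<^sup>2 \<partial>M) = (\<integral>x. (f x)\<^sup>2 \<partial>M) - m\<^sup>2"
    and "m\<^sup>2 \<le> (\<integral>x. (f x)\<^sup>2 \<partial>M)" and "\<bar>m\<bar> \<le> C"
    and "integrable M f" and "integrable M (\<lambda>x. (f x)\<^sup>2)"
proof -
  interpret prob_space M by fact
  show i1: "integrable M f"
    by (rule integrable_const_bound[where B = C]) (use bd in auto)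
  show i2: "integrable M (\<lambda>x. (f x)\<^sup>2)"
  proof (rule integrable_const_bound[where B = "C\<^sup>2"])
    have "(f x)\<^sup>2 \<le> C\<^sup>2" for x
      using power_mono[OF bd[of x] abs_ge_zero, of 2] by simp
    then show "AE x in M. norm ((f x)\<^sup>2) \<le> C\<^sup>2" by simp
  qed simp
  show eq: "(\<integral>x. (f x - m)\<^sup>2 \<partial>M) = (\<integral>x. (f x)\<^sup>2 \<partial>M) - m\<^sup>2"
    unfolding m_def by (rule variance_eq[OF i1 i2])
  have "0 \<le> (\<integral>x. (f x - m)\<^sup>2 \<partial>M)" by simp
  then show "m\<^sup>2 \<le> (\<integral>x. (f x)\<^sup>2 \<partial>M)" using eq by simp
  have "\<bar>m\<bar> \<le> (\<integral>x. \<bar>f x\<bar> \<partial>M)" unfolding m_def by simp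
  also have "\<dots> \<le> (\<integral>x. C \<partial>M)" using i1 bd by (intro integral_mono) auto
  finally show "\<bar>m\<bar> \<le> C" by (simp add: prob_space)
qed

lemma measurable_matrix_vector_mult:
  "(\<lambda>p::(real^'n^'n) \<times> (real^'n). fst p *v snd p) \<in> (borel \<Otimes>\<^sub>M borel) \<rightarrow>\<^sub>M (borel :: (real^'n) measure)"
proof -
  have "continuous_on UNIV (\<lambda>p::(real^'n^'n) \<times> (real^'n). fst p *v snd p)"
    unfolding matrix_vector_mult_def continuous_on_def
    by (intro ballI vec_tendstoI) (auto intro!: tendsto_intros tendsto_vec_nth)
  then show ?thesis
    unfolding borel_prod by (rule borel_measurable_continuous_onI)
qed

lemma measurable_matvec [measurable (raw)]:
  assumes "f \<in> M \<rightarrow>\<^sub>M (borel :: (real^'n^'n) measure)" "g \<in> M \<rightarrow>\<^sub>M borel"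
  shows "(\<lambda>x. f x *v g x) \<in> M \<rightarrow>\<^sub>M (borel :: (real^'n) measure)"
  using measurable_compose[OF measurable_Pair[OF assms] measurable_matrix_vector_mult] by simp

lemma integral_SL_invariant:
  fixes f :: "real^'n \<Rightarrow> real"
  assumes "A \<in> SL" and [measurable]: "f \<in> borel_measurable borel"
  shows "(\<integral>z. f (A *v z) \<partial>lborel) = (\<integral>z. f z \<partial>lborel)"
    and "integrable lborel (\<lambda>z. f (A *v z)) \<longleftrightarrow> integrable lborel f"
proof -
  have "(\<integral>z. f z \<partial>distr lborel borel ((*v) A)) = (\<integral>z. f (A *v z) \<partial>lborel)"
    by (rule integral_distr) measurable
  then show "(\<integral>z. f (A *v z) \<partial>lborel) = (\<integral>z. f z \<partial>lborel)"
    by (simp add: lborel_distr_SL[OF assms(1)])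
  have "integrable (distr lborel borel ((*v) A)) f \<longleftrightarrow> integrable lborel (\<lambda>z. f (A *v z))"
    by (rule integrable_distr_eq) measurable
  then show "integrable lborel (\<lambda>z. f (A *v z)) \<longleftrightarrow> integrable lborel f"
    by (simp add: lborel_distr_SL[OF assms(1)])
qed

lemma integrable_square_diff:
  fixes f g :: "'a \<Rightarrow> real"
  assumes [measurable]: "f \<in> borel_measurable M" "g \<in> borel_measurable M"
    and "integrable M (\<lambda>x. (f x)\<^sup>2)" "integrable M (\<lambda>x. (g x)\<^sup>2)"
  shows "integrable M (\<lambda>x. (f x - g x)\<^sup>2)" "integrable M (\<lambda>x. (f x + g x)\<^sup>2)"
proof -
  have i: "integrable M (\<lambda>x. 2 * (f x)\<^sup>2 + 2 * (g x)\<^sup>2)" using assms(3,4) by simp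
  have 1: "(f x - g x)\<^sup>2 \<le> 2 * (f x)\<^sup>2 + 2 * (g x)\<^sup>2" for x
    using zero_le_power2[of "f x + g x"] by (simp add: power2_eq_square algebra_simps)
  have 2: "(f x + g x)\<^sup>2 \<le> 2 * (f x)\<^sup>2 + 2 * (g x)\<^sup>2" for x
    using zero_le_power2[of "f x - g x"] by (simp add: power2_eq_square algebra_simps)
  show "integrable M (\<lambda>x. (f x - g x)\<^sup>2)"
    by (rule Bochner_Integration.integrable_bound[OF i]) (use 1 in auto)
  show "integrable M (\<lambda>x. (f x + g x)\<^sup>2)"
    by (rule Bochner_Integration.integrable_bound[OF i]) (use 2 in auto)
qed

text \<open>For fixed \<open>z\<close> this is the variance of \<open>a (A z)\<close> as \<open>A\<close> varies; integrating over \<open>z\<close>, the second moment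
  becomes the square norm of \<open>a\<close> because each \<open>A\<close> preserves Lebesgue measure.\<close>

lemma average_variance:
  fixes a :: "real^'n \<Rightarrow> real" and \<nu> :: "(real^'n^'n) measure"
  assumes \<nu>: "\<nu> \<in> SL_probs"
    and a [measurable]: "a \<in> borel_measurable borel" and bd: "\<And>z. \<bar>a z\<bar> \<le> C"
    and sq: "integrable lborel (\<lambda>z. (a z)\<^sup>2)"
  defines "b \<equiv> \<lambda>z. \<integral>A. a (A *v z) \<partial>\<nu>"
  shows "b \<in> borel_measurable borel" and "integrable lborel (\<lambda>z. (b z)\<^sup>2)"
    and "integrable \<nu> (\<lambda>A. \<integral>z. (a (A *v z) - b z)\<^sup>2 \<partial>lborel)"
    and "(\<integral>A. (\<integral>z. (a (A *v z) - b z)\<^sup>2 \<partial>lborel) \<partial>\<nu>) = sq_norm a - sq_norm b"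
proof -
  have sets_\<nu> [measurable_cong]: "sets \<nu> = sets SL_borel" and "prob_space \<nu>"
    using \<nu> by (auto simp: space_prob_algebra)
  interpret prob_space \<nu> by fact
  interpret pair_sigma_finite \<nu> lborel by unfold_locales
  have space_\<nu>: "space \<nu> = SL"
    using sets_eq_imp_space_eq[OF sets_\<nu>] by (simp add: space_restrict_space)
  have id [measurable]: "(\<lambda>A. A) \<in> \<nu> \<rightarrow>\<^sub>M borel"
    unfolding measurable_cong_sets[OF sets_\<nu> refl] by (rule measurable_restrict_space1) simp
  have am [measurable]: "(\<lambda>A. a (A *v z)) \<in> borel_measurable \<nu>" for z by measurable
  show b [measurable]: "b \<in> borel_measurable borel"
    unfolding b_def by measurable
  have b_eq: "(\<integral>A. a (A *v z) \<partial>\<nu>) = b z" for z by (simp add: b_def)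
  note var = variance_bounded[OF \<open>prob_space \<nu>\<close> am bd, unfolded b_eq]
  have a2m: "(\<lambda>z. (a z)\<^sup>2) \<in> borel_measurable borel" by measurable
  have int_a2: "integrable (\<nu> \<Otimes>\<^sub>M lborel) (\<lambda>(A, z). (a (A *v z))\<^sup>2)"
  proof (rule Fubini_integrable)
    show "integrable \<nu> (\<lambda>A. \<integral>z. norm (case (A, z) of (A, z) \<Rightarrow> (a (A *v z))\<^sup>2) \<partial>lborel)"
    proof (subst Bochner_Integration.integrable_cong[OF refl])
      fix A assume "A \<in> space \<nu>"
      then show "(\<integral>z. norm (case (A, z) of (A, z) \<Rightarrow> (a (A *v z))\<^sup>2) \<partial>lborel) = sq_norm a"
        using integral_SL_invariant(1)[of A "\<lambda>z. (a z)\<^sup>2"] by (simp add: space_\<nu>)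
    qed simp
    show "AE A in \<nu>. integrable lborel (\<lambda>z. case (A, z) of (A, z) \<Rightarrow> (a (A *v z))\<^sup>2)"
      using integral_SL_invariant(2)[of _ "\<lambda>z. (a z)\<^sup>2"] sq by (intro AE_I2) (simp add: space_\<nu>)
  qed measurable
  have a2: "(\<integral>z. (\<integral>A. (a (A *v z))\<^sup>2 \<partial>\<nu>) \<partial>lborel) = sq_norm a"
  proof -
    have "(\<integral>z. (\<integral>A. (a (A *v z))\<^sup>2 \<partial>\<nu>) \<partial>lborel) = (\<integral>A. (\<integral>z. (a (A *v z))\<^sup>2 \<partial>lborel) \<partial>\<nu>)"
      by (rule Fubini_integral[OF int_a2])
    also have "\<dots> = (\<integral>A. sq_norm a \<partial>\<nu>)"
      by (rule Bochner_Integration.integral_cong[OF refl])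
         (simp add: space_\<nu> integral_SL_invariant(1)[OF _ a2m])
    finally show ?thesis by (simp add: prob_space)
  qed
  have int_a2': "integrable lborel (\<lambda>z. \<integral>A. (a (A *v z))\<^sup>2 \<partial>\<nu>)"
    using integrable_snd[OF int_a2] by simp
  show b2: "integrable lborel (\<lambda>z. (b z)\<^sup>2)"
    by (rule Bochner_Integration.integrable_bound[OF int_a2']) (use var(2) in auto)
  have int_b2: "integrable (\<nu> \<Otimes>\<^sub>M lborel) (\<lambda>(A, z). (b z)\<^sup>2)"
    by (rule Fubini_integrable) (use b2 in auto)
  have int_ab: "integrable (\<nu> \<Otimes>\<^sub>M lborel) (\<lambda>(A, z). (a (A *v z) - b z)\<^sup>2)"
    using integrable_square_diff(1)[of "\<lambda>(A, z). a (A *v z)" "\<nu> \<Otimes>\<^sub>M lborel" "\<lambda>(A, z). b z"] int_a2 int_b2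
    by (simp add: case_prod_beta' )
  show "integrable \<nu> (\<lambda>A. \<integral>z. (a (A *v z) - b z)\<^sup>2 \<partial>lborel)"
    using integrable_fst[OF int_ab] by simp
  have "(\<integral>A. (\<integral>z. (a (A *v z) - b z)\<^sup>2 \<partial>lborel) \<partial>\<nu>) = (\<integral>z. (\<integral>A. (a (A *v z) - b z)\<^sup>2 \<partial>\<nu>) \<partial>lborel)"
    by (rule Fubini_integral[OF int_ab, symmetric])
  also have "\<dots> = (\<integral>z. (\<integral>A. (a (A *v z))\<^sup>2 \<partial>\<nu>) - (b z)\<^sup>2 \<partial>lborel)"
    by (simp only: var(1))
  also have "\<dots> = sq_norm a - sq_norm b"
    by (subst Bochner_Integration.integral_diff[OF int_a2' b2]) (simp add: a2)
  finally show "(\<integral>A. (\<integral>z. (a (A *v z) - b z)\<^sup>2 \<partial>lborel) \<partial>\<nu>) = sq_norm a - sq_norm b" .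
qed

text \<open>The direction of a vector; the value at 0 is some unit vector, so that the function maps into the sphere
  everywhere.\<close>

definition radial :: "real^'n \<Rightarrow> real^'n" where
  "radial z = (if z = 0 then axis undefined 1 else z /\<^sub>R norm z)"

lemma measurable_radial [measurable]: "radial \<in> borel \<rightarrow>\<^sub>M sphere_borel"
proof (rule measurable_restrict_space2)
  show "radial \<in> space borel \<rightarrow> sphere 0 1"
    by (auto simp: radial_def norm_axis_1)
  show "radial \<in> borel \<rightarrow>\<^sub>M borel"
    unfolding radial_def by measurable
qed

lemma sphere_act_radial:
  assumes "A \<in> SL" "z \<noteq> 0"
  shows "sphere_act A (radial z) = radial (A *v z)"
  using SL_mult_nonzero[OF assms] assms(2)
  by (simp add: radial_def sphere_act_def matrix_vector_mult_scaleR)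

text \<open>The distribution of the direction under the probability density proportional to \<open>b\<^sup>2\<close>.\<close>

lemma radial_measure:
  fixes b :: "real^'n \<Rightarrow> real"
  assumes b [measurable]: "b \<in> borel_measurable borel" and b2: "integrable lborel (\<lambda>z. (b z)\<^sup>2)"
    and pos: "sq_norm b > 0"
  obtains \<kappa> where "\<kappa> \<in> sphere_probs"
    "\<And>\<psi> :: real^'n \<Rightarrow> real. \<psi> \<in> borel_measurable sphere_borel \<Longrightarrow>
       (\<integral>u. \<psi> u \<partial>\<kappa>) = (\<integral>z. \<psi> (radial z) * (b z)\<^sup>2 \<partial>lborel) / sq_norm b"
proof -
  define N where "N = sq_norm b"
  have N: "N > 0" using pos by (simp add: N_def)
  define d where "d = density lborel (\<lambda>z. ennreal ((b z)\<^sup>2 / N))"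
  have [measurable_cong]: "sets d = sets borel" by (simp add: d_def)
  have "prob_space d"
  proof
    have "emeasure d (space d) = (\<integral>\<^sup>+z. ennreal ((b z)\<^sup>2 / N) \<partial>lborel)"
      by (simp add: d_def emeasure_density)
    also have "\<dots> = ennreal (\<integral>z. (b z)\<^sup>2 / N \<partial>lborel)"
      using N b2 by (intro nn_integral_eq_integral) auto
    also have "(\<integral>z. (b z)\<^sup>2 / N \<partial>lborel) = 1" using N by (simp add: N_def)
    finally show "emeasure d (space d) = 1" by simp
  qed
  then interpret d: prob_space d .
  show ?thesis
  proof (rule that)
    show "distr d sphere_borel radial \<in> sphere_probs"
      by (auto simp: space_prob_algebra intro!: d.prob_space_distr)
    fix \<psi> :: "real^'n \<Rightarrow> real" assume \<psi> [measurable]: "\<psi> \<in> borel_measurable sphere_borel"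
    have "(\<integral>u. \<psi> u \<partial>distr d sphere_borel radial) = (\<integral>z. \<psi> (radial z) \<partial>d)"
      by (rule integral_distr) measurable
    also have "\<dots> = (\<integral>z. ((b z)\<^sup>2 / N) * \<psi> (radial z) \<partial>lborel)"
      unfolding d_def using N by (subst integral_density) auto
    also have "(\<lambda>z. ((b z)\<^sup>2 / N) * \<psi> (radial z)) = (\<lambda>z. (\<psi> (radial z) * (b z)\<^sup>2) / N)"
      by (auto simp: field_simps)
    finally show "(\<integral>u. \<psi> u \<partial>distr d sphere_borel radial)
        = (\<integral>z. \<psi> (radial z) * (b z)\<^sup>2 \<partial>lborel) / sq_norm b"
      by (simp add: N_def)
  qed
qed


text \<open>The difference of squares is a product, so this is the Cauchy-Schwarz inequality, in the form with a free
  parameter \<open>t\<close>.\<close>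

lemma square_difference_bound:
  fixes a b :: "real^'n \<Rightarrow> real"
  assumes [measurable]: "a \<in> borel_measurable borel" "b \<in> borel_measurable borel"
    and a2: "integrable lborel (\<lambda>z. (a z)\<^sup>2)" and b2: "integrable lborel (\<lambda>z. (b z)\<^sup>2)"
    and le: "sq_norm b \<le> sq_norm a" and t: "t > 0"
  shows "integrable lborel (\<lambda>z. \<bar>(b z)\<^sup>2 - (a z)\<^sup>2\<bar>)"
    and "(\<integral>z. \<bar>(b z)\<^sup>2 - (a z)\<^sup>2\<bar> \<partial>lborel)
      \<le> t / 2 * (\<integral>z. (a z - b z)\<^sup>2 \<partial>lborel) + 2 / t * sq_norm a"
proof -
  show i: "integrable lborel (\<lambda>z. \<bar>(b z)\<^sup>2 - (a z)\<^sup>2\<bar>)"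
    using a2 b2 by simp
  note d = integrable_square_diff[OF _ _ a2 b2, simplified]
  have pt: "\<bar>(b z)\<^sup>2 - (a z)\<^sup>2\<bar> \<le> t / 2 * (a z - b z)\<^sup>2 + 1 / (2 * t) * (a z + b z)\<^sup>2" for z
  proof -
    define x y where "x = \<bar>a z - b z\<bar>" "y = \<bar>a z + b z\<bar>"
    have "\<bar>(b z)\<^sup>2 - (a z)\<^sup>2\<bar> = x * y"
      unfolding x_y_def abs_mult[symmetric] by (subst abs_minus_commute) (simp add: power2_eq_square algebra_simps)
    moreover have "0 \<le> (t * x - y)\<^sup>2 / (2 * t)" using t by simp
    moreover have "(t * x - y)\<^sup>2 / (2 * t) = t / 2 * x\<^sup>2 + 1 / (2 * t) * y\<^sup>2 - x * y"
      using t by (simp add: power2_eq_square field_simps)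
    ultimately show ?thesis unfolding x_y_def by simp
  qed
  have "(\<integral>z. \<bar>(b z)\<^sup>2 - (a z)\<^sup>2\<bar> \<partial>lborel)
      \<le> (\<integral>z. t / 2 * (a z - b z)\<^sup>2 + 1 / (2 * t) * (a z + b z)\<^sup>2 \<partial>lborel)"
    by (rule integral_mono[OF i _ pt]) (use d in simp)
  also have "\<dots> = t / 2 * (\<integral>z. (a z - b z)\<^sup>2 \<partial>lborel) + 1 / (2 * t) * (\<integral>z. (a z + b z)\<^sup>2 \<partial>lborel)"
    using d by simp
  also have "(\<integral>z. (a z + b z)\<^sup>2 \<partial>lborel) \<le> (\<integral>z. 2 * (a z)\<^sup>2 + 2 * (b z)\<^sup>2 \<partial>lborel)"
  proof (rule integral_mono[OF d(2)])
    show "(a z + b z)\<^sup>2 \<le> 2 * (a z)\<^sup>2 + 2 * (b z)\<^sup>2" for z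
      using zero_le_power2[of "a z - b z"] by (simp add: power2_eq_square algebra_simps)
  qed (use a2 b2 in simp)
  also have "(\<integral>z. 2 * (a z)\<^sup>2 + 2 * (b z)\<^sup>2 \<partial>lborel) \<le> 4 * sq_norm a"
    using a2 b2 le by simp
  finally show "(\<integral>z. \<bar>(b z)\<^sup>2 - (a z)\<^sup>2\<bar> \<partial>lborel)
      \<le> t / 2 * (\<integral>z. (a z - b z)\<^sup>2 \<partial>lborel) + 2 / t * sq_norm a"
    using t by (simp add: divide_right_mono)
qed

text \<open>Let \<open>b\<close> be the average of the functions \<open>a (A z)\<close>. Either \<open>b\<close> has at most half of the square norm of \<open>a\<close>, or
  the direction distribution \<open>\<kappa>\<close> of \<open>b\<^sup>2\<close> has two distant images under members \<open>A\<close>, \<open>B\<close> of \<open>F\<close>, tested by some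
  \<open>\<phi>\<close>. The integral of \<open>\<phi>\<close> against the image under \<open>h\<close> of the measure with density \<open>a (h z)\<^sup>2\<close> is a
  number \<open>I\<close> that does not depend on \<open>h\<close>. Hence \<open>b\<^sup>2\<close> cannot be near \<open>a (h z)\<^sup>2\<close> for \<open>h\<close> near \<open>A\<close> and also for
  \<open>h\<close> near \<open>B\<close>, and one of the two neighbourhoods contributes to the variance of \<open>average_variance\<close>.\<close>

lemma gap_of_separation:
  fixes \<nu> :: "(real^'n^'n) measure" and U :: "real^'n^'n \<Rightarrow> (real^'n^'n) set"
  assumes \<nu>: "\<nu> \<in> SL_probs"
    and FSL: "F \<subseteq> SL" and \<delta>: "0 < \<delta>" and \<epsilon>: "0 < \<epsilon>"
    and sep: "separates F \<delta>"
    and Uset: "\<And>A. A \<in> F \<Longrightarrow> U A \<in> sets \<nu>"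
    and Umass: "\<And>A. A \<in> F \<Longrightarrow> \<epsilon> \<le> measure \<nu> (U A)"
    and Uclose: "\<And>A h u. A \<in> F \<Longrightarrow> h \<in> U A \<Longrightarrow> u \<in> sphere 0 1 \<Longrightarrow> dist (sphere_act h u) (sphere_act A u) \<le> \<delta> / 4"
    and a [measurable]: "a \<in> borel_measurable borel" and bd: "\<And>z. \<bar>a z\<bar> \<le> C"
    and sq: "integrable lborel (\<lambda>z. (a z)\<^sup>2)"
  shows "(\<integral>z. (\<integral>A. a (A *v z) \<partial>\<nu>)\<^sup>2 \<partial>lborel) \<le> (1 - min (1/2) (\<epsilon> * \<delta>\<^sup>2 / 256)) * sq_norm a"
proof -
  have sets_\<nu>: "sets \<nu> = sets SL_borel" and "prob_space \<nu>"
    using \<nu> by (auto simp: space_prob_algebra)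
  interpret prob_space \<nu> by fact
  have space_\<nu>: "space \<nu> = SL"
    using sets_eq_imp_space_eq[OF sets_\<nu>] by (simp add: space_restrict_space)
  have USL: "U A \<subseteq> SL" if "A \<in> F" for A
    using sets.sets_into_space[OF Uset[OF that]] by (simp add: space_\<nu>)
  define b where "b = (\<lambda>z. \<integral>A. a (A *v z) \<partial>\<nu>)"
  define D where "D = (\<lambda>A. \<integral>z. (a (A *v z) - b z)\<^sup>2 \<partial>lborel)"
  define na where "na = sq_norm a"
  define nb where "nb = sq_norm b"
  have b_eq: "(\<integral>A. a (A *v z) \<partial>\<nu>) = b z" for z by (simp add: b_def)
  note V = average_variance[OF \<nu> a bd sq, unfolded b_eq]
  note [measurable] = V(1)
  have D0: "0 \<le> D A" for A by (simp add: D_def)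
  have V3: "integrable \<nu> D" using V(3) by (simp add: D_def)
  have V4: "(\<integral>A. D A \<partial>\<nu>) = na - nb" using V(4) by (simp add: D_def na_def nb_def)
  have "0 \<le> (\<integral>A. D A \<partial>\<nu>)" using D0 by simp
  then have nb_na: "nb \<le> na" using V4 by simp
  have na0: "0 \<le> na" by (simp add: na_def)
  have "nb \<le> (1 - min (1/2) (\<epsilon> * \<delta>\<^sup>2 / 256)) * na"
  proof (cases "nb \<le> na / 2")
    case True
    have "na / 2 \<le> (1 - min (1/2) (\<epsilon> * \<delta>\<^sup>2 / 256)) * na"
      using mult_right_mono[of "1/2" "1 - min (1/2) (\<epsilon> * \<delta>\<^sup>2 / 256)" na] na0 by simp
    then show ?thesis using True by simp
  next
    case False
    then have nb: "nb > 0" "na / 2 < nb" using na0 by auto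
    obtain \<kappa> where \<kappa>: "\<kappa> \<in> sphere_probs"
      and int_\<kappa>0: "\<And>\<psi> :: real^'n \<Rightarrow> real. \<psi> \<in> borel_measurable sphere_borel \<Longrightarrow>
         (\<integral>u. \<psi> u \<partial>\<kappa>) = (\<integral>z. \<psi> (radial z) * (b z)\<^sup>2 \<partial>lborel) / sq_norm b"
      by (rule radial_measure[OF V(1,2) nb(1)[unfolded nb_def]]) (rule that)
    note int_\<kappa> = int_\<kappa>0[folded nb_def]
    obtain A B \<phi> where AB: "A \<in> F" "B \<in> F" and \<phi>: "lip1 \<phi>"
      and gt: "\<delta> < \<bar>act_mean \<phi> A \<kappa> - act_mean \<phi> B \<kappa>\<bar>"
      using bspec[OF sep \<kappa>] by (elim bexE exE conjE)
    have \<phi>1: "\<bar>\<phi> u\<bar> \<le> 1" and \<phi>2: "\<bar>\<phi> u - \<phi> v\<bar> \<le> dist u v" for u v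
      using \<phi> by (auto simp: lip1_def)
    have \<phi>m [measurable]: "\<phi> \<in> borel_measurable borel"
      using lip1_continuous[OF \<phi>] by (rule borel_measurable_continuous_onI)
    have radial_borel [measurable]: "(radial :: real^'n \<Rightarrow> _) \<in> borel \<rightarrow>\<^sub>M borel"
      unfolding radial_def by measurable
    define J where "J h = (\<integral>z. \<phi> (radial (h *v z)) * (b z)\<^sup>2 \<partial>lborel)" for h
    define I where "I = (\<integral>z. \<phi> (radial z) * (a z)\<^sup>2 \<partial>lborel)"
    have bint: "integrable lborel (\<lambda>z. f z * (g z)\<^sup>2)"
      if [measurable]: "f \<in> borel_measurable borel" "g \<in> borel_measurable borel"
        and "\<And>z. \<bar>f z\<bar> \<le> 1" "integrable lborel (\<lambda>z. (g z)\<^sup>2)" for f g :: "real^'n \<Rightarrow> real"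
    proof (rule Bochner_Integration.integrable_bound[OF that(4)])
      show "AE z in lborel. norm (f z * (g z)\<^sup>2) \<le> norm ((g z)\<^sup>2)"
        using mult_right_mono[OF that(3), of "(g _)\<^sup>2"] by (intro AE_I2) (simp add: abs_mult)
    qed measurable
    have J: "act_mean \<phi> h \<kappa> = J h / nb" if h: "h \<in> SL" for h
    proof -
      have [measurable]: "\<phi> \<in> borel_measurable sphere_borel" by (rule measurable_restrict_space1) simp
      have "(\<lambda>u. \<phi> (sphere_act h u)) \<in> borel_measurable sphere_borel"
        by (rule measurable_compose[OF measurable_sphere_act[OF h]]) measurable
      then have "act_mean \<phi> h \<kappa> = (\<integral>z. \<phi> (sphere_act h (radial z)) * (b z)\<^sup>2 \<partial>lborel) / nb"
        by (rule int_\<kappa>)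
      also have "(\<integral>z. \<phi> (sphere_act h (radial z)) * (b z)\<^sup>2 \<partial>lborel) = J h"
        unfolding J_def
      proof (rule integral_cong_AE)
        show "(\<lambda>z. \<phi> (sphere_act h (radial z)) * (b z)\<^sup>2) \<in> borel_measurable lborel"
          using measurable_compose[OF measurable_radial \<open>(\<lambda>u. \<phi> (sphere_act h u)) \<in> _\<close>] by simp
        show "AE z in lborel. \<phi> (sphere_act h (radial z)) * (b z)\<^sup>2 = \<phi> (radial (h *v z)) * (b z)\<^sup>2"
          using AE_lborel_singleton[of 0] by eventually_elim (simp add: sphere_act_radial[OF h])
      qed measurable
      finally show ?thesis .
    qed
    have J_close: "\<bar>J h - J E\<bar> \<le> \<delta> / 4 * nb" if E: "E \<in> F" and h: "h \<in> U E" for h E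
    proof -
      have hE: "h \<in> SL" "E \<in> SL" using USL[OF E] h FSL E by auto
      have "J h - J E = (\<integral>z. (\<phi> (radial (h *v z)) - \<phi> (radial (E *v z))) * (b z)\<^sup>2 \<partial>lborel)"
        unfolding J_def left_diff_distrib
        by (rule Bochner_Integration.integral_diff[symmetric]; rule bint) (use \<phi>1 V(2) in auto)
      also have "\<bar>\<dots>\<bar> \<le> (\<integral>z. \<bar>(\<phi> (radial (h *v z)) - \<phi> (radial (E *v z))) * (b z)\<^sup>2\<bar> \<partial>lborel)"
        by (rule integral_abs_bound)
      also have "\<dots> \<le> (\<integral>z. \<delta> / 4 * (b z)\<^sup>2 \<partial>lborel)"
      proof (rule integral_mono_AE')
        show "AE z in lborel. \<bar>(\<phi> (radial (h *v z)) - \<phi> (radial (E *v z))) * (b z)\<^sup>2\<bar> \<le> \<delta> / 4 * (b z)\<^sup>2"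
          using AE_lborel_singleton[of 0]
        proof eventually_elim
          fix z :: "real^'n" assume z: "z \<noteq> 0"
          have "radial z \<in> sphere 0 1" by (simp add: radial_def norm_axis_1)
          then have "\<bar>\<phi> (radial (h *v z)) - \<phi> (radial (E *v z))\<bar> \<le> \<delta> / 4"
            using order_trans[OF \<phi>2 Uclose[OF E h]] by (simp add: sphere_act_radial[OF _ z, symmetric] hE)
          from mult_right_mono[OF this zero_le_power2[of "b z"]]
          show "\<bar>(\<phi> (radial (h *v z)) - \<phi> (radial (E *v z))) * (b z)\<^sup>2\<bar> \<le> \<delta> / 4 * (b z)\<^sup>2"
            by (simp only: abs_mult abs_power2)
        qed
      qed (use V(2) \<delta> in auto)
      also have "(\<integral>z. \<delta> / 4 * (b z)\<^sup>2 \<partial>lborel) = \<delta> / 4 * nb" by (simp add: nb_def)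
      finally show ?thesis .
    qed
    have I: "\<bar>J h - I\<bar> \<le> 16 / \<delta> * D h + \<delta> / 16 * na" if h: "h \<in> SL" for h
    proof -
      have ah [measurable]: "(\<lambda>z. a (h *v z)) \<in> borel_measurable borel" by measurable
      have ah2: "integrable lborel (\<lambda>z. (a (h *v z))\<^sup>2)" and nah: "(\<integral>z. (a (h *v z))\<^sup>2 \<partial>lborel) = na"
        using integral_SL_invariant[OF h, of "\<lambda>z. (a z)\<^sup>2"] sq by (simp_all add: na_def)
      have "I = (\<integral>z. \<phi> (radial (h *v z)) * (a (h *v z))\<^sup>2 \<partial>lborel)"
        unfolding I_def by (rule integral_SL_invariant(1)[OF h, symmetric]) measurable
      then have "J h - I = (\<integral>z. \<phi> (radial (h *v z)) * ((b z)\<^sup>2 - (a (h *v z))\<^sup>2) \<partial>lborel)"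
        unfolding J_def right_diff_distrib
        by (simp only:) (rule Bochner_Integration.integral_diff[symmetric]; rule bint, use \<phi>1 V(2) ah2 in auto)
      also have "\<bar>\<dots>\<bar> \<le> (\<integral>z. \<bar>\<phi> (radial (h *v z)) * ((b z)\<^sup>2 - (a (h *v z))\<^sup>2)\<bar> \<partial>lborel)"
        by (rule integral_abs_bound)
      also have "\<dots> \<le> (\<integral>z. \<bar>(b z)\<^sup>2 - (a (h *v z))\<^sup>2\<bar> \<partial>lborel)"
      proof (rule integral_mono')
        show "integrable lborel (\<lambda>z. \<bar>(b z)\<^sup>2 - (a (h *v z))\<^sup>2\<bar>)" using V(2) ah2 by simp
        show "\<bar>\<phi> (radial (h *v z)) * ((b z)\<^sup>2 - (a (h *v z))\<^sup>2)\<bar> \<le> \<bar>(b z)\<^sup>2 - (a (h *v z))\<^sup>2\<bar>" for z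
          unfolding abs_mult using mult_right_mono[OF \<phi>1] by force
      qed simp
      \<comment> \<open>With this parameter the second term costs only a small fraction of the separation \<open>\<delta> / 4 * nb\<close> that is needed.\<close>
      also have "\<dots> \<le> (32/\<delta>) / 2 * D h + 2 / (32/\<delta>) * na"
        unfolding D_def nah[symmetric]
        by (rule square_difference_bound(2)[OF ah V(1) ah2 V(2)])
           (use nb_na \<delta> in \<open>auto simp: nah nb_def\<close>)
      finally show ?thesis by simp
    qed
    have far: "\<delta> * nb < \<bar>J A - J B\<bar>"
    proof -
      have "\<delta> < \<bar>J A - J B\<bar> / nb"
        using gt AB FSL nb(1) by (simp add: J subset_iff diff_divide_distrib[symmetric] abs_divide)
      then show ?thesis using nb(1) by (simp add: pos_less_divide_eq)
    qed
    have "\<exists>E\<in>{A, B}. \<forall>h\<in>U E. \<delta>\<^sup>2 / 256 * na \<le> D h"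
    proof (rule ccontr)
      assume "\<not> ?thesis"
      then obtain h k where hk: "h \<in> U A" "k \<in> U B" "D h < \<delta>\<^sup>2 / 256 * na" "D k < \<delta>\<^sup>2 / 256 * na"
        by (auto simp: not_le)
      have e: "16 / \<delta> * (\<delta>\<^sup>2 / 256 * na) = \<delta> / 16 * na"
        using \<delta> by (simp add: power2_eq_square field_simps)
      have "\<bar>J h - I\<bar> \<le> \<delta> / 8 * na" "\<bar>J k - I\<bar> \<le> \<delta> / 8 * na"
      proof -
        have "h \<in> SL" "k \<in> SL" using hk USL AB by auto
        note I = I[OF this(1)] I[OF this(2)]
        have "0 < 16 / \<delta>" using \<delta> by simp
        note m = mult_strict_left_mono[OF hk(3) this] mult_strict_left_mono[OF hk(4) this]
        show "\<bar>J h - I\<bar> \<le> \<delta> / 8 * na" "\<bar>J k - I\<bar> \<le> \<delta> / 8 * na"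
          using I m unfolding e by linarith+
      qed
      moreover have "\<bar>J h - J A\<bar> \<le> \<delta> / 4 * nb" "\<bar>J k - J B\<bar> \<le> \<delta> / 4 * nb"
        using J_close AB hk by auto
      moreover have "\<delta> / 8 * na \<le> \<delta> / 4 * nb"
        using mult_left_mono[of "na / 2" nb "\<delta> / 4"] nb(2) \<delta> by simp
      ultimately show False using far by linarith
    qed
    then obtain E where E: "E \<in> F" and big: "\<And>h. h \<in> U E \<Longrightarrow> \<delta>\<^sup>2 / 256 * na \<le> D h"
      using AB by blast
    have "\<epsilon> * (\<delta>\<^sup>2 / 256 * na) \<le> measure \<nu> (U E) * (\<delta>\<^sup>2 / 256 * na)"
      using Umass[OF E] na0 by (intro mult_right_mono) auto
    also have "\<dots> = (\<integral>A. indicator (U E) A * (\<delta>\<^sup>2 / 256 * na) \<partial>\<nu>)"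
      using Uset[OF E] sets.sets_into_space[OF Uset[OF E]] by (simp add: Int_absorb1)
    also have "\<dots> \<le> (\<integral>A. D A \<partial>\<nu>)"
    proof (rule integral_mono'[OF V3])
      show "indicator (U E) h * (\<delta>\<^sup>2 / 256 * na) \<le> D h" for h
        using big[of h] D0[of h] by (auto simp: indicator_def)
    qed (use D0 in simp)
    finally have "nb \<le> (1 - \<epsilon> * \<delta>\<^sup>2 / 256) * na"
      by (simp add: V4 algebra_simps)
    also have "\<dots> \<le> (1 - min (1/2) (\<epsilon> * \<delta>\<^sup>2 / 256)) * na"
      using na0 by (intro mult_right_mono) auto
    finally show ?thesis .
  qed
  then show ?thesis by (simp add: na_def nb_def b_def)
qed

section \<open>The gap is uniform on weakly compact sets\<close>

lemma norm_matrix_vector_le: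
  fixes B :: "real^'n^'m"
  shows "norm (B *v u) \<le> norm B * norm u"
proof -
  have "norm (B *v u) \<le> L2_set (\<lambda>i. norm u * norm (B $ i)) UNIV"
    unfolding norm_vec_def[of "B *v u"]
  proof (rule L2_set_mono)
    show "norm ((B *v u) $ i) \<le> norm u * norm (B $ i)" for i
      using Cauchy_Schwarz_ineq2[of "B $ i" u] by (simp add: matrix_vector_mul_component mult.commute)
  qed simp
  also have "\<dots> = norm u * norm B"
    by (simp add: L2_set_right_distrib norm_vec_def)
  finally show ?thesis by (simp add: mult.commute)
qed

lemma dist_normalized_le:
  fixes v w :: "'a::real_normed_vector"
  assumes "v \<noteq> 0" "w \<noteq> 0"
  shows "dist (v /\<^sub>R norm v) (w /\<^sub>R norm w) \<le> 2 * norm (v - w) / norm w"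
proof -
  have "v /\<^sub>R norm v - w /\<^sub>R norm w = (inverse (norm v) - inverse (norm w)) *\<^sub>R v + (v - w) /\<^sub>R norm w"
    by (simp add: algebra_simps)
  then have "dist (v /\<^sub>R norm v) (w /\<^sub>R norm w)
      \<le> norm ((inverse (norm v) - inverse (norm w)) *\<^sub>R v) + norm ((v - w) /\<^sub>R norm w)"
    by (simp only: dist_norm norm_triangle_ineq)
  also have "norm ((inverse (norm v) - inverse (norm w)) *\<^sub>R v) = \<bar>(inverse (norm v) - inverse (norm w)) * norm v\<bar>"
    by (simp add: abs_mult)
  also have "(inverse (norm v) - inverse (norm w)) * norm v = (norm w - norm v) / norm w"
    using assms by (simp add: field_simps)
  also have "\<bar>(norm w - norm v) / norm w\<bar> \<le> norm (v - w) / norm w"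
    using norm_triangle_ineq3[of w v] by (simp add: abs_divide divide_right_mono norm_minus_commute)
  also have "norm ((v - w) /\<^sub>R norm w) = norm (v - w) / norm w"
    by (simp add: divide_inverse mult.commute)
  finally show ?thesis by simp
qed

text \<open>By compactness the length of \<open>A *v u\<close> is bounded below on the sphere, so normalizing this vector is
  Lipschitz near it.\<close>

lemma sphere_act_uniformly_close:
  fixes A :: "real^'n^'n"
  assumes A: "A \<in> SL" and e: "e > 0"
  shows "\<exists>r>0. \<forall>h\<in>SL. dist h A < r \<longrightarrow> (\<forall>u\<in>sphere 0 1. dist (sphere_act h u) (sphere_act A u) \<le> e)"
proof -
  have "continuous_on (sphere 0 1) (\<lambda>u. norm (A *v u))"
    by (intro continuous_intros linear_continuous_on) (simp add: linear_linear)
  moreover have "axis undefined 1 \<in> sphere 0 (1::real) \<inter> (UNIV :: (real^'n) set)"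
    by (simp add: norm_axis_1)
  ultimately obtain u0 where u0: "u0 \<in> sphere 0 1" "\<And>u. u \<in> sphere 0 1 \<Longrightarrow> norm (A *v u0) \<le> norm (A *v u)"
    using continuous_attains_inf[of "sphere 0 1" "\<lambda>u. norm (A *v u)"] by (metis IntD1 compact_sphere empty_iff)
  define m where "m = norm (A *v u0)"
  have "u0 \<noteq> 0" using u0(1) by auto
  then have m: "m > 0" using SL_mult_nonzero[OF A] by (simp add: m_def)
  show ?thesis
  proof (intro exI[of _ "e * m / 2"] conjI ballI impI)
    show "0 < e * m / 2" using e m by simp
    fix h :: "real^'n^'n" and u :: "real^'n"
    assume h: "h \<in> SL" "dist h A < e * m / 2" and u: "u \<in> sphere 0 1"
    then have "u \<noteq> 0" by auto
    have "dist (sphere_act h u) (sphere_act A u) \<le> 2 * norm (h *v u - A *v u) / norm (A *v u)"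
      unfolding sphere_act_def by (intro dist_normalized_le SL_mult_nonzero h(1) A \<open>u \<noteq> 0\<close>)
    also have "\<dots> \<le> 2 * (e * m / 2) / m"
    proof (rule frac_le)
      have "norm (h *v u - A *v u) \<le> norm (h - A) * norm u"
        using norm_matrix_vector_le[of "h - A" u] by (simp add: matrix_vector_mult_diff_rdistrib)
      then show "2 * norm (h *v u - A *v u) \<le> 2 * (e * m / 2)"
        using h(2) u by (simp add: dist_norm)
      show "m \<le> norm (A *v u)" using u0(2)[OF u] by (simp add: m_def)
    qed (use m e in auto)
    also have "\<dots> = e" using m by simp
    finally show "dist (sphere_act h u) (sphere_act A u) \<le> e" .
  qed
qed

text \<open>The number \<open>1 - \<eta>\<close> bounds the square of the norm of the averaging operator of \<open>\<nu>\<close>. Bounded functions are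
  sufficient here and keep all integrals over \<open>\<nu>\<close> finite at every point.\<close>

definition contracts :: "(real^'n^'n) measure \<Rightarrow> real \<Rightarrow> bool" where
  "contracts \<nu> \<eta> \<longleftrightarrow> (\<forall>a C. a \<in> borel_measurable borel \<longrightarrow> (\<forall>z. \<bar>a z\<bar> \<le> C) \<longrightarrow>
     integrable lborel (\<lambda>z. (a z)\<^sup>2) \<longrightarrow>
     (\<integral>z. (\<integral>A. a (A *v z) \<partial>\<nu>)\<^sup>2 \<partial>lborel) \<le> (1 - \<eta>) * sq_norm a)"

lemma contracts_mono: "contracts \<nu> \<eta> \<Longrightarrow> \<eta>' \<le> \<eta> \<Longrightarrow> contracts \<nu> \<eta>'"
proof -
  assume *: "contracts \<nu> \<eta>" "\<eta>' \<le> \<eta>"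
  have "(1 - \<eta>) * sq_norm a \<le> (1 - \<eta>') * sq_norm a" for a :: "real^'a \<Rightarrow> real"
    using *(2) by (intro mult_right_mono) auto
  then show ?thesis
    using *(1) unfolding contracts_def by (meson order_trans)
qed

lemma topspace_weak_topology:
  "topspace (weak_topology S) = space (prob_algebra (restrict_space borel (S :: 'a::topological_space set)))"
proof
  show "topspace (weak_topology S) \<subseteq> space (prob_algebra (restrict_space borel S))"
    unfolding weak_topology_def topology_generated_by_topspace by blast
  have "{\<mu> \<in> space (prob_algebra (restrict_space borel S)). (\<integral>x. 0 \<partial>\<mu>) \<in> (UNIV :: real set)}
      \<in> {{\<mu> \<in> space (prob_algebra (restrict_space borel S)). (\<integral>x. f x \<partial>\<mu>) \<in> U} | f U.
        continuous_on S (f :: 'a \<Rightarrow> real) \<and> bounded (f ` S) \<and> open U}"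
    by (intro CollectI exI[of _ "\<lambda>_. 0"] exI[of _ UNIV] conjI refl)
       (auto intro: finite_imp_bounded finite_subset[of _ "{0}"])
  then show "space (prob_algebra (restrict_space borel S)) \<subseteq> topspace (weak_topology S)"
    unfolding weak_topology_def topology_generated_by_topspace by auto
qed

lemma openin_weak_topology:
  fixes f :: "'a::topological_space \<Rightarrow> real"
  assumes "continuous_on S f" "bounded (f ` S)" "open U"
  shows "openin (weak_topology S) {\<mu> \<in> space (prob_algebra (restrict_space borel S)). (\<integral>x. f x \<partial>\<mu>) \<in> U}"
  unfolding weak_topology_def using assms by (intro topology_generated_by_Basis) blast

text \<open>A bump function at a point of the support of \<open>\<nu>\<close> has positive \<open>\<nu>\<close>-integral. The measures that give the
  bumps at the separating matrices more than half of these integrals form a weakly open set, and on it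
  \<open>gap_of_separation\<close> applies with constants that do not depend on the measure.\<close>

lemma local_gap:
  fixes \<nu> :: "(real^'n^'n) measure"
  assumes \<nu>: "\<nu> \<in> SL_probs"
    and no_inv: "\<not> (\<exists>\<kappa>\<in>sphere_probs. \<forall>A\<in>G_of \<nu>. preserves A \<kappa>)"
  shows "\<exists>W \<eta>. openin (weak_topology SL) W \<and> \<nu> \<in> W \<and> 0 < \<eta> \<and> (\<forall>\<nu>'\<in>W. contracts \<nu>' \<eta>)"
proof -
  have space: "space \<rho> = SL" and sets: "sets \<rho> = sets SL_borel" and prob: "prob_space \<rho>"
    if "\<rho> \<in> SL_probs" for \<rho> :: "(real^'n^'n) measure"
    using that sets_eq_imp_space_eq[of \<rho> "SL_borel"]
    by (auto simp: space_prob_algebra space_restrict_space)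
  have supp: "measure_support \<nu> \<subseteq> SL" by (auto simp: measure_support_def space[OF \<nu>])
  obtain F \<delta> where F: "finite F" "F \<subseteq> measure_support \<nu>" and \<delta>: "0 < (\<delta>::real)"
    and sep: "separates F \<delta>"
    using uniform_separation[OF supp no_inv] by (elim exE conjE)
  have "\<forall>A\<in>F. \<exists>r>0. \<forall>h\<in>SL. dist h A < r \<longrightarrow> (\<forall>u\<in>sphere 0 1. dist (sphere_act h u) (sphere_act A u) \<le> \<delta> / 4)"
    using F(2) supp \<delta> by (intro ballI sphere_act_uniformly_close) auto
  from bchoice[OF this] obtain r where r0: "\<forall>A\<in>F. 0 < r A \<and> (\<forall>h\<in>SL. dist h A < r A \<longrightarrow>
      (\<forall>u\<in>sphere 0 1. dist (sphere_act h u) (sphere_act A u) \<le> \<delta> / 4))" ..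
  have r: "\<And>A. A \<in> F \<Longrightarrow> 0 < r A"
    "\<And>A h u. A \<in> F \<Longrightarrow> h \<in> SL \<Longrightarrow> dist h A < r A \<Longrightarrow> u \<in> sphere 0 1 \<Longrightarrow>
       dist (sphere_act h u) (sphere_act A u) \<le> \<delta> / 4"
    using r0 by blast+
  define bump where "bump A h = max 0 (1 - dist h A / r A)" for A h :: "real^'n^'n"
  have bump_cont: "continuous_on S (bump A)" if "A \<in> F" for A S
    unfolding bump_def using r(1)[OF that] by (intro continuous_intros) auto
  have bump_bd: "0 \<le> bump A h" "bump A h \<le> 1" if "A \<in> F" for A h
    using r(1)[OF that] by (auto simp: bump_def)
  have bump_int: "integrable \<rho> (bump A)" if "A \<in> F" "\<rho> \<in> SL_probs" for A \<rho>
  proof -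
    interpret prob_space \<rho> by (rule prob[OF that(2)])
    have "bump A \<in> borel_measurable SL_borel"
      by (intro borel_measurable_continuous_on_restrict bump_cont that(1))
    then have "bump A \<in> borel_measurable \<rho>" by (simp add: measurable_cong_sets[OF sets[OF that(2)] refl])
    then show ?thesis
      using bump_bd[OF that(1)] by (intro integrable_const_bound[where B = 1]) auto
  qed
  define e where "e A = (\<integral>h. bump A h \<partial>\<nu>) / 2" for A
  have e: "0 < e A" if A: "A \<in> F" for A
  proof -
    interpret prob_space \<nu> by (rule prob[OF \<nu>])
    let ?B = "ball A (r A / 2) \<inter> space \<nu>"
    have "0 < emeasure \<nu> ?B"
      using A F(2) r(1)[OF A] by (auto simp: measure_support_def)
    then have "0 < measure \<nu> ?B" by (simp add: emeasure_eq_measure)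
    also have "measure \<nu> ?B = 2 * (\<integral>h. indicator ?B h * (1/2) \<partial>\<nu>)" by simp
    also have "\<dots> \<le> 2 * (\<integral>h. bump A h \<partial>\<nu>)"
    proof (intro mult_left_mono integral_mono')
      show "indicator ?B h * (1/2) \<le> bump A h" for h
        using r(1)[OF A] bump_bd[OF A] by (auto simp: indicator_def bump_def dist_commute field_simps max_def)
    qed (use bump_int[OF A \<nu>] bump_bd[OF A] in auto)
    finally show ?thesis by (simp add: e_def)
  qed
  \<comment> \<open>The element 1 only serves to make the set nonempty.\<close>
  define \<epsilon> where "\<epsilon> = Min (insert 1 (e ` F))"
  have \<epsilon>: "0 < \<epsilon>" "\<And>A. A \<in> F \<Longrightarrow> \<epsilon> \<le> e A"
    using F(1) e by (auto simp: \<epsilon>_def)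
  define W where "W = (\<Inter>A\<in>F. {\<rho> \<in> SL_probs. (\<integral>h. bump A h \<partial>\<rho>) \<in> {e A<..}})
      \<inter> topspace (weak_topology SL)"
  show ?thesis
  proof (intro exI conjI ballI)
    show "openin (weak_topology SL) W"
      unfolding W_def
    proof (intro openin_INT F(1) openin_weak_topology bump_cont)
      show "bounded (bump A ` SL)" if "A \<in> F" for A
        using bump_bd[OF that] by (intro boundedI[of _ 1]) auto
    qed auto
    show "\<nu> \<in> W"
      using \<nu> e by (auto simp: W_def topspace_weak_topology) (simp add: e_def)
    show "0 < min (1/2) (\<epsilon> * \<delta>\<^sup>2 / 256)" using \<epsilon>(1) \<delta> by simp
    fix \<rho> assume "\<rho> \<in> W"
    then have \<rho>: "\<rho> \<in> SL_probs"
      and big: "\<And>A. A \<in> F \<Longrightarrow> e A < (\<integral>h. bump A h \<partial>\<rho>)"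
      by (auto simp: W_def topspace_weak_topology)
    interpret prob_space \<rho> by (rule prob[OF \<rho>])
    define U where "U A = {h \<in> SL. dist h A < r A}" for A
    have Uset: "U A \<in> sets \<rho>" for A
    proof -
      have "U A = SL \<inter> ball A (r A)" by (auto simp: U_def dist_commute)
      then show ?thesis by (simp add: sets[OF \<rho>] sets_restrict_space)
    qed
    show "contracts \<rho> (min (1/2) (\<epsilon> * \<delta>\<^sup>2 / 256))"
      unfolding contracts_def
    proof (intro allI impI, rule gap_of_separation[where F = F and U = U, OF \<rho> _ \<delta> \<epsilon>(1) sep])
      fix A assume A: "A \<in> F"
      have "\<epsilon> \<le> (\<integral>h. bump A h \<partial>\<rho>)" using \<epsilon>(2)[OF A] big[OF A] by simp
      also have "\<dots> \<le> (\<integral>h. indicator (U A) h \<partial>\<rho>)"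
      proof (rule integral_mono_AE[OF bump_int[OF A \<rho>]])
        show "integrable \<rho> (indicator (U A) :: _ \<Rightarrow> real)"
          by (intro integrable_real_indicator Uset) (simp add: less_top[symmetric])
        show "AE h in \<rho>. bump A h \<le> indicator (U A) h"
        proof (rule AE_I2)
          fix h assume "h \<in> space \<rho>"
          then show "bump A h \<le> indicator (U A) h"
            using r(1)[OF A] by (auto simp: indicator_def U_def space[OF \<rho>] bump_def field_simps)
        qed
      qed
      also have "\<dots> = measure \<rho> (U A)"
        using sets.sets_into_space[OF Uset[of A]] by (simp add: Int_absorb2)
      finally show "\<epsilon> \<le> measure \<rho> (U A)" .
    qed (use F(2) supp Uset r(2) in \<open>auto simp: U_def\<close>)
  qed
qed

lemma uniform_gap:
  fixes M :: "(real^'n^'n) measure set"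
  assumes M: "compactin (weak_topology SL) M"
    and no_inv: "\<forall>\<rho>\<in>M. \<not> (\<exists>\<kappa>\<in>sphere_probs. \<forall>h\<in>G_of \<rho>. preserves h \<kappa>)"
  shows "\<exists>\<eta>>0. \<eta> < 1 \<and> (\<forall>\<rho>\<in>M. contracts \<rho> \<eta>)"
proof -
  define \<U> where "\<U> = {W. openin (weak_topology SL) W \<and> (\<exists>\<eta>>0. \<forall>\<rho>\<in>W. contracts (\<rho> :: (real^'n^'n) measure) \<eta>)}"
  have "M \<subseteq> \<Union>\<U>"
  proof
    fix \<rho> assume \<rho>: "\<rho> \<in> M"
    then have "\<rho> \<in> SL_probs"
      using M by (auto simp: compactin_def topspace_weak_topology)
    from local_gap[OF this] no_inv \<rho> show "\<rho> \<in> \<Union>\<U>" unfolding \<U>_def by blast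
  qed
  then obtain \<V> where \<V>: "finite \<V>" "\<V> \<subseteq> \<U>" "M \<subseteq> \<Union>\<V>"
  proof -
    have "Ball \<U> (openin (weak_topology SL))" by (simp add: \<U>_def)
    then have "\<exists>\<V>. finite \<V> \<and> \<V> \<subseteq> \<U> \<and> M \<subseteq> \<Union>\<V>"
      using M \<open>M \<subseteq> \<Union>\<U>\<close> unfolding compactin_def by blast
    then show ?thesis using that by blast
  qed
  have "\<forall>W\<in>\<V>. \<exists>\<eta>>0. \<forall>\<rho>\<in>W. contracts \<rho> \<eta>" using \<V>(2) by (auto simp: \<U>_def)
  from bchoice[OF this] obtain \<eta> where \<eta>: "\<And>W. W \<in> \<V> \<Longrightarrow> 0 < \<eta> W" "\<And>W \<rho>. W \<in> \<V> \<Longrightarrow> \<rho> \<in> W \<Longrightarrow> contracts \<rho> (\<eta> W)"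
    by auto
  show ?thesis
  proof (intro exI[of _ "Min (insert (1/2) (\<eta> ` \<V>))"] conjI ballI)
    show "0 < Min (insert (1/2) (\<eta> ` \<V>))" using \<V>(1) \<eta>(1) by auto
    have "Min (insert (1/2) (\<eta> ` \<V>)) \<le> 1/2" using \<V>(1) by (intro Min_le) auto
    then show "Min (insert (1/2) (\<eta> ` \<V>)) < 1" by simp
    fix \<rho> assume "\<rho> \<in> M"
    then obtain W where W: "W \<in> \<V>" "\<rho> \<in> W" using \<V>(3) by blast
    show "contracts \<rho> (Min (insert (1/2) (\<eta> ` \<V>)))"
      by (rule contracts_mono[OF \<eta>(2)[OF W]]) (use \<V>(1) W in \<open>intro Min_le; auto\<close>)
  qed
qed

section \<open>The Markov property along the path\<close>

lemma emeasure_distr_indicator: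
  assumes [measurable]: "f \<in> M \<rightarrow>\<^sub>M N" "A \<in> sets N"
  shows "emeasure (distr M N f) A = (\<integral>\<^sup>+x. indicator A (f x) \<partial>M)"
  by (simp add: nn_integral_indicator[symmetric] nn_integral_distr del: nn_integral_indicator)

text \<open>The Markov property with a past-dependent parameter \<open>W\<close>. On rectangles it is the defining property of
  conditional probabilities; the two sides are integrals of \<open>h\<close> against two finite measures that agree on
  the rectangles and hence coincide.\<close>

lemma markov_step:
  fixes h :: "'x \<times> 'b \<Rightarrow> ennreal"
  assumes mc: "markov_chain P X k \<xi>" and n: "n \<ge> 1"
    and W: "W \<in> past_algebra P X \<xi> n \<rightarrow>\<^sub>M N"
    and h: "h \<in> borel_measurable (X \<Otimes>\<^sub>M N)"
  shows "(\<integral>\<^sup>+\<omega>. h (\<xi> (Suc n) \<omega>, W \<omega>) \<partial>P) = (\<integral>\<^sup>+\<omega>. (\<integral>\<^sup>+z. h (z, W \<omega>) \<partial>k n (\<xi> n \<omega>)) \<partial>P)"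
proof -
  interpret prob_space P using mc by (simp add: markov_chain_def)
  have \<xi> [measurable]: "\<And>i. i \<ge> 1 \<Longrightarrow> \<xi> i \<in> P \<rightarrow>\<^sub>M X" and kp: "k n \<in> X \<rightarrow>\<^sub>M prob_algebra X"
    using mc n by (auto simp: markov_chain_def)
  have \<xi>n [measurable]: "\<xi> n \<in> P \<rightarrow>\<^sub>M X" "\<xi> (Suc n) \<in> P \<rightarrow>\<^sub>M X" using \<xi> n by auto
  have k [measurable]: "k n \<in> X \<rightarrow>\<^sub>M subprob_algebra X" by (rule measurable_prob_algebraD[OF kp])
  define F where "F = past_algebra P X \<xi> n"
  let ?hist = "\<lambda>\<omega>. \<lambda>i\<in>{1..n}. \<xi> i \<omega>"
  have hist: "?hist \<in> P \<rightarrow>\<^sub>M PiM {1..n} (\<lambda>_. X)"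
    by (rule measurable_restrict) auto
  have hist_fun: "?hist \<in> space P \<rightarrow> space (PiM {1..n} (\<lambda>_. X))"
    using measurable_space[OF hist] by blast
  have sets_F: "sets F = {?hist -` A \<inter> space P | A. A \<in> sets (PiM {1..n} (\<lambda>_. X))}"
    unfolding F_def past_algebra_def by (rule sets_vimage_algebra2[OF hist_fun])
  have "subalgebra P F"
    unfolding subalgebra_def sets_F using measurable_sets[OF hist]
    by (auto simp: F_def past_algebra_def simp del: One_nat_def)
  then have "finite_measure_subalgebra P F"
    by (simp add: finite_measure_subalgebra_def finite_measure_subalgebra_axioms_def finite_measure_axioms)
  then interpret F: finite_measure_subalgebra P F .
  have [measurable]: "W \<in> P \<rightarrow>\<^sub>M N"
    using W measurable_from_subalg[OF \<open>subalgebra P F\<close>] by (simp add: F_def)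
  let ?K = "\<lambda>\<omega>. distr (k n (\<xi> n \<omega>)) (X \<Otimes>\<^sub>M N) (\<lambda>z. (z, W \<omega>))"
  have K [measurable]: "?K \<in> P \<rightarrow>\<^sub>M subprob_algebra (X \<Otimes>\<^sub>M N)"
    by (rule measurable_distr2) measurable
  have sets_k: "sets (k n (\<xi> n \<omega>)) = sets X" and prob_k: "prob_space (k n (\<xi> n \<omega>))" if "\<omega> \<in> space P" for \<omega>
    using measurable_space[OF kp measurable_space[OF \<xi>n(1) that]] by (auto simp: space_prob_algebra)
  define M1 where "M1 = distr P (X \<Otimes>\<^sub>M N) (\<lambda>\<omega>. (\<xi> (Suc n) \<omega>, W \<omega>))"
  define M2 where "M2 = P \<bind> ?K"
  have sets_M2: "sets M2 = sets (X \<Otimes>\<^sub>M N)"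
    unfolding M2_def by (rule sets_bind[OF sets_kernel[OF K] not_empty])
  have rect: "emeasure M1 (B \<times> C) = emeasure M2 (B \<times> C)" if B: "B \<in> sets X" and C: "C \<in> sets N" for B C
  proof -
    define A where "A = W -` C \<inter> space P"
    have A: "A \<in> sets F"
      using measurable_sets[OF W C] by (simp add: A_def F_def past_algebra_def)
    have AP [measurable]: "A \<in> sets P" using A F.subalg by (auto simp: subalgebra_def)
    note [measurable] = B C
    define Q where "Q = (\<lambda>\<omega>. measure (k n (\<xi> n \<omega>)) B)"
    have Q [measurable]: "Q \<in> borel_measurable P"
      unfolding Q_def by measurable
    have "(\<integral>\<omega>\<in>A. indicator B (\<xi> (Suc n) \<omega>) \<partial>P)
        = (\<integral>\<omega>\<in>A. real_cond_exp P F (\<lambda>\<omega>. indicator B (\<xi> (Suc n) \<omega>)) \<omega> \<partial>P)"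
      by (rule F.real_cond_exp_intA[OF _ A]) (auto intro!: integrable_const_bound[where B = 1])
    also have "\<dots> = (\<integral>\<omega>\<in>A. Q \<omega> \<partial>P)"
      unfolding set_lebesgue_integral_def
    proof (rule integral_cong_AE)
      have "AE \<omega> in P. real_cond_exp P F (\<lambda>\<omega>. indicator B (\<xi> (Suc n) \<omega>)) \<omega> = Q \<omega>"
        using mc n B unfolding markov_chain_def F_def Q_def by blast
      then show "AE \<omega> in P. indicator A \<omega> *\<^sub>R real_cond_exp P F (\<lambda>\<omega>. indicator B (\<xi> (Suc n) \<omega>)) \<omega> = indicator A \<omega> *\<^sub>R Q \<omega>"
        by eventually_elim simp
    qed measurable
    finally have eq: "(\<integral>\<omega>. indicator A \<omega> * indicator B (\<xi> (Suc n) \<omega>) \<partial>P) = (\<integral>\<omega>. indicator A \<omega> * Q \<omega> \<partial>P)"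
      by (simp add: set_lebesgue_integral_def)
    have Q1: "0 \<le> Q \<omega>" "\<omega> \<in> space P \<Longrightarrow> Q \<omega> \<le> 1" for \<omega>
      using prob_space.prob_le_1[OF prob_k] by (auto simp: Q_def)
    have "emeasure M1 (B \<times> C) = (\<integral>\<^sup>+\<omega>. ennreal (indicator A \<omega> * indicator B (\<xi> (Suc n) \<omega>)) \<partial>P)"
    proof -
      have "emeasure M1 (B \<times> C) = (\<integral>\<^sup>+\<omega>. indicator (B \<times> C) (\<xi> (Suc n) \<omega>, W \<omega>) \<partial>P)"
        unfolding M1_def by (rule emeasure_distr_indicator) measurable
      also have "\<dots> = (\<integral>\<^sup>+\<omega>. ennreal (indicator A \<omega> * indicator B (\<xi> (Suc n) \<omega>)) \<partial>P)"
        by (intro nn_integral_cong) (auto simp: A_def indicator_def)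
      finally show ?thesis .
    qed
    also have "\<dots> = ennreal (\<integral>\<omega>. indicator A \<omega> * indicator B (\<xi> (Suc n) \<omega>) \<partial>P)"
      by (intro nn_integral_eq_integral integrable_const_bound[where B = 1]) (auto simp: indicator_def)
    also have "\<dots> = ennreal (\<integral>\<omega>. indicator A \<omega> * Q \<omega> \<partial>P)" by (simp only: eq)
    also have "\<dots> = (\<integral>\<^sup>+\<omega>. ennreal (indicator A \<omega> * Q \<omega>) \<partial>P)"
      using Q1 by (intro nn_integral_eq_integral[symmetric] integrable_const_bound[where B = 1])
        (auto simp: indicator_def)
    also have "\<dots> = (\<integral>\<^sup>+\<omega>. emeasure (?K \<omega>) (B \<times> C) \<partial>P)"
    proof (rule nn_integral_cong)
      fix \<omega> assume \<omega>: "\<omega> \<in> space P"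
      interpret k: prob_space "k n (\<xi> n \<omega>)" by (rule prob_k[OF \<omega>])
      have W\<omega>: "W \<omega> \<in> space N" using \<omega> measurable_space[OF \<open>W \<in> P \<rightarrow>\<^sub>M N\<close>] by blast
      have "(\<lambda>z. (z, W \<omega>)) \<in> k n (\<xi> n \<omega>) \<rightarrow>\<^sub>M X \<Otimes>\<^sub>M N"
        unfolding measurable_cong_sets[OF sets_k[OF \<omega>] refl] using W\<omega> by measurable
      then have "emeasure (?K \<omega>) (B \<times> C) = emeasure (k n (\<xi> n \<omega>)) ((\<lambda>z. (z, W \<omega>)) -` (B \<times> C) \<inter> space (k n (\<xi> n \<omega>)))"
        by (rule emeasure_distr) (use B C in measurable)
      also have "(\<lambda>z. (z, W \<omega>)) -` (B \<times> C) \<inter> space (k n (\<xi> n \<omega>)) = (if \<omega> \<in> A then B else {})"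
        using \<omega> sets.sets_into_space[OF B] sets_eq_imp_space_eq[OF sets_k[OF \<omega>]] by (auto simp: A_def)
      finally show "ennreal (indicator A \<omega> * Q \<omega>) = emeasure (?K \<omega>) (B \<times> C)"
        by (simp add: Q_def k.emeasure_eq_measure)
    qed
    also have "\<dots> = emeasure M2 (B \<times> C)"
      unfolding M2_def by (rule emeasure_bind[OF not_empty K, symmetric]) (use B C in measurable)
    finally show ?thesis .
  qed
  have "M1 = M2"
  proof (rule measure_eqI_generator_eq[where E = "{a \<times> b | a b. a \<in> sets X \<and> b \<in> sets N}"
        and \<Omega> = "space X \<times> space N" and A = "\<lambda>_. space X \<times> space N"])
    show "Int_stable {a \<times> b | a b. a \<in> sets X \<and> b \<in> sets N}" by (rule Int_stable_pair_measure_generator)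
    show "{a \<times> b | a b. a \<in> sets X \<and> b \<in> sets N} \<subseteq> Pow (space X \<times> space N)"
      by (auto dest: sets.sets_into_space)
    show "sets M1 = sigma_sets (space X \<times> space N) {a \<times> b | a b. a \<in> sets X \<and> b \<in> sets N}"
      by (simp add: M1_def sets_pair_measure)
    show "sets M2 = sigma_sets (space X \<times> space N) {a \<times> b | a b. a \<in> sets X \<and> b \<in> sets N}"
      by (simp add: sets_M2 sets_pair_measure)
    interpret M1: prob_space M1 unfolding M1_def by (rule prob_space_distr) measurable
    show "emeasure M1 (space X \<times> space N) \<noteq> \<infinity>" by (metis M1.emeasure_finite infinity_ennreal_def)
  qed (use rect in auto)
  have "(\<integral>\<^sup>+\<omega>. h (\<xi> (Suc n) \<omega>, W \<omega>) \<partial>P) = (\<integral>\<^sup>+p. h p \<partial>M1)"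
    unfolding M1_def using h by (subst nn_integral_distr) auto
  also have "\<dots> = (\<integral>\<^sup>+p. h p \<partial>M2)" by (simp only: \<open>M1 = M2\<close>)
  also have "\<dots> = (\<integral>\<^sup>+\<omega>. (\<integral>\<^sup>+p. h p \<partial>?K \<omega>) \<partial>P)"
    unfolding M2_def by (rule nn_integral_bind[OF h K])
  also have "\<dots> = (\<integral>\<^sup>+\<omega>. (\<integral>\<^sup>+z. h (z, W \<omega>) \<partial>k n (\<xi> n \<omega>)) \<partial>P)"
  proof (rule nn_integral_cong)
    fix \<omega> assume \<omega>: "\<omega> \<in> space P"
    have W\<omega>: "W \<omega> \<in> space N" using \<omega> measurable_space[OF \<open>W \<in> P \<rightarrow>\<^sub>M N\<close>] by blast
    have "(\<lambda>z. (z, W \<omega>)) \<in> k n (\<xi> n \<omega>) \<rightarrow>\<^sub>M X \<Otimes>\<^sub>M N"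
      unfolding measurable_cong_sets[OF sets_k[OF \<omega>] refl] using W\<omega> by measurable
    then show "(\<integral>\<^sup>+p. h p \<partial>?K \<omega>) = (\<integral>\<^sup>+z. h (z, W \<omega>) \<partial>k n (\<xi> n \<omega>))"
      by (rule nn_integral_distr) (simp add: h)
  qed
  finally show ?thesis .
qed

lemma markov_marginal:
  assumes mc: "markov_chain P X k \<xi>" and n: "n \<ge> 1"
  shows "distr P X (\<xi> (Suc n)) = distr P X (\<xi> n) \<bind> k n"
proof -
  interpret prob_space P using mc by (simp add: markov_chain_def)
  have \<xi> [measurable]: "\<xi> n \<in> P \<rightarrow>\<^sub>M X" "\<xi> (Suc n) \<in> P \<rightarrow>\<^sub>M X" and kp: "k n \<in> X \<rightarrow>\<^sub>M prob_algebra X"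
    using mc n by (auto simp: markov_chain_def)
  have k [measurable]: "k n \<in> X \<rightarrow>\<^sub>M subprob_algebra X" by (rule measurable_prob_algebraD[OF kp])
  have ne: "space (distr P X (\<xi> n)) \<noteq> {}" using measurable_space[OF \<xi>(1)] not_empty by auto
  show ?thesis
  proof (rule measure_eqI)
    show "sets (distr P X (\<xi> (Suc n))) = sets (distr P X (\<xi> n) \<bind> k n)"
      using ne by (subst sets_bind[OF sets_kernel]) auto
    fix B assume "B \<in> sets (distr P X (\<xi> (Suc n)))"
    then have B [measurable]: "B \<in> sets X" by simp
    have "(\<integral>\<^sup>+\<omega>. indicator (B \<times> UNIV) (\<xi> (Suc n) \<omega>, 0::nat) \<partial>P)
        = (\<integral>\<^sup>+\<omega>. (\<integral>\<^sup>+z. indicator (B \<times> UNIV) (z, 0::nat) \<partial>k n (\<xi> n \<omega>)) \<partial>P)"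
      by (rule markov_step[OF mc n, where W = "\<lambda>_. 0" and N = "count_space UNIV"]) measurable
    then have *: "(\<integral>\<^sup>+\<omega>. indicator B (\<xi> (Suc n) \<omega>) \<partial>P) = (\<integral>\<^sup>+\<omega>. (\<integral>\<^sup>+z. indicator B z \<partial>k n (\<xi> n \<omega>)) \<partial>P)"
      by (simp add: indicator_times)
    have "emeasure (distr P X (\<xi> (Suc n))) B = (\<integral>\<^sup>+\<omega>. indicator B (\<xi> (Suc n) \<omega>) \<partial>P)"
      by (rule emeasure_distr_indicator) measurable
    also have "\<dots> = (\<integral>\<^sup>+\<omega>. emeasure (k n (\<xi> n \<omega>)) B \<partial>P)"
      unfolding * using measurable_space[OF kp measurable_space[OF \<xi>(1)]]
      by (intro nn_integral_cong) (auto simp: space_prob_algebra)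
    also have "\<dots> = (\<integral>\<^sup>+x. emeasure (k n x) B \<partial>distr P X (\<xi> n))"
      by (subst nn_integral_distr) auto
    also have "\<dots> = emeasure (distr P X (\<xi> n) \<bind> k n) B"
      by (rule emeasure_bind[OF ne _ B, symmetric]) simp
    finally show "emeasure (distr P X (\<xi> (Suc n))) B = emeasure (distr P X (\<xi> n) \<bind> k n) B" .
  qed
qed

section \<open>Transition operators contract mean-zero functions\<close>

text \<open>What the sequel needs to know about one transition: the kernel maps the law \<open>\<mu>\<close> to \<open>\<mu>'\<close>, and it shrinks the
  deviation of a function from its mean by the factor \<open>c\<close>.\<close>

definition kernel_step :: "'x measure \<Rightarrow> 'x measure \<Rightarrow> ('x \<Rightarrow> 'x measure) \<Rightarrow> 'x measure \<Rightarrow> real \<Rightarrow> bool" where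
  "kernel_step X \<mu> \<kappa> \<mu>' c \<longleftrightarrow>
     prob_space \<mu> \<and> prob_space \<mu>' \<and> sets \<mu> = sets X \<and> sets \<mu>' = sets X \<and>
     \<kappa> \<in> X \<rightarrow>\<^sub>M prob_algebra X \<and>
     (\<forall>f \<in> borel_measurable X. (\<forall>x. \<bar>f x\<bar> \<le> 1) \<longrightarrow>
        (\<integral>x. kernel_op \<kappa> f x \<partial>\<mu>) = (\<integral>x. f x \<partial>\<mu>') \<and>
        (\<integral>x. (kernel_op \<kappa> f x - (\<integral>x. f x \<partial>\<mu>'))\<^sup>2 \<partial>\<mu>) \<le> c\<^sup>2 * ((\<integral>x. (f x)\<^sup>2 \<partial>\<mu>') - (\<integral>x. f x \<partial>\<mu>')\<^sup>2))"

lemma kernel_op_measurable: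
  fixes F :: "'x \<Rightarrow> 'b \<Rightarrow> real"
  assumes \<kappa>: "\<kappa> \<in> X \<rightarrow>\<^sub>M prob_algebra X" and F: "case_prod F \<in> borel_measurable (X \<Otimes>\<^sub>M N)"
  shows "(\<lambda>(x, y). kernel_op \<kappa> (\<lambda>z. F z y) x) \<in> borel_measurable (X \<Otimes>\<^sub>M N)"
proof -
  have [measurable]: "\<kappa> \<in> X \<rightarrow>\<^sub>M subprob_algebra X" by (rule measurable_prob_algebraD[OF \<kappa>])
  note [measurable] = F
  let ?D = "\<lambda>p. distr (\<kappa> (fst p)) (X \<Otimes>\<^sub>M N) (\<lambda>z. (z, snd p))"
  have D: "?D \<in> X \<Otimes>\<^sub>M N \<rightarrow>\<^sub>M subprob_algebra (X \<Otimes>\<^sub>M N)"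
    by (rule measurable_distr2) measurable
  have "(\<lambda>p. \<integral>q. case_prod F q \<partial>?D p) \<in> borel_measurable (X \<Otimes>\<^sub>M N)"
    using measurable_compose[OF D integral_measurable_subprob_algebra[OF F]] by simp
  then show ?thesis
  proof (rule measurable_cong[THEN iffD1, rotated])
    fix p assume p: "p \<in> space (X \<Otimes>\<^sub>M N)"
    then have 1: "fst p \<in> space X" "snd p \<in> space N" by (auto simp: space_pair_measure)
    have "sets (\<kappa> (fst p)) = sets X" using measurable_space[OF \<kappa> 1(1)] by (simp add: space_prob_algebra)
    have "(\<lambda>z. (z, snd p)) \<in> \<kappa> (fst p) \<rightarrow>\<^sub>M X \<Otimes>\<^sub>M N"
      unfolding measurable_cong_sets[OF \<open>sets (\<kappa> (fst p)) = sets X\<close> refl]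
      by (rule measurable_Pair2'[OF 1(2)])
    then show "(\<integral>q. case_prod F q \<partial>?D p) = (case p of (x, y) \<Rightarrow> kernel_op \<kappa> (\<lambda>z. F z y) x)"
      by (subst integral_distr[OF _ F]) (auto simp: kernel_op_def split: prod.split)
  qed
qed

lemma kernel_op_bounded:
  assumes \<kappa>: "\<kappa> \<in> X \<rightarrow>\<^sub>M prob_algebra X" and f: "f \<in> borel_measurable X"
    and bd: "\<And>x. \<bar>f x\<bar> \<le> 1" and x: "x \<in> space X"
  shows "\<bar>kernel_op \<kappa> f x\<bar> \<le> 1"
    and "(kernel_op \<kappa> f x)\<^sup>2 \<le> kernel_op \<kappa> (\<lambda>z. (f z)\<^sup>2) x"
    and "kernel_op \<kappa> (\<lambda>z. f z - a) x = kernel_op \<kappa> f x - a"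
proof -
  have p: "prob_space (\<kappa> x)" and s: "sets (\<kappa> x) = sets X"
    using measurable_space[OF \<kappa> x] by (auto simp: space_prob_algebra)
  have f': "f \<in> borel_measurable (\<kappa> x)" using f by (simp add: measurable_cong_sets[OF s refl])
  interpret K: prob_space "\<kappa> x" by (rule p)
  note v = variance_bounded[OF p f' bd]
  show "\<bar>kernel_op \<kappa> f x\<bar> \<le> 1" "(kernel_op \<kappa> f x)\<^sup>2 \<le> kernel_op \<kappa> (\<lambda>z. (f z)\<^sup>2) x"
    using v by (simp_all add: kernel_op_def)
  show "kernel_op \<kappa> (\<lambda>z. f z - a) x = kernel_op \<kappa> f x - a"
    unfolding kernel_op_def by (subst Bochner_Integration.integral_diff[OF v(4)]) (simp_all add: K.prob_space)
qed

text \<open>Apply the norm bound to \<open>f\<close> minus its mean. When \<open>f\<close> is almost surely constant, the quotient that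
  defines the norm is 0 by convention and carries no information; then Jensen's inequality gives the claim.\<close>

lemma markov_kernel_step:
  fixes c :: real and X :: "'x measure"
  assumes mc: "markov_chain P X k \<xi>" and n: "n \<ge> 1"
    and \<mu>: "\<And>n. \<mu> n = distr P X (\<xi> n)"
    and gap: "L2_0_onorm (\<mu> (Suc n)) (\<mu> n) (kernel_op (k n)) \<le> ereal c"
  shows "kernel_step X (\<mu> n) (k n) (\<mu> (Suc n)) c"
proof -
  interpret P: prob_space P using mc by (simp add: markov_chain_def)
  have \<xi>: "\<xi> n \<in> P \<rightarrow>\<^sub>M X" "\<xi> (Suc n) \<in> P \<rightarrow>\<^sub>M X" and kp: "k n \<in> X \<rightarrow>\<^sub>M prob_algebra X"
    using mc n by (auto simp: markov_chain_def)
  have p: "prob_space (\<mu> n)" "prob_space (\<mu> (Suc n))"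
    using \<xi> by (auto simp: \<mu> intro!: P.prob_space_distr)
  interpret P1: prob_space "\<mu> n" by (rule p(1))
  interpret P2: prob_space "\<mu> (Suc n)" by (rule p(2))
  have s [measurable_cong]: "sets (\<mu> n) = sets X" "sets (\<mu> (Suc n)) = sets X" by (simp_all add: \<mu>)
  have sp: "space (\<mu> n) = space X" by (simp add: \<mu>)
  have k [measurable]: "k n \<in> \<mu> n \<rightarrow>\<^sub>M subprob_algebra X"
    using measurable_prob_algebraD[OF kp] by (simp add: measurable_cong_sets[OF s(1) refl])
  have ne: "space (\<mu> n) \<noteq> {}" by (rule prob_space.not_empty[OF p(1)])
  have marg: "(\<integral>x. kernel_op (k n) f x \<partial>\<mu> n) = (\<integral>x. f x \<partial>\<mu> (Suc n))"
    if f [measurable]: "f \<in> borel_measurable X" and bd: "\<And>x. \<bar>f x\<bar> \<le> C" for f :: "'x \<Rightarrow> real" and C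
  proof -
    have "(\<integral>x. f x \<partial>\<mu> (Suc n)) = (\<integral>x. f x \<partial>(\<mu> n \<bind> k n))"
      using markov_marginal[OF mc n] by (simp add: \<mu>)
    also have "\<dots> = (\<integral>x. (\<integral>y. f y \<partial>k n x) \<partial>\<mu> n)"
    proof (rule integral_bind[where K = X and B' = 1 and B = C])
      show "finite_measure (\<mu> n)" by (rule P1.finite_measure_axioms)
      show "AE x in \<mu> n. emeasure (k n x) (space (k n x)) \<le> ennreal 1"
        using measurable_space[OF kp] by (intro AE_I2) (auto simp: sp space_prob_algebra prob_space.emeasure_space_1)
    qed (use bd ne in auto)
    finally show ?thesis by (simp add: kernel_op_def)
  qed
  have "0 \<le> c"
  proof -
    have "(\<lambda>_. 0) \<in> L2_0 (\<mu> (Suc n))" by (simp add: L2_0_def L2_def)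
    then have "ereal (L2_norm (\<mu> n) (kernel_op (k n) (\<lambda>_. 0)) / L2_norm (\<mu> (Suc n)) (\<lambda>_. 0)) \<le> ereal c"
      by (rule order_trans[OF SUP_upper gap[unfolded L2_0_onorm_def]])
    then show ?thesis by (simp add: L2_norm_def)
  qed
  have contr: "(\<integral>x. (kernel_op (k n) f x - (\<integral>x. f x \<partial>\<mu> (Suc n)))\<^sup>2 \<partial>\<mu> n)
      \<le> c\<^sup>2 * ((\<integral>x. (f x)\<^sup>2 \<partial>\<mu> (Suc n)) - (\<integral>x. f x \<partial>\<mu> (Suc n))\<^sup>2)"
    if f [measurable]: "f \<in> borel_measurable X" and bd: "\<And>x. \<bar>f x\<bar> \<le> 1" for f :: "'x \<Rightarrow> real"
  proof -
    define a where "a = (\<integral>x. f x \<partial>\<mu> (Suc n))"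
    define g where "g = (\<lambda>x. f x - a)"
    have f': "f \<in> borel_measurable (\<mu> (Suc n))" by measurable
    note v = variance_bounded[OF p(2) f' bd, folded a_def]
    have g [measurable]: "g \<in> borel_measurable X" unfolding g_def by measurable
    have "\<bar>a\<bar> \<le> 1" by (rule v(3))
    then have gb: "\<bar>g x\<bar> \<le> 2" for x using bd[of x] by (auto simp: g_def)
    have g2: "(\<integral>x. (g x)\<^sup>2 \<partial>\<mu> (Suc n)) = (\<integral>x. (f x)\<^sup>2 \<partial>\<mu> (Suc n)) - a\<^sup>2"
      unfolding g_def by (rule v(1))
    have g': "g \<in> borel_measurable (\<mu> (Suc n))" by measurable
    note vg = variance_bounded[OF p(2) g' gb]
    have "(\<integral>x. g x \<partial>\<mu> (Suc n)) = 0"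
      unfolding g_def by (subst Bochner_Integration.integral_diff[OF v(4)]) (simp_all add: P2.prob_space a_def)
    then have gL: "g \<in> L2_0 (\<mu> (Suc n))"
      using vg(5) g' by (simp add: L2_0_def L2_def)
    have Kg: "kernel_op (k n) g x = kernel_op (k n) f x - a" if "x \<in> space X" for x
      unfolding g_def by (rule kernel_op_bounded(3)[OF kp f bd that])
    let ?Kg2 = "\<integral>x. (kernel_op (k n) g x)\<^sup>2 \<partial>\<mu> n"
    let ?g2 = "\<integral>x. (g x)\<^sup>2 \<partial>\<mu> (Suc n)"
    have lhs: "(\<integral>x. (kernel_op (k n) f x - a)\<^sup>2 \<partial>\<mu> n) = ?Kg2"
      by (intro Bochner_Integration.integral_cong refl) (simp add: sp Kg)
    have "?Kg2 \<le> c\<^sup>2 * ?g2"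
    proof (cases "?g2 > 0")
      case True
      then have pos: "L2_norm (\<mu> (Suc n)) g > 0" by (simp add: L2_norm_def)
      have "ereal (L2_norm (\<mu> n) (kernel_op (k n) g) / L2_norm (\<mu> (Suc n)) g) \<le> ereal c"
        by (rule order_trans[OF SUP_upper[OF gL] gap[unfolded L2_0_onorm_def]])
      then have "L2_norm (\<mu> n) (kernel_op (k n) g) \<le> c * L2_norm (\<mu> (Suc n)) g"
        using pos by (simp add: pos_divide_le_eq)
      moreover have "0 \<le> L2_norm (\<mu> n) (kernel_op (k n) g)" by (simp add: L2_norm_def)
      ultimately have "(L2_norm (\<mu> n) (kernel_op (k n) g))\<^sup>2 \<le> (c * L2_norm (\<mu> (Suc n)) g)\<^sup>2"
        by (intro power_mono)
      then show ?thesis by (simp add: L2_norm_def power_mult_distrib)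
    next
      case False
      have "0 \<le> ?g2" by simp
      then have 0: "?g2 = 0" using False by linarith
      let ?h = "\<lambda>x. g x / 2"
      have hb: "\<bar>?h x\<bar> \<le> 1" for x using gb[of x] by simp
      have hm: "?h \<in> borel_measurable X" by measurable
      have h2b: "\<bar>(?h x)\<^sup>2\<bar> \<le> 1" for x
        using hb[of x] by (simp only: abs_square_le_1 abs_power2)
      have h2m: "(\<lambda>x. (?h x)\<^sup>2) \<in> borel_measurable X" by measurable
      have KF: "(\<lambda>x. kernel_op (k n) f x) \<in> borel_measurable X" if "f \<in> borel_measurable X" for f
      proof -
        have "case_prod (\<lambda>x (y::nat). f x) \<in> borel_measurable (X \<Otimes>\<^sub>M count_space UNIV)"
          using that by measurable
        from measurable_compose[OF measurable_Pair2'[of _ "count_space UNIV" X] kernel_op_measurable[OF kp this], of 0]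
        show ?thesis by simp
      qed
      have km: "(\<lambda>x. kernel_op (k n) f x) \<in> borel_measurable (\<mu> n)" if "f \<in> borel_measurable X" for f
        using KF[OF that] by (simp add: measurable_cong_sets[OF s(1) refl])
      have intb: "integrable (\<mu> n) u" if "u \<in> borel_measurable (\<mu> n)" "\<And>x. x \<in> space X \<Longrightarrow> \<bar>u x\<bar> \<le> 1" for u :: "'x \<Rightarrow> real"
        by (rule P1.integrable_const_bound[where B = 1, OF AE_I2 that(1)]) (simp add: that(2) sp)
      have "(\<integral>x. (kernel_op (k n) ?h x)\<^sup>2 \<partial>\<mu> n) \<le> (\<integral>x. kernel_op (k n) (\<lambda>z. (?h z)\<^sup>2) x \<partial>\<mu> n)"
      proof (rule integral_mono)
        show "integrable (\<mu> n) (\<lambda>x. (kernel_op (k n) ?h x)\<^sup>2)"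
        proof (rule intb)
          show "(\<lambda>x. (kernel_op (k n) ?h x)\<^sup>2) \<in> borel_measurable (\<mu> n)"
            using km[OF hm] by (rule borel_measurable_power)
          show "\<bar>(kernel_op (k n) ?h x)\<^sup>2\<bar> \<le> 1" if "x \<in> space X" for x
            using kernel_op_bounded(1)[OF kp hm hb that] by (simp only: abs_square_le_1 abs_power2)
        qed
        show "integrable (\<mu> n) (\<lambda>x. kernel_op (k n) (\<lambda>z. (?h z)\<^sup>2) x)"
          by (rule intb[OF km[OF h2m]]) (rule kernel_op_bounded(1)[OF kp h2m h2b])
        show "(kernel_op (k n) ?h x)\<^sup>2 \<le> kernel_op (k n) (\<lambda>z. (?h z)\<^sup>2) x" if "x \<in> space (\<mu> n)" for x
          using that by (intro kernel_op_bounded(2)[OF kp hm hb]) (simp add: sp)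
      qed
      also have "\<dots> = (\<integral>x. (?h x)\<^sup>2 \<partial>\<mu> (Suc n))" by (rule marg[OF h2m h2b])
      also have "\<dots> = 0" using 0 by (simp add: power_divide)
      finally have "(\<integral>x. (kernel_op (k n) ?h x)\<^sup>2 \<partial>\<mu> n) \<le> 0" .
      moreover have "kernel_op (k n) ?h = (\<lambda>x. kernel_op (k n) g x / 2)"
        by (simp add: kernel_op_def fun_eq_iff)
      ultimately show ?thesis using 0 by (simp add: power_divide)
    qed
    then show ?thesis using lhs g2 by (simp add: a_def)
  qed
  have main: "\<forall>f \<in> borel_measurable X. (\<forall>x. \<bar>f x\<bar> \<le> 1) \<longrightarrow>
        (\<integral>x. kernel_op (k n) f x \<partial>\<mu> n) = (\<integral>x. f x \<partial>\<mu> (Suc n)) \<and>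
        (\<integral>x. (kernel_op (k n) f x - (\<integral>x. f x \<partial>\<mu> (Suc n)))\<^sup>2 \<partial>\<mu> n)
          \<le> c\<^sup>2 * ((\<integral>x. (f x)\<^sup>2 \<partial>\<mu> (Suc n)) - (\<integral>x. f x \<partial>\<mu> (Suc n))\<^sup>2)"
  proof (rule ballI, rule impI)
    fix f :: "'x \<Rightarrow> real" assume f: "f \<in> borel_measurable X" and bd: "\<forall>x. \<bar>f x\<bar> \<le> 1"
    show "(\<integral>x. kernel_op (k n) f x \<partial>\<mu> n) = (\<integral>x. f x \<partial>\<mu> (Suc n)) \<and>
      (\<integral>x. (kernel_op (k n) f x - (\<integral>x. f x \<partial>\<mu> (Suc n)))\<^sup>2 \<partial>\<mu> n)
      \<le> c\<^sup>2 * ((\<integral>x. (f x)\<^sup>2 \<partial>\<mu> (Suc n)) - (\<integral>x. f x \<partial>\<mu> (Suc n))\<^sup>2)"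
      by (rule conjI[OF marg[OF f spec[OF bd]] contr[OF f spec[OF bd]]])
  qed
  show ?thesis
    by (rule kernel_step_def[THEN iffD2]) (rule conjI p s kp main)+
qed

section \<open>Two steps of the chain contract the energy\<close>

definition bdd_meas :: "'x measure \<Rightarrow> real \<Rightarrow> ('x \<Rightarrow> 'b::topological_space \<Rightarrow> real) \<Rightarrow> bool" where
  "bdd_meas X C F \<longleftrightarrow> case_prod F \<in> borel_measurable (X \<Otimes>\<^sub>M borel) \<and> (\<forall>x y. \<bar>F x y\<bar> \<le> C)"

definition energy :: "'x measure \<Rightarrow> ('x \<Rightarrow> 'b::euclidean_space \<Rightarrow> real) \<Rightarrow> real" where
  "energy \<mu> F = (\<integral>y. (\<integral>x. (F x y)\<^sup>2 \<partial>\<mu>) \<partial>lborel)"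

definition finite_energy :: "'x measure \<Rightarrow> ('x \<Rightarrow> 'b::euclidean_space \<Rightarrow> real) \<Rightarrow> bool" where
  "finite_energy \<mu> F \<longleftrightarrow> integrable lborel (\<lambda>y. \<integral>x. (F x y)\<^sup>2 \<partial>\<mu>)"

definition moved_by :: "('x \<Rightarrow> real^'n^'n) \<Rightarrow> ('x \<Rightarrow> real^'n \<Rightarrow> real) \<Rightarrow> 'x \<Rightarrow> real^'n \<Rightarrow> real" where
  "moved_by g F x y = F x (g x *v y)"

text \<open>The transition operator in the first variable. The value 0 outside \<open>X\<close>, where the kernel is arbitrary,
  keeps the function bounded everywhere.\<close>

definition markov_avg :: "'x measure \<Rightarrow> ('x \<Rightarrow> 'x measure) \<Rightarrow> ('x \<Rightarrow> 'b \<Rightarrow> real) \<Rightarrow> 'x \<Rightarrow> 'b \<Rightarrow> real" where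
  "markov_avg X \<kappa> F x y = (if x \<in> space X then kernel_op \<kappa> (\<lambda>z. F z y) x else 0)"

lemma bdd_meas_slice:
  assumes "bdd_meas X C F" "prob_space \<mu>" "sets \<mu> = sets X"
  shows "(\<lambda>x. F x y) \<in> borel_measurable X" "(\<lambda>x. F x y) \<in> borel_measurable \<mu>"
    and "\<And>x. \<bar>F x y\<bar> \<le> C"
    and "(\<lambda>y. \<integral>x. F x y \<partial>\<mu>) \<in> borel_measurable borel"
    and "(\<lambda>y. \<integral>x. (F x y)\<^sup>2 \<partial>\<mu>) \<in> borel_measurable borel"
proof -
  interpret prob_space \<mu> by fact
  note [measurable_cong] = assms(3)
  have m [measurable]: "case_prod F \<in> borel_measurable (X \<Otimes>\<^sub>M borel)" using assms(1) by (simp add: bdd_meas_def)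
  show X: "(\<lambda>x. F x y) \<in> borel_measurable X" by measurable
  then show "(\<lambda>x. F x y) \<in> borel_measurable \<mu>" by (simp add: measurable_cong_sets[OF assms(3) refl])
  show "\<And>x. \<bar>F x y\<bar> \<le> C" using assms(1) by (simp add: bdd_meas_def)
  show "(\<lambda>y. \<integral>x. F x y \<partial>\<mu>) \<in> borel_measurable borel" by measurable
  show "(\<lambda>y. \<integral>x. (F x y)\<^sup>2 \<partial>\<mu>) \<in> borel_measurable borel" by measurable
qed

lemma energy_nn_integral:
  assumes F: "bdd_meas X C F" "prob_space \<mu>" "sets \<mu> = sets X"
  shows "finite_energy \<mu> F \<longleftrightarrow> (\<integral>\<^sup>+y. (\<integral>\<^sup>+x. ennreal ((F x y)\<^sup>2) \<partial>\<mu>) \<partial>lborel) < \<infinity>"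
    and "energy \<mu> F = enn2real (\<integral>\<^sup>+y. (\<integral>\<^sup>+x. ennreal ((F x y)\<^sup>2) \<partial>\<mu>) \<partial>lborel)"
proof -
  note s = bdd_meas_slice[OF F]
  note v = variance_bounded[OF F(2) s(2) s(3)]
  have inner: "(\<integral>\<^sup>+x. ennreal ((F x y)\<^sup>2) \<partial>\<mu>) = ennreal (\<integral>x. (F x y)\<^sup>2 \<partial>\<mu>)" for y
    by (rule nn_integral_eq_integral[OF v(5)]) simp
  show "finite_energy \<mu> F \<longleftrightarrow> (\<integral>\<^sup>+y. (\<integral>\<^sup>+x. ennreal ((F x y)\<^sup>2) \<partial>\<mu>) \<partial>lborel) < \<infinity>"
    unfolding finite_energy_def integrable_iff_bounded inner using s(5) by simp
  show "energy \<mu> F = enn2real (\<integral>\<^sup>+y. (\<integral>\<^sup>+x. ennreal ((F x y)\<^sup>2) \<partial>\<mu>) \<partial>lborel)"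
    unfolding energy_def inner using s(5) by (intro integral_eq_nn_integral) auto
qed

lemma bdd_meas_moved_by:
  assumes F: "bdd_meas X C F" and g: "g \<in> X \<rightarrow>\<^sub>M SL_borel"
  shows "bdd_meas X C (moved_by g F)"
proof -
  have [measurable]: "case_prod F \<in> borel_measurable (X \<Otimes>\<^sub>M borel)" using F by (simp add: bdd_meas_def)
  have [measurable]: "g \<in> X \<rightarrow>\<^sub>M borel" using g by (simp add: measurable_restrict_space2_iff)
  have "(\<lambda>p. case_prod F (fst p, g (fst p) *v snd p)) \<in> borel_measurable (X \<Otimes>\<^sub>M borel)"
    by measurable
  then show ?thesis using F by (simp add: bdd_meas_def moved_by_def case_prod_beta')
qed

text \<open>For fixed \<open>x\<close> the vector is moved by a matrix of determinant 1.\<close>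

lemma energy_moved_by:
  fixes F :: "'x \<Rightarrow> real^'n \<Rightarrow> real"
  assumes F: "bdd_meas X C F" "prob_space \<mu>" "sets \<mu> = sets X" and g: "g \<in> X \<rightarrow>\<^sub>M SL_borel"
  shows "finite_energy \<mu> (moved_by g F) \<longleftrightarrow> finite_energy \<mu> F" and "energy \<mu> (moved_by g F) = energy \<mu> F"
proof -
  interpret prob_space \<mu> by fact
  interpret pair_sigma_finite \<mu> "lborel :: (real^'n) measure" by unfold_locales
  note [measurable_cong] = F(3)
  have m [measurable]: "case_prod F \<in> borel_measurable (X \<Otimes>\<^sub>M borel)" using F by (simp add: bdd_meas_def)
  note R = bdd_meas_moved_by[OF F(1) g]
  have mR [measurable]: "case_prod (moved_by g F) \<in> borel_measurable (X \<Otimes>\<^sub>M borel)" using R by (simp add: bdd_meas_def)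
  have "(\<integral>\<^sup>+y. (\<integral>\<^sup>+x. ennreal ((moved_by g F x y)\<^sup>2) \<partial>\<mu>) \<partial>lborel)
      = (\<integral>\<^sup>+x. (\<integral>\<^sup>+y. ennreal ((moved_by g F x y)\<^sup>2) \<partial>lborel) \<partial>\<mu>)"
    by (rule Fubini') measurable
  also have "\<dots> = (\<integral>\<^sup>+x. (\<integral>\<^sup>+y. ennreal ((F x y)\<^sup>2) \<partial>lborel) \<partial>\<mu>)"
  proof (rule nn_integral_cong)
    fix x assume "x \<in> space \<mu>"
    then have x [measurable]: "x \<in> space X" using sets_eq_imp_space_eq[OF F(3)] by simp
    then have SL: "g x \<in> SL" using measurable_space[OF g] by (auto simp: space_restrict_space)
    have "(\<integral>\<^sup>+y. ennreal ((F x y)\<^sup>2) \<partial>lborel) = (\<integral>\<^sup>+y. ennreal ((F x y)\<^sup>2) \<partial>distr lborel borel ((*v) (g x)))"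
      by (simp add: lborel_distr_SL[OF SL])
    also have "\<dots> = (\<integral>\<^sup>+y. ennreal ((F x (g x *v y))\<^sup>2) \<partial>lborel)"
      by (rule nn_integral_distr) measurable
    finally show "(\<integral>\<^sup>+y. ennreal ((moved_by g F x y)\<^sup>2) \<partial>lborel) = (\<integral>\<^sup>+y. ennreal ((F x y)\<^sup>2) \<partial>lborel)"
      by (simp add: moved_by_def)
  qed
  also have "\<dots> = (\<integral>\<^sup>+y. (\<integral>\<^sup>+x. ennreal ((F x y)\<^sup>2) \<partial>\<mu>) \<partial>lborel)"
    by (rule Fubini'[symmetric]) measurable
  finally show "finite_energy \<mu> (moved_by g F) \<longleftrightarrow> finite_energy \<mu> F" "energy \<mu> (moved_by g F) = energy \<mu> F"
    by (simp_all add: energy_nn_integral[OF F] energy_nn_integral[OF R F(2,3)])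
qed

text \<open>The function \<open>a\<close> is the part of \<open>F\<close> that does not depend on the state. After the transition it is orthogonal
  to the remainder, whose energy has been reduced by the factor \<open>c\<^sup>2\<close>.\<close>

lemma markov_avg_energy:
  fixes F :: "'x \<Rightarrow> 'b::euclidean_space \<Rightarrow> real"
  assumes step: "kernel_step X \<mu> \<kappa> \<mu>' c" and F: "bdd_meas X 1 F" and fin: "finite_energy \<mu>' F"
  defines "G \<equiv> markov_avg X \<kappa> F" and "a \<equiv> \<lambda>y. \<integral>x. F x y \<partial>\<mu>'"
  shows "bdd_meas X 1 G" and "a \<in> borel_measurable borel" and "\<And>y. \<bar>a y\<bar> \<le> 1"
    and "integrable lborel (\<lambda>y. (a y)\<^sup>2)" and "sq_norm a \<le> energy \<mu>' F"
    and "finite_energy \<mu> (\<lambda>x y. G x y - a y)"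
    and "energy \<mu> (\<lambda>x y. G x y - a y) \<le> c\<^sup>2 * (energy \<mu>' F - sq_norm a)"
    and "finite_energy \<mu> G"
    and "energy \<mu> G = sq_norm a + energy \<mu> (\<lambda>x y. G x y - a y)"
    and "bdd_meas X 2 (\<lambda>x y. G x y - a y)"
proof -
  have p: "prob_space \<mu>" "prob_space \<mu>'" and s: "sets \<mu> = sets X" "sets \<mu>' = sets X"
    and \<kappa>: "\<kappa> \<in> X \<rightarrow>\<^sub>M prob_algebra X"
    using step by (auto simp: kernel_step_def)
  have sp: "space \<mu> = space X" using sets_eq_imp_space_eq[OF s(1)] .
  note sl = bdd_meas_slice[OF F p(2) s(2)]
  note v = variance_bounded[OF p(2) sl(2,3)]
  have m: "case_prod F \<in> borel_measurable (X \<Otimes>\<^sub>M borel)" using F by (simp add: bdd_meas_def)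
  have "case_prod G \<in> borel_measurable (X \<Otimes>\<^sub>M borel)"
  proof (rule measurable_cong[THEN iffD1, OF _ kernel_op_measurable[OF \<kappa> m]])
    show "(case p of (x, y) \<Rightarrow> kernel_op \<kappa> (\<lambda>z. F z y) x) = case_prod G p" if "p \<in> space (X \<Otimes>\<^sub>M borel)" for p
      using that by (auto simp: G_def markov_avg_def space_pair_measure)
  qed
  then show G: "bdd_meas X 1 G"
    using kernel_op_bounded(1)[OF \<kappa> sl(1,3)] by (auto simp: bdd_meas_def G_def markov_avg_def)
  show a [measurable]: "a \<in> borel_measurable borel" unfolding a_def by (rule sl(4))
  show ab: "\<bar>a y\<bar> \<le> 1" for y unfolding a_def by (rule v(3))
  have a2: "(a y)\<^sup>2 \<le> (\<integral>x. (F x y)\<^sup>2 \<partial>\<mu>')" for y unfolding a_def by (rule v(2))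
  have fin': "integrable lborel (\<lambda>y. \<integral>x. (F x y)\<^sup>2 \<partial>\<mu>')" using fin by (simp add: finite_energy_def)
  show inta: "integrable lborel (\<lambda>y. (a y)\<^sup>2)"
    by (rule Bochner_Integration.integrable_bound[OF fin']) (use a2 in auto)
  show "sq_norm a \<le> energy \<mu>' F"
    unfolding energy_def by (rule integral_mono[OF inta fin' a2])
  have mG: "case_prod G \<in> borel_measurable (X \<Otimes>\<^sub>M borel)" using G by (simp add: bdd_meas_def)
  have "(\<lambda>(x, y). G x y - a y) \<in> borel_measurable (X \<Otimes>\<^sub>M borel)" using mG by measurable
  moreover have "\<bar>G x y - a y\<bar> \<le> 2" for x y
    using ab[of y] bdd_meas_slice(3)[OF G p(1) s(1), of x y] by linarith
  ultimately show Ga: "bdd_meas X 2 (\<lambda>x y. G x y - a y)" by (simp add: bdd_meas_def)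
  note slG = bdd_meas_slice[OF G p(1) s(1)] and slGa = bdd_meas_slice[OF Ga p(1) s(1)]
  note vG = variance_bounded[OF p(1) slG(2,3)]
  have stepF: "(\<integral>x. G x y \<partial>\<mu>) = a y"
      "(\<integral>x. (G x y - a y)\<^sup>2 \<partial>\<mu>) \<le> c\<^sup>2 * ((\<integral>x. (F x y)\<^sup>2 \<partial>\<mu>') - (a y)\<^sup>2)" for y
  proof -
    have st: "(\<integral>x. kernel_op \<kappa> (\<lambda>x. F x y) x \<partial>\<mu>) = a y \<and>
      (\<integral>x. (kernel_op \<kappa> (\<lambda>x. F x y) x - a y)\<^sup>2 \<partial>\<mu>) \<le> c\<^sup>2 * ((\<integral>x. (F x y)\<^sup>2 \<partial>\<mu>') - (a y)\<^sup>2)"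
      using step sl(1)[of y] sl(3)[of _ y] unfolding kernel_step_def a_def by simp
    have "(\<integral>x. G x y \<partial>\<mu>) = (\<integral>x. kernel_op \<kappa> (\<lambda>x. F x y) x \<partial>\<mu>)"
      by (rule Bochner_Integration.integral_cong) (simp_all add: G_def markov_avg_def sp)
    then show "(\<integral>x. G x y \<partial>\<mu>) = a y" using st by simp
    have "(\<integral>x. (G x y - a y)\<^sup>2 \<partial>\<mu>) = (\<integral>x. (kernel_op \<kappa> (\<lambda>x. F x y) x - a y)\<^sup>2 \<partial>\<mu>)"
      by (rule Bochner_Integration.integral_cong) (simp_all add: G_def markov_avg_def sp)
    then show "(\<integral>x. (G x y - a y)\<^sup>2 \<partial>\<mu>) \<le> c\<^sup>2 * ((\<integral>x. (F x y)\<^sup>2 \<partial>\<mu>') - (a y)\<^sup>2)" using st by simp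
  qed
  have var: "(\<integral>x. (G x y)\<^sup>2 \<partial>\<mu>) = (a y)\<^sup>2 + (\<integral>x. (G x y - a y)\<^sup>2 \<partial>\<mu>)" for y
    using vG(1)[of y] by (simp add: stepF(1))
  have bnd: "integrable lborel (\<lambda>y. c\<^sup>2 * ((\<integral>x. (F x y)\<^sup>2 \<partial>\<mu>') - (a y)\<^sup>2))"
    using fin' inta by simp
  have "integrable lborel (\<lambda>y. \<integral>x. (G x y - a y)\<^sup>2 \<partial>\<mu>)"
    by (rule Bochner_Integration.integrable_bound[OF bnd])
       (use slGa(5) stepF(2) in \<open>auto intro!: AE_I2 order_trans[OF _ abs_ge_self]\<close>)
  then show finGa: "finite_energy \<mu> (\<lambda>x y. G x y - a y)" by (simp add: finite_energy_def)
  have "energy \<mu> (\<lambda>x y. G x y - a y) \<le> (\<integral>y. c\<^sup>2 * ((\<integral>x. (F x y)\<^sup>2 \<partial>\<mu>') - (a y)\<^sup>2) \<partial>lborel)"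
    unfolding energy_def by (rule integral_mono[OF finGa[unfolded finite_energy_def] bnd stepF(2)])
  also have "\<dots> = c\<^sup>2 * (energy \<mu>' F - sq_norm a)"
    using fin' inta by (simp add: energy_def)
  finally show "energy \<mu> (\<lambda>x y. G x y - a y) \<le> c\<^sup>2 * (energy \<mu>' F - sq_norm a)" .
  show "finite_energy \<mu> G"
    unfolding finite_energy_def var
    by (rule Bochner_Integration.integrable_add[OF inta finGa[unfolded finite_energy_def]])
  show "energy \<mu> G = sq_norm a + energy \<mu> (\<lambda>x y. G x y - a y)"
    unfolding energy_def var
    by (rule Bochner_Integration.integral_add[OF inta finGa[unfolded finite_energy_def]])
qed

text \<open>Here \<open>s\<close> is the energy at the start, \<open>\<alpha>\<close> and \<open>\<beta>\<close> are the energies of its constant and mean-zero part after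
  the first transition, and \<open>M\<close> is that of the constant part after the rotation. If \<open>\<alpha>\<close> is much smaller than
  \<open>s\<close>, the first transition has contracted; otherwise \<open>\<beta>\<close> is small and \<open>M\<close> is smaller than \<open>s\<close>, so that the
  second transition contracts. The two bounds on \<open>E\<close> are linear in \<open>\<alpha>\<close>, and a convex combination of them with weight
  \<open>\<eta> / 2\<close> covers both cases.\<close>

lemma two_step_arithmetic:
  fixes \<eta> :: real
  assumes \<eta>: "0 < \<eta>" "\<eta> < 1" and C: "0 \<le> C" "C \<le> 1"
    and M: "M \<le> (1 - \<eta>/2) * \<alpha> + ((2 - \<eta>) / \<eta>) * \<beta>" "M \<le> \<alpha> + \<beta>"
    and \<beta>: "\<beta> \<le> C * (s - \<alpha>)" and \<alpha>: "\<alpha> \<le> s" "0 \<le> \<alpha>" "0 \<le> \<beta>"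
    and E: "E \<le> M + C * (\<alpha> + \<beta> - M)"
  shows "E \<le> (1 - (1 - C) * \<eta>\<^sup>2 / 4) * s"
proof -
  have s\<beta>: "\<beta> \<le> s - \<alpha>"
    using \<beta> mult_right_mono[of C 1 "s - \<alpha>"] C \<alpha> by simp
  have c1: "0 \<le> (2 - \<eta>) / \<eta>" using \<eta> by simp
  have b1: "E \<le> (1 - C) * ((1 - \<eta>/2) * \<alpha> + ((2 - \<eta>) / \<eta>) * (s - \<alpha>)) + C * s"
  proof -
    have "E \<le> (1 - C) * M + C * (\<alpha> + \<beta>)" using E by (simp add: algebra_simps)
    also have "\<dots> \<le> (1 - C) * ((1 - \<eta>/2) * \<alpha> + ((2 - \<eta>) / \<eta>) * \<beta>) + C * s"
      using C M(1) s\<beta> by (intro add_mono mult_left_mono) auto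
    also have "\<dots> \<le> (1 - C) * ((1 - \<eta>/2) * \<alpha> + ((2 - \<eta>) / \<eta>) * (s - \<alpha>)) + C * s"
      using C c1 s\<beta> by (intro add_mono mult_left_mono order_refl) auto
    finally show ?thesis .
  qed
  have b2: "E \<le> (1 - C) * \<alpha> + C * s"
  proof -
    have "E \<le> (1 - C) * M + C * (\<alpha> + \<beta>)" using E by (simp add: algebra_simps)
    also have "\<dots> \<le> (1 - C) * (\<alpha> + \<beta>) + C * (\<alpha> + \<beta>)"
      using C M(2) by (intro add_mono mult_left_mono) auto
    also have "\<dots> = \<alpha> + \<beta>" by (simp add: algebra_simps)
    also have "\<dots> \<le> \<alpha> + C * (s - \<alpha>)" using \<beta> by simp
    finally show ?thesis by (simp add: algebra_simps)
  qed
  have "E = (\<eta>/2) * E + (1 - \<eta>/2) * E" by (simp add: algebra_simps)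
  also have "\<dots> \<le> (\<eta>/2) * ((1 - C) * ((1 - \<eta>/2) * \<alpha> + ((2 - \<eta>) / \<eta>) * (s - \<alpha>)) + C * s)
      + (1 - \<eta>/2) * ((1 - C) * \<alpha> + C * s)"
    using \<eta> b1 b2 by (intro add_mono mult_left_mono) auto
  also have "\<dots> = C * s + (1 - C) * ((1 - \<eta>\<^sup>2/4) * \<alpha> + (1 - \<eta>/2) * (s - \<alpha>))"
    using \<eta> by (simp add: field_simps power2_eq_square)
  also have "\<dots> \<le> C * s + (1 - C) * ((1 - \<eta>\<^sup>2/4) * \<alpha> + (1 - \<eta>\<^sup>2/4) * (s - \<alpha>))"
  proof -
    have "\<eta>\<^sup>2 \<le> 2 * \<eta>" using \<eta> by (simp add: power2_eq_square)
    then show ?thesis using C \<alpha> by (intro add_mono mult_left_mono mult_right_mono order_refl) auto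
  qed
  also have "(1 - \<eta>\<^sup>2/4) * \<alpha> + (1 - \<eta>\<^sup>2/4) * (s - \<alpha>) = (1 - \<eta>\<^sup>2/4) * s"
    by (simp flip: distrib_left)
  also have "C * s + (1 - C) * ((1 - \<eta>\<^sup>2/4) * s) = (1 - (1 - C) * \<eta>\<^sup>2 / 4) * s" by (simp add: field_simps)
  finally show ?thesis .
qed


lemma square_sum_weighted:
  fixes p r t :: real
  assumes "t > 0"
  shows "(p + r)\<^sup>2 \<le> (1 + t) * p\<^sup>2 + (1 + 1/t) * r\<^sup>2"
proof -
  have "0 \<le> (t * p - r)\<^sup>2 / t" using assms by simp
  also have "\<dots> = t * p\<^sup>2 + r\<^sup>2 / t - 2 * p * r"
    using assms by (simp add: power2_eq_square field_simps)
  finally show ?thesis by (simp add: power2_sum algebra_simps)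
qed

text \<open>After the first transition the function is \<open>a y + D x y\<close> with \<open>D\<close> of mean zero. The mean of its rotation is \<open>b + r\<close>,
  where \<open>b\<close> is the average of \<open>a\<close> over the matrices, of square norm at most \<open>1 - \<eta>\<close> times that of \<open>a\<close>, and
  \<open>r\<close> is bounded by the energy of \<open>D\<close>. The second transition then acts on what is not part of this mean.\<close>

lemma two_step_contraction:
  fixes F :: "'x \<Rightarrow> real^'n \<Rightarrow> real"
  assumes S0: "kernel_step X \<mu>0 \<kappa>0 \<mu>1 c" and S1: "kernel_step X \<mu>1 \<kappa>1 \<mu>2 c" and c: "c\<^sup>2 \<le> 1"
    and g: "g \<in> X \<rightarrow>\<^sub>M SL_borel"
    and contr: "contracts (distr \<mu>1 SL_borel g) \<eta>" and \<eta>: "0 < \<eta>" "\<eta> < 1"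
    and F: "bdd_meas X 1 F" and fin: "finite_energy \<mu>2 F"
  defines "L \<equiv> markov_avg X \<kappa>0 (moved_by g (markov_avg X \<kappa>1 F))"
  shows "bdd_meas X 1 L" and "finite_energy \<mu>0 L"
    and "energy \<mu>0 L \<le> (1 - (1 - c\<^sup>2) * \<eta>\<^sup>2 / 4) * energy \<mu>2 F"
proof -
  define a where "a = (\<lambda>y. \<integral>x. F x y \<partial>\<mu>2)"
  define G where "G = markov_avg X \<kappa>1 F"
  define D where "D = (\<lambda>x y. G x y - a y)"
  define H where "H = moved_by g G"
  define m where "m = (\<lambda>y. \<integral>x. H x y \<partial>\<mu>1)"
  have a_eq: "(\<integral>x. F x y \<partial>\<mu>2) = a y" for y by (simp add: a_def)
  note A = markov_avg_energy[OF S1 F fin, folded G_def, unfolded a_eq, folded D_def]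
  have p1: "prob_space \<mu>1" and s1: "sets \<mu>1 = sets X" using S1 by (auto simp: kernel_step_def)
  interpret prob_space \<mu>1 by (rule p1)
  have H: "bdd_meas X 1 H" unfolding H_def by (rule bdd_meas_moved_by[OF A(1) g])
  have finH: "finite_energy \<mu>1 H" and enH: "energy \<mu>1 H = energy \<mu>1 G"
    unfolding H_def using energy_moved_by[OF A(1) p1 s1 g] A(8) by auto
  have m_def': "(\<integral>x. H x y \<partial>\<mu>1) = m y" for y by (simp add: m_def)
  note B = markov_avg_energy[OF S0 H finH, unfolded m_def']
  have L: "L = markov_avg X \<kappa>0 H" by (simp add: L_def H_def G_def)
  show "bdd_meas X 1 L" "finite_energy \<mu>0 L" unfolding L by (rule B(1), rule B(8))
  have a_bm: "bdd_meas X 1 (\<lambda>x. a)"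
    using A(2,3) by (auto simp: bdd_meas_def)
  have fin_a: "finite_energy \<mu>1 (\<lambda>x. a)" "energy \<mu>1 (\<lambda>x. a) = sq_norm a"
    using A(4) by (simp_all add: finite_energy_def energy_def prob_space)
  have Ra: "bdd_meas X 1 (moved_by g (\<lambda>x. a))" by (rule bdd_meas_moved_by[OF a_bm g])
  have fin_Ra: "finite_energy \<mu>1 (moved_by g (\<lambda>x. a))"
    using energy_moved_by(1)[OF a_bm p1 s1 g] fin_a by simp
  have RD: "bdd_meas X 2 (moved_by g D)" by (rule bdd_meas_moved_by[OF A(10) g])
  have fin_RD: "finite_energy \<mu>1 (moved_by g D)" and en_RD: "energy \<mu>1 (moved_by g D) = energy \<mu>1 D"
    using energy_moved_by[OF A(10) p1 s1 g] A(6) by auto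
  note sa = bdd_meas_slice[OF Ra p1 s1] and sD = bdd_meas_slice[OF RD p1 s1]
  note va = variance_bounded[OF p1 sa(2,3)] and vD = variance_bounded[OF p1 sD(2,3)]
  define b where "b = (\<lambda>y. \<integral>x. moved_by g (\<lambda>x. a) x y \<partial>\<mu>1)"
  define r where "r = (\<lambda>y. \<integral>x. moved_by g D x y \<partial>\<mu>1)"
  have m_eq: "m y = b y + r y" for y
    unfolding m_def b_def r_def
    by (subst Bochner_Integration.integral_add[OF va(4) vD(4), symmetric])
       (simp add: H_def moved_by_def D_def)
  have b_meas: "b \<in> borel_measurable borel" and r_meas: "r \<in> borel_measurable borel"
    unfolding b_def r_def by (rule sa(4), rule sD(4))
  have int_b: "integrable lborel (\<lambda>y. (b y)\<^sup>2)"
    by (rule Bochner_Integration.integrable_bound[OF fin_Ra[unfolded finite_energy_def]])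
       (use va(2) b_meas in \<open>auto simp: b_def\<close>)
  have int_r: "integrable lborel (\<lambda>y. (r y)\<^sup>2)"
    by (rule Bochner_Integration.integrable_bound[OF fin_RD[unfolded finite_energy_def]])
       (use vD(2) r_meas in \<open>auto simp: r_def\<close>)
  have r_le: "sq_norm r \<le> energy \<mu>1 D"
  proof -
    have "sq_norm r \<le> energy \<mu>1 (moved_by g D)"
      unfolding energy_def
      by (rule integral_mono[OF int_r fin_RD[unfolded finite_energy_def]]) (simp add: r_def vD(2))
    then show ?thesis by (simp add: en_RD)
  qed
  have b_le: "sq_norm b \<le> (1 - \<eta>) * sq_norm a"
  proof -
    have "b y = (\<integral>A. a (A *v y) \<partial>distr \<mu>1 SL_borel g)" for y
    proof -
      have "g \<in> \<mu>1 \<rightarrow>\<^sub>M SL_borel" using g by (simp add: measurable_cong_sets[OF s1 refl])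
      moreover have "(\<lambda>A. a (A *v y)) \<in> borel_measurable SL_borel"
        by (intro measurable_restrict_space1 measurable_compose[OF _ A(2)]) measurable
      ultimately show ?thesis by (simp add: b_def moved_by_def integral_distr)
    qed
    then have b_alt: "b = (\<lambda>y. \<integral>A. a (A *v y) \<partial>distr \<mu>1 SL_borel g)" ..
    show ?thesis
      unfolding b_alt using contr[unfolded contracts_def, rule_format, of a 1] A(2,3,4) by blast
  qed
  \<comment> \<open>The parameter turns the factor \<open>1 - \<eta>\<close> into \<open>1 - \<eta> / 2\<close>.\<close>
  define t where "t = (\<eta>/2) / (1 - \<eta>)"
  have t: "t > 0" using \<eta> by (simp add: t_def)
  have t1: "(1 + t) * (1 - \<eta>) = 1 - \<eta>/2" and t2: "1 + 1/t = (2 - \<eta>) / \<eta>"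
    using \<eta> by (simp_all add: t_def field_simps)
  let ?\<alpha> = "\<integral>y. (a y)\<^sup>2 \<partial>lborel" and ?M = "\<integral>y. (m y)\<^sup>2 \<partial>lborel"
  have "?M \<le> (\<integral>y. (1 + t) * (b y)\<^sup>2 + (1 + 1/t) * (r y)\<^sup>2 \<partial>lborel)"
    by (rule integral_mono[OF B(4)]) (use int_b int_r square_sum_weighted[OF t] in \<open>auto simp: m_eq\<close>)
  also have "\<dots> = (1 + t) * sq_norm b + (1 + 1/t) * sq_norm r"
    using int_b int_r by simp
  also have "\<dots> \<le> (1 + t) * ((1 - \<eta>) * ?\<alpha>) + (1 + 1/t) * energy \<mu>1 D"
    using t b_le r_le by (intro add_mono mult_left_mono) auto
  also have "\<dots> = (1 - \<eta>/2) * ?\<alpha> + ((2 - \<eta>) / \<eta>) * energy \<mu>1 D"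
    by (simp only: t1[symmetric] t2 mult.assoc)
  finally have M1: "?M \<le> (1 - \<eta>/2) * ?\<alpha> + ((2 - \<eta>) / \<eta>) * energy \<mu>1 D" .
  have M2: "?M \<le> ?\<alpha> + energy \<mu>1 D" using B(5) by (simp add: enH A(9))
  have E: "energy \<mu>0 L \<le> ?M + c\<^sup>2 * (?\<alpha> + energy \<mu>1 D - ?M)"
    using B(7,9) by (simp add: L enH A(9))
  have D0: "0 \<le> energy \<mu>1 D" by (simp add: energy_def)
  show "energy \<mu>0 L \<le> (1 - (1 - c\<^sup>2) * \<eta>\<^sup>2 / 4) * energy \<mu>2 F"
    by (rule two_step_arithmetic[OF \<eta> _ c M1 M2 A(7) A(5) _ D0 E]) simp_all
qed

lemma one_step_nonexpansive:
  fixes F :: "'x \<Rightarrow> 'b::euclidean_space \<Rightarrow> real"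
  assumes "kernel_step X \<mu> \<kappa> \<mu>' c" "bdd_meas X 1 F" "finite_energy \<mu>' F" and c: "c\<^sup>2 \<le> 1"
  shows "energy \<mu> (markov_avg X \<kappa> F) \<le> energy \<mu>' F"
proof -
  note A = markov_avg_energy[OF assms(1-3)]
  have "c\<^sup>2 * (energy \<mu>' F - (\<integral>y. (\<integral>x. F x y \<partial>\<mu>')\<^sup>2 \<partial>lborel))
      \<le> 1 * (energy \<mu>' F - (\<integral>y. (\<integral>x. F x y \<partial>\<mu>')\<^sup>2 \<partial>lborel))"
    using A(5) c by (intro mult_right_mono) auto
  from order_trans[OF A(7) this] show ?thesis unfolding A(9) by simp
qed

text \<open>The value \<open>backward X k g B d j x y\<close> is the conditional expectation of \<open>B (g\<^sub>j\<^sub>+\<^sub>d \<dots> g\<^sub>j\<^sub>+\<^sub>1 y)\<close> given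
  that the chain is at \<open>x\<close> at time \<open>j\<close>.\<close>

fun backward :: "'x measure \<Rightarrow> (nat \<Rightarrow> 'x \<Rightarrow> 'x measure) \<Rightarrow> (nat \<Rightarrow> 'x \<Rightarrow> real^'n^'n) \<Rightarrow> (real^'n \<Rightarrow> real)
    \<Rightarrow> nat \<Rightarrow> nat \<Rightarrow> 'x \<Rightarrow> real^'n \<Rightarrow> real" where
  "backward X k g B 0 j = (\<lambda>x. B)"
| "backward X k g B (Suc d) j = markov_avg X (k j) (moved_by (g (Suc j)) (backward X k g B d (Suc j)))"

text \<open>The recursion is taken two steps at a time, since a single step need not contract.\<close>

lemma backward_energy:
  fixes B :: "real^'n \<Rightarrow> real"
  assumes step: "\<And>n. n \<ge> 1 \<Longrightarrow> kernel_step X (\<mu> n) (k n) (\<mu> (Suc n)) c" and c: "c\<^sup>2 \<le> 1"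
    and g: "\<And>n. n \<ge> 1 \<Longrightarrow> g n \<in> X \<rightarrow>\<^sub>M SL_borel"
    and contr: "\<And>n. n \<ge> 1 \<Longrightarrow> contracts (distr (\<mu> n) SL_borel (g n)) \<eta>"
    and \<eta>: "0 < \<eta>" "\<eta> < 1"
    and B: "B \<in> borel_measurable borel" "\<And>y. \<bar>B y\<bar> \<le> 1" "integrable lborel (\<lambda>y. (B y)\<^sup>2)"
    and j: "j \<ge> 1"
  shows "bdd_meas X 1 (backward X k g B d j) \<and> finite_energy (\<mu> j) (backward X k g B d j) \<and>
    energy (\<mu> j) (backward X k g B d j) \<le> (1 - (1 - c\<^sup>2) * \<eta>\<^sup>2 / 4) ^ (d div 2) * sq_norm B"
  using j
proof (induction d arbitrary: j rule: induct_nat_012)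
  case 0
  interpret prob_space "\<mu> j" using step[OF 0] by (simp add: kernel_step_def)
  show ?case using B by (simp add: bdd_meas_def finite_energy_def energy_def prob_space)
next
  case 1
  interpret prob_space "\<mu> (Suc j)" using step[OF 1] by (simp add: kernel_step_def)
  have p: "prob_space (\<mu> (Suc j))" and s: "sets (\<mu> (Suc j)) = sets X" using step[OF 1] by (simp_all add: kernel_step_def)
  have Bb: "bdd_meas X 1 (\<lambda>x. B)" using B by (simp add: bdd_meas_def)
  have fB: "finite_energy (\<mu> (Suc j)) (\<lambda>x. B)" "energy (\<mu> (Suc j)) (\<lambda>x. B) = sq_norm B"
    using B by (simp_all add: finite_energy_def energy_def prob_space)
  have gj: "g (Suc j) \<in> X \<rightarrow>\<^sub>M SL_borel" by (rule g) simp
  note R = bdd_meas_moved_by[OF Bb gj] and E = energy_moved_by[OF Bb p s gj]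
  have fR: "finite_energy (\<mu> (Suc j)) (moved_by (g (Suc j)) (\<lambda>x. B))" using E(1) fB(1) by simp
  show ?case
    using markov_avg_energy(1,8)[OF step[OF 1] R fR] one_step_nonexpansive[OF step[OF 1] R fR c] E(2) fB(2)
    by simp
next
  case (ge2 d)
  let ?j = "Suc (Suc j)"
  have j2: "?j \<ge> 1" "Suc j \<ge> 1" by simp_all
  have p: "prob_space (\<mu> ?j)" and s: "sets (\<mu> ?j) = sets X" using step[OF j2(2)] by (simp_all add: kernel_step_def)
  define F where "F = moved_by (g ?j) (backward X k g B d ?j)"
  have IH: "bdd_meas X 1 (backward X k g B d ?j)" "finite_energy (\<mu> ?j) (backward X k g B d ?j)"
    "energy (\<mu> ?j) (backward X k g B d ?j) \<le> (1 - (1 - c\<^sup>2) * \<eta>\<^sup>2 / 4) ^ (d div 2) * sq_norm B"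
    using ge2.IH(1)[OF j2(1)] by auto
  note E = energy_moved_by[OF IH(1) p s g[OF j2(1)], folded F_def]
  have F: "bdd_meas X 1 F" unfolding F_def by (rule bdd_meas_moved_by[OF IH(1) g[OF j2(1)]])
  have fF: "finite_energy (\<mu> ?j) F" using E(1) IH(2) by simp
  note T = two_step_contraction[OF step[OF ge2.prems] step[OF j2(2)] c g[OF j2(2)] contr[OF j2(2)] \<eta> F fF]
  have q: "0 \<le> 1 - (1 - c\<^sup>2) * \<eta>\<^sup>2 / 4"
  proof -
    have "(1 - c\<^sup>2) * \<eta>\<^sup>2 \<le> 1 * 1"
      using \<eta> by (intro mult_mono) (auto simp: power_le_one)
    then show ?thesis by simp
  qed
  have bk: "backward X k g B (Suc (Suc d)) j = markov_avg X (k j) (moved_by (g (Suc j)) (markov_avg X (k (Suc j)) F))"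
    by (simp add: F_def)
  have "(1 - (1 - c\<^sup>2) * \<eta>\<^sup>2 / 4) * energy (\<mu> ?j) F
      \<le> (1 - (1 - c\<^sup>2) * \<eta>\<^sup>2 / 4) * ((1 - (1 - c\<^sup>2) * \<eta>\<^sup>2 / 4) ^ (d div 2) * sq_norm B)"
    unfolding E(2) by (rule mult_left_mono[OF IH(3) q])
  then show ?case
    unfolding bk using T by (simp add: mult.assoc)
qed

section \<open>Exponential growth\<close>

lemma measurable_past:
  assumes mc: "markov_chain P X k \<xi>" and i: "1 \<le> i" "i \<le> n"
  shows "\<xi> i \<in> past_algebra P X \<xi> n \<rightarrow>\<^sub>M X"
proof -
  have \<xi>: "\<And>i. i \<ge> 1 \<Longrightarrow> \<xi> i \<in> P \<rightarrow>\<^sub>M X" using mc by (auto simp: markov_chain_def)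
  let ?hist = "\<lambda>\<omega>. \<lambda>i\<in>{1..n}. \<xi> i \<omega>"
  have hist: "?hist \<in> P \<rightarrow>\<^sub>M PiM {1..n} (\<lambda>_. X)"
    by (rule measurable_restrict) (auto intro: \<xi>)
  have "?hist \<in> space P \<rightarrow> space (PiM {1..n} (\<lambda>_. X))"
    using measurable_space[OF hist] by blast
  then have "?hist \<in> past_algebra P X \<xi> n \<rightarrow>\<^sub>M PiM {1..n} (\<lambda>_. X)"
    unfolding past_algebra_def by (rule measurable_vimage_algebra1)
  from measurable_compose[OF this measurable_component_singleton[of i]] i show ?thesis
    by simp
qed

lemma measurable_mat_prod_vec:
  fixes g :: "nat \<Rightarrow> 'x \<Rightarrow> real^'n^'n"
  assumes \<xi>: "\<And>i. 1 \<le> i \<Longrightarrow> i \<le> n \<Longrightarrow> \<xi> i \<in> Q \<rightarrow>\<^sub>M X"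
    and g: "\<And>i. 1 \<le> i \<Longrightarrow> g i \<in> X \<rightarrow>\<^sub>M SL_borel"
    and f: "f \<in> Q \<rightarrow>\<^sub>M borel"
  shows "(\<lambda>\<omega>. walk g \<xi> n \<omega> *v f \<omega>) \<in> Q \<rightarrow>\<^sub>M borel"
  using \<xi>
proof (induction n)
  case 0
  show ?case using f by simp
next
  case (Suc n)
  have gm: "g (Suc n) \<in> X \<rightarrow>\<^sub>M borel" using g[of "Suc n"] by (simp add: measurable_restrict_space2_iff)
  have "(\<lambda>\<omega>. g (Suc n) (\<xi> (Suc n) \<omega>)) \<in> Q \<rightarrow>\<^sub>M borel"
    by (rule measurable_compose[OF Suc.prems gm]) simp_all
  moreover have "(\<lambda>\<omega>. walk g \<xi> n \<omega> *v f \<omega>) \<in> Q \<rightarrow>\<^sub>M borel"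
    by (rule Suc.IH, rule Suc.prems) simp_all
  ultimately have "(\<lambda>\<omega>. g (Suc n) (\<xi> (Suc n) \<omega>) *v (walk g \<xi> n \<omega> *v f \<omega>)) \<in> Q \<rightarrow>\<^sub>M borel"
    by (rule measurable_matvec)
  then show ?case by (simp add: matrix_vector_mul_assoc)
qed

lemma backward_nonneg:
  assumes "\<And>y. 0 \<le> B y"
  shows "0 \<le> backward X k g B d j x y"
proof (induction d arbitrary: j x y)
  case (Suc d)
  then show ?case by (auto simp: markov_avg_def kernel_op_def moved_by_def intro!: integral_nonneg)
qed (simp add: assms)

text \<open>The Markov property trades one transition along the path for one step of the backward recursion.\<close>

lemma backward_path_expectation:
  fixes B :: "real^'n \<Rightarrow> real"
  assumes mc: "markov_chain P X k \<xi>"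
    and g: "\<And>n. n \<ge> 1 \<Longrightarrow> g n \<in> X \<rightarrow>\<^sub>M SL_borel"
    and bm: "\<And>d j. j \<ge> 1 \<Longrightarrow> bdd_meas X 1 (backward X k g B d j)"
    and B0: "\<And>y. 0 \<le> B y" and j: "j \<ge> 1"
  shows "(\<integral>\<^sup>+\<omega>. ennreal (backward X k g B d j (\<xi> j \<omega>) (walk g \<xi> j \<omega> *v y)) \<partial>P)
    = (\<integral>\<^sup>+\<omega>. ennreal (B (walk g \<xi> (j + d) \<omega> *v y)) \<partial>P)"
  using j
proof (induction d arbitrary: j)
  case (Suc d)
  let ?W = "\<lambda>\<omega>. walk g \<xi> j \<omega> *v y"
  let ?R = "moved_by (g (Suc j)) (backward X k g B d (Suc j))"
  have kp: "k j \<in> X \<rightarrow>\<^sub>M prob_algebra X" and \<xi>: "\<xi> j \<in> P \<rightarrow>\<^sub>M X"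
    using mc Suc.prems by (auto simp: markov_chain_def)
  have R: "bdd_meas X 1 ?R" by (rule bdd_meas_moved_by[OF bm g]) simp_all
  have R0: "0 \<le> ?R z w" for z w by (simp add: moved_by_def backward_nonneg B0)
  have W: "?W \<in> past_algebra P X \<xi> j \<rightarrow>\<^sub>M borel"
    by (rule measurable_mat_prod_vec[where X = X]) (auto intro: measurable_past[OF mc] g)
  have Rm: "(\<lambda>(z, w). ennreal (?R z w)) \<in> borel_measurable (X \<Otimes>\<^sub>M borel)"
    using R measurable_compose[of "case_prod ?R" "X \<Otimes>\<^sub>M borel" borel ennreal borel]
    by (simp add: bdd_meas_def case_prod_beta')
  have "(\<integral>\<^sup>+\<omega>. ennreal (backward X k g B (Suc d) j (\<xi> j \<omega>) (?W \<omega>)) \<partial>P)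
      = (\<integral>\<^sup>+\<omega>. (\<integral>\<^sup>+z. ennreal (?R z (?W \<omega>)) \<partial>k j (\<xi> j \<omega>)) \<partial>P)"
  proof (rule nn_integral_cong)
    fix \<omega> assume "\<omega> \<in> space P"
    then have x: "\<xi> j \<omega> \<in> space X" using measurable_space[OF \<xi>] by blast
    then have p: "prob_space (k j (\<xi> j \<omega>))" and s: "sets (k j (\<xi> j \<omega>)) = sets X"
      using measurable_space[OF kp] by (auto simp: space_prob_algebra)
    interpret K: prob_space "k j (\<xi> j \<omega>)" by (rule p)
    note sl = bdd_meas_slice[OF R p s]
    have "integrable (k j (\<xi> j \<omega>)) (\<lambda>z. ?R z (?W \<omega>))"
      by (rule K.integrable_const_bound[where B = 1, OF AE_I2 sl(2)]) (use sl(3) in simp)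
    then have "(\<integral>\<^sup>+z. ennreal (?R z (?W \<omega>)) \<partial>k j (\<xi> j \<omega>)) = ennreal (\<integral>z. ?R z (?W \<omega>) \<partial>k j (\<xi> j \<omega>))"
      by (rule nn_integral_eq_integral) (simp add: R0)
    then show "ennreal (backward X k g B (Suc d) j (\<xi> j \<omega>) (?W \<omega>)) = (\<integral>\<^sup>+z. ennreal (?R z (?W \<omega>)) \<partial>k j (\<xi> j \<omega>))"
      using x by (simp add: markov_avg_def kernel_op_def)
  qed
  also have "\<dots> = (\<integral>\<^sup>+\<omega>. ennreal (?R (\<xi> (Suc j) \<omega>) (?W \<omega>)) \<partial>P)"
    using markov_step[OF mc Suc.prems W Rm] by simp
  also have "\<dots> = (\<integral>\<^sup>+\<omega>. ennreal (backward X k g B d (Suc j) (\<xi> (Suc j) \<omega>) (walk g \<xi> (Suc j) \<omega> *v y)) \<partial>P)"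
    by (simp add: moved_by_def matrix_vector_mul_assoc)
  also have "\<dots> = (\<integral>\<^sup>+\<omega>. ennreal (B (walk g \<xi> (Suc j + d) \<omega> *v y)) \<partial>P)"
    by (rule Suc.IH) simp
  finally show ?case by simp
qed simp

text \<open>The volume of the part of the unit ball that \<open>A\<close> maps into the unit ball.\<close>

definition overlap :: "real^'n^'n \<Rightarrow> ennreal" where
  "overlap A = (\<integral>\<^sup>+y. indicator (cball 0 1) y * indicator (cball 0 1) (A *v y) \<partial>lborel)"

text \<open>The ball of radius \<open>1 / max 1 \<parallel>A\<parallel>\<close> is mapped into the unit ball.\<close>

lemma overlap_lower_bound:
  fixes A :: "real^'n^'n"
  shows "ennreal (unit_ball_vol (real CARD('n)) * (1 / max 1 (onorm ((*v) A))) ^ CARD('n)) \<le> overlap A"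
proof -
  let ?N = "max 1 (onorm ((*v) A))"
  have sub: "norm y \<le> 1 \<and> norm (A *v y) \<le> 1" if y: "norm y \<le> 1 / ?N" for y
  proof
    have "1 / ?N \<le> 1" by simp
    with y show "norm y \<le> 1" by linarith
    have "norm (A *v y) \<le> onorm ((*v) A) * norm y" by (rule onorm) simp
    also have "\<dots> \<le> ?N * (1 / ?N)" using y by (intro mult_mono) auto
    also have "\<dots> = 1" by simp
    finally show "norm (A *v y) \<le> 1" .
  qed
  have "indicator (cball 0 (1 / ?N)) y \<le> (indicator (cball 0 1) y * indicator (cball 0 1) (A *v y) :: ennreal)" for y
    using sub[of y] by (cases "norm y \<le> 1 / ?N") (simp_all add: indicator_def)
  then have "(\<integral>\<^sup>+y. indicator (cball 0 (1 / ?N)) (y :: real^'n) \<partial>lborel) \<le> overlap A"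
    unfolding overlap_def by (rule nn_integral_mono)
  moreover have "(\<integral>\<^sup>+y. indicator (cball 0 (1 / ?N)) (y :: real^'n) \<partial>lborel)
      = ennreal (unit_ball_vol (real CARD('n)) * (1 / ?N) ^ CARD('n))"
    by (simp add: emeasure_cball)
  ultimately show ?thesis by simp
qed

lemma overlap_le: "overlap (A :: real^'n^'n) \<le> ennreal (unit_ball_vol (real CARD('n)))"
proof -
  have "overlap A \<le> (\<integral>\<^sup>+y. indicator (cball 0 1) (y :: real^'n) \<partial>lborel)"
    unfolding overlap_def by (intro nn_integral_mono) (auto simp: indicator_def)
  then show ?thesis by (simp add: emeasure_cball)
qed

text \<open>Integrating over the unit ball, the expected overlap is an inner product with the backward function, which the
  energy bounds: \<open>\<Psi> \<le> s + \<Psi>\<^sup>2 / s\<close> with \<open>s = w ^ (d div 2)\<close> balances the two terms.\<close>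

lemma expected_overlap_decay:
  fixes g :: "nat \<Rightarrow> 'x \<Rightarrow> real^'n^'n"
  assumes mc: "markov_chain P X k \<xi>"
    and g: "\<And>n. n \<ge> 1 \<Longrightarrow> g n \<in> X \<rightarrow>\<^sub>M SL_borel"
    and step: "\<And>n. n \<ge> 1 \<Longrightarrow> kernel_step X (\<mu> n) (k n) (\<mu> (Suc n)) c" and c: "c\<^sup>2 \<le> 1"
    and \<mu>: "\<And>n. \<mu> n = distr P X (\<xi> n)"
    and contr: "\<And>n. n \<ge> 1 \<Longrightarrow> contracts (distr (\<mu> n) SL_borel (g n)) \<eta>"
    and \<eta>: "0 < \<eta>" "\<eta> < 1" and w: "0 < w" "w\<^sup>2 = 1 - (1 - c\<^sup>2) * \<eta>\<^sup>2 / 4"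
  shows "(\<integral>\<^sup>+\<omega>. overlap (walk g \<xi> (Suc d) \<omega>) \<partial>P)
    \<le> ennreal (2 * w ^ (d div 2) * unit_ball_vol (real CARD('n)))"
proof -
  interpret prob_space P using mc by (simp add: markov_chain_def)
  interpret pair_sigma_finite P "lborel :: (real^'n) measure" by unfold_locales
  have \<xi>: "\<And>i. i \<ge> 1 \<Longrightarrow> \<xi> i \<in> P \<rightarrow>\<^sub>M X" using mc by (auto simp: markov_chain_def)
  define V where "V = unit_ball_vol (real CARD('n))"
  have V0: "V \<ge> 0" by (simp add: V_def)
  define B :: "real^'n \<Rightarrow> real" where "B = indicator (cball 0 1)"
  have B: "B \<in> borel_measurable borel" "\<And>y. \<bar>B y\<bar> \<le> 1" "\<And>y. 0 \<le> B y"
    unfolding B_def by (rule borel_measurable_indicator) (simp_all add: indicator_def)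
  have B2: "(B y)\<^sup>2 = B y" for y by (auto simp: B_def indicator_def)
  have emB: "emeasure lborel (cball 0 1 :: (real^'n) set) = ennreal V"
    by (simp add: emeasure_cball V_def)
  have intB: "integrable lborel (\<lambda>y. (B y)\<^sup>2)" "sq_norm B = V"
    unfolding B2 using emB V0 by (auto simp: B_def less_top[symmetric] measure_def)
  have BE: "bdd_meas X 1 (backward X k g B d j) \<and> finite_energy (\<mu> j) (backward X k g B d j) \<and>
      energy (\<mu> j) (backward X k g B d j) \<le> (1 - (1 - c\<^sup>2) * \<eta>\<^sup>2 / 4) ^ (d div 2) * V" if "j \<ge> 1" for d j
    unfolding intB(2)[symmetric]
    by (rule backward_energy[where X = X and \<mu> = \<mu> and k = k and g = g and B = B and c = c and \<eta> = \<eta>])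
       (fact step c g contr \<eta> B intB that)+
  have bm: "bdd_meas X 1 (backward X k g B d j)" if "j \<ge> 1" for d j
    using BE[OF that] by blast
  define \<Psi> where "\<Psi> = moved_by (g 1) (backward X k g B d 1)"
  have one: "(1::nat) \<ge> 1" by simp
  have p1: "prob_space (\<mu> 1)" and s1: "sets (\<mu> 1) = sets X" using step[OF one] by (auto simp: kernel_step_def)
  have \<Psi>: "bdd_meas X 1 \<Psi>" unfolding \<Psi>_def by (rule bdd_meas_moved_by[OF bm[OF one] g[OF one]])
  note ER = energy_moved_by[OF bm[OF one] p1 s1 g[OF one], of d, folded \<Psi>_def]
  have fin: "finite_energy (\<mu> 1) \<Psi>" and en: "energy (\<mu> 1) \<Psi> \<le> (w\<^sup>2) ^ (d div 2) * V"
    using BE[OF one, of d] ER by (simp_all add: w(2))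
  have \<Psi>0: "0 \<le> \<Psi> x y" for x y by (simp add: \<Psi>_def moved_by_def backward_nonneg B(3))
  define s where "s = w ^ (d div 2)"
  have s: "s > 0" using w by (simp add: s_def)
  define i where "i = 1 / s"
  have i: "i > 0" and si: "i * (s * z) = z" for z using s by (simp_all add: i_def)
  have cb [measurable]: "(cball 0 1 :: (real^'n) set) \<in> sets borel" by (simp add: borel_closed)
  have path: "(\<integral>\<^sup>+\<omega>. ennreal (B (walk g \<xi> (Suc d) \<omega> *v y)) \<partial>P)
      = (\<integral>\<^sup>+x. ennreal (\<Psi> x y) \<partial>\<mu> 1)" for y
  proof -
    have "(\<integral>\<^sup>+\<omega>. ennreal (B (walk g \<xi> (Suc d) \<omega> *v y)) \<partial>P)
       = (\<integral>\<^sup>+\<omega>. ennreal (backward X k g B d 1 (\<xi> 1 \<omega>) (walk g \<xi> 1 \<omega> *v y)) \<partial>P)"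
      using backward_path_expectation[OF mc g bm B(3) one, of d y] by simp
    also have "\<dots> = (\<integral>\<^sup>+\<omega>. ennreal (\<Psi> (\<xi> 1 \<omega>) y) \<partial>P)"
      by (simp add: \<Psi>_def moved_by_def)
    also have "\<dots> = (\<integral>\<^sup>+x. ennreal (\<Psi> x y) \<partial>\<mu> 1)"
      unfolding \<mu> using bdd_meas_slice(1)[OF \<Psi> p1 s1, of y] \<xi>[OF one]
      by (subst nn_integral_distr) auto
    finally show ?thesis .
  qed
  note sl = bdd_meas_slice[OF \<Psi> p1 s1]
  have "(\<integral>\<^sup>+\<omega>. overlap (walk g \<xi> (Suc d) \<omega>) \<partial>P)
      = (\<integral>\<^sup>+y. (\<integral>\<^sup>+\<omega>. indicator (cball 0 1) y * indicator (cball 0 1) (walk g \<xi> (Suc d) \<omega> *v y) \<partial>P) \<partial>lborel)"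
    unfolding overlap_def
  proof (rule Fubini'[symmetric])
    have [measurable]: "(\<lambda>p. walk g \<xi> (Suc d) (fst p) *v snd p) \<in> P \<Otimes>\<^sub>M lborel \<rightarrow>\<^sub>M borel"
      by (rule measurable_mat_prod_vec[where X = X and \<xi> = "\<lambda>i p. \<xi> i (fst p)"])
         (auto intro: measurable_compose[OF measurable_fst \<xi>] g)
    have "(\<lambda>p. indicator (cball 0 1) (snd p) * indicator (cball 0 1) (walk g \<xi> (Suc d) (fst p) *v snd p) :: ennreal)
        \<in> borel_measurable (P \<Otimes>\<^sub>M lborel)" by measurable
    then show "(\<lambda>(\<omega>, y). indicator (cball 0 1) y * indicator (cball 0 1) (walk g \<xi> (Suc d) \<omega> *v y) :: ennreal)
        \<in> borel_measurable (P \<Otimes>\<^sub>M lborel)" by (simp add: case_prod_beta')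
  qed
  also have "\<dots> = (\<integral>\<^sup>+y. indicator (cball 0 1) y * (\<integral>\<^sup>+x. ennreal (\<Psi> x y) \<partial>\<mu> 1) \<partial>lborel)"
  proof (rule nn_integral_cong)
    fix y :: "real^'n"
    have m: "(\<lambda>\<omega>. walk g \<xi> (Suc d) \<omega> *v y) \<in> P \<rightarrow>\<^sub>M borel"
      by (rule measurable_mat_prod_vec[where X = X]) (auto intro: \<xi> g)
    have "(\<integral>\<^sup>+\<omega>. indicator (cball 0 1) y * indicator (cball 0 1) (walk g \<xi> (Suc d) \<omega> *v y) \<partial>P)
       = indicator (cball 0 1) y * (\<integral>\<^sup>+\<omega>. indicator (cball 0 1) (walk g \<xi> (Suc d) \<omega> *v y) \<partial>P)"
      by (rule nn_integral_cmult) (use m in measurable)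
    also have "(\<integral>\<^sup>+\<omega>. indicator (cball 0 1) (walk g \<xi> (Suc d) \<omega> *v y) \<partial>P)
       = (\<integral>\<^sup>+\<omega>. ennreal (B (walk g \<xi> (Suc d) \<omega> *v y)) \<partial>P)"
      by (intro nn_integral_cong) (simp add: B_def ennreal_indicator)
    finally show "(\<integral>\<^sup>+\<omega>. indicator (cball 0 1) y * indicator (cball 0 1) (walk g \<xi> (Suc d) \<omega> *v y) \<partial>P)
       = indicator (cball 0 1) y * (\<integral>\<^sup>+x. ennreal (\<Psi> x y) \<partial>\<mu> 1)"
      by (simp only: path)
  qed
  finally have e1: "(\<integral>\<^sup>+\<omega>. overlap (walk g \<xi> (Suc d) \<omega>) \<partial>P)
      = (\<integral>\<^sup>+y. indicator (cball 0 1) y * (\<integral>\<^sup>+x. ennreal (\<Psi> x y) \<partial>\<mu> 1) \<partial>lborel)" .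
  have e2: "(\<integral>\<^sup>+y. indicator (cball 0 1) y * (\<integral>\<^sup>+x. ennreal (\<Psi> x y) \<partial>\<mu> 1) \<partial>lborel)
      \<le> (\<integral>\<^sup>+y. ennreal s * indicator (cball 0 1) y + ennreal i * (\<integral>\<^sup>+x. ennreal ((\<Psi> x y)\<^sup>2) \<partial>\<mu> 1) \<partial>lborel)"
  proof (rule nn_integral_mono)
    fix y :: "real^'n"
    interpret m1: prob_space "\<mu> 1" by (rule p1)
    have "(\<integral>\<^sup>+x. ennreal (\<Psi> x y) \<partial>\<mu> 1) \<le> (\<integral>\<^sup>+x. ennreal s + ennreal i * ennreal ((\<Psi> x y)\<^sup>2) \<partial>\<mu> 1)"
    proof (rule nn_integral_mono)
      fix x
      have "\<Psi> x y \<le> s + i * (\<Psi> x y)\<^sup>2"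
      proof (cases "\<Psi> x y \<le> s")
        case True
        then show ?thesis using i by (simp add: add_increasing2)
      next
        case False
        then have "\<Psi> x y * s \<le> \<Psi> x y * \<Psi> x y" using \<Psi>0[of x y] by (intro mult_left_mono) auto
        then have "\<Psi> x y \<le> i * (\<Psi> x y)\<^sup>2" using s by (simp add: i_def field_simps power2_eq_square)
        then show ?thesis using s by simp
      qed
      then show "ennreal (\<Psi> x y) \<le> ennreal s + ennreal i * ennreal ((\<Psi> x y)\<^sup>2)"
        using s i by (simp add: ennreal_mult[symmetric] ennreal_plus[symmetric] ennreal_leI del: ennreal_plus)
    qed
    also have "\<dots> = ennreal s + ennreal i * (\<integral>\<^sup>+x. ennreal ((\<Psi> x y)\<^sup>2) \<partial>\<mu> 1)"
      using sl(2)[of y] by (simp add: nn_integral_add nn_integral_cmult m1.emeasure_space_1 del: One_nat_def)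
    finally show "indicator (cball 0 1) y * (\<integral>\<^sup>+x. ennreal (\<Psi> x y) \<partial>\<mu> 1)
        \<le> ennreal s * indicator (cball 0 1) y + ennreal i * (\<integral>\<^sup>+x. ennreal ((\<Psi> x y)\<^sup>2) \<partial>\<mu> 1)"
      by (auto simp: indicator_def)
  qed
  have fe: "(\<integral>\<^sup>+y. (\<integral>\<^sup>+x. ennreal ((\<Psi> x y)\<^sup>2) \<partial>\<mu> 1) \<partial>lborel) = ennreal (energy (\<mu> 1) \<Psi>)"
    using energy_nn_integral[OF \<Psi> p1 s1] fin by (simp add: less_top)
  have inner: "ennreal (\<integral>x. (\<Psi> x y)\<^sup>2 \<partial>\<mu> 1) = (\<integral>\<^sup>+x. ennreal ((\<Psi> x y)\<^sup>2) \<partial>\<mu> 1)" for y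
    by (rule nn_integral_eq_integral[symmetric, OF variance_bounded(5)[OF p1 sl(2,3)]]) simp
  have "(\<lambda>y. ennreal (\<integral>x. (\<Psi> x y)\<^sup>2 \<partial>\<mu> 1)) \<in> borel_measurable lborel" using sl(5) by simp
  then have inner_meas: "(\<lambda>y. \<integral>\<^sup>+x. ennreal ((\<Psi> x y)\<^sup>2) \<partial>\<mu> 1) \<in> borel_measurable lborel"
    by (simp only: inner)
  have e3: "(\<integral>\<^sup>+y. ennreal s * indicator (cball 0 1) y + ennreal i * (\<integral>\<^sup>+x. ennreal ((\<Psi> x y)\<^sup>2) \<partial>\<mu> 1) \<partial>lborel)
      = ennreal s * ennreal V + ennreal i * ennreal (energy (\<mu> 1) \<Psi>)"
  proof (subst nn_integral_add)
    show "(\<lambda>y. ennreal i * (\<integral>\<^sup>+x. ennreal ((\<Psi> x y)\<^sup>2) \<partial>\<mu> 1)) \<in> borel_measurable lborel"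
      using inner_meas by measurable
  qed (simp_all add: nn_integral_cmult[OF inner_meas] nn_integral_cmult emB fe del: One_nat_def)
  have en0: "0 \<le> energy (\<mu> 1) \<Psi>" by (simp add: energy_def)
  have "ennreal s * ennreal V + ennreal i * ennreal (energy (\<mu> 1) \<Psi>)
      = ennreal (s * V + i * energy (\<mu> 1) \<Psi>)"
    using s i V0 by (simp add: ennreal_mult ennreal_plus en0 del: One_nat_def)
  also have "\<dots> \<le> ennreal (2 * s * V)"
  proof (rule ennreal_leI)
    have ss: "(w\<^sup>2) ^ (d div 2) = s * s"
      by (simp add: s_def power2_eq_square power_mult_distrib)
    have "i * energy (\<mu> 1) \<Psi> \<le> i * (s * s * V)"
      using i en unfolding ss by (intro mult_left_mono) auto
    then show "s * V + i * energy (\<mu> 1) \<Psi> \<le> 2 * s * V" by (simp add: mult.assoc mult.commute[of V] si del: One_nat_def)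
  qed
  finally have e4: "ennreal s * ennreal V + ennreal i * ennreal (energy (\<mu> 1) \<Psi>) \<le> ennreal (2 * s * V)" .
  show ?thesis
    using order_trans[OF e2[unfolded e3] e4] unfolding e1 by (simp only: s_def V_def mult.assoc)
qed


text \<open>An overlap below the full volume of the ball excludes \<open>\<parallel>A\<parallel> \<le> 1\<close>; the lower bound for the overlap then
  bounds \<open>\<parallel>A\<parallel>\<close> from below.\<close>

lemma growth_of_small_overlap:
  fixes A :: "real^'n^'n"
  assumes u: "0 < u" "u < 1" and n: "n \<ge> 1"
    and small: "overlap A < ennreal (unit_ball_vol (real CARD('n)) * u ^ n)"
  shows "- ln u / real CARD('n) \<le> 1 / real n * ln (onorm ((*v) A))"
proof -
  let ?N = "onorm ((*v) A)" and ?m = "CARD('n)"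
  have V: "unit_ball_vol (real ?m) > 0" by simp
  have "ennreal (unit_ball_vol (real ?m) * (1 / max 1 ?N) ^ ?m) < ennreal (unit_ball_vol (real ?m) * u ^ n)"
    by (rule le_less_trans[OF overlap_lower_bound small])
  then have "unit_ball_vol (real ?m) * (1 / max 1 ?N) ^ ?m < unit_ball_vol (real ?m) * u ^ n"
    by (subst (asm) ennreal_less_iff) (simp_all add: zero_le_mult_iff)
  then have lt: "(1 / max 1 ?N) ^ ?m < u ^ n" using V by simp
  have "u ^ n < 1" using u n by (simp add: power_less_one_iff)
  have N1: "?N > 1"
  proof (rule ccontr)
    assume "\<not> ?N > 1"
    then have "max 1 ?N = 1" by simp
    then show False using lt \<open>u ^ n < 1\<close> by simp
  qed
  then have "(1 / ?N) ^ ?m < u ^ n" using lt by (simp add: max_def)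
  then have "ln ((1 / ?N) ^ ?m) < ln (u ^ n)"
    using N1 u by (subst ln_less_cancel_iff) auto
  then have "- (real ?m * ln ?N) < real n * ln u"
    using N1 u by (simp add: ln_realpow ln_div)
  then show ?thesis
    using n by (simp add: field_simps)
qed

theorem theorem2p2:
  fixes P :: "'w measure" and X :: "'x measure"
    and \<xi> :: "nat \<Rightarrow> 'w \<Rightarrow> 'x" and k :: "nat \<Rightarrow> 'x \<Rightarrow> 'x measure"
    and \<gg> :: "nat \<Rightarrow> 'x \<Rightarrow> real^'m^'m"
    and \<mu> :: "nat \<Rightarrow> 'x measure" and g :: "nat \<Rightarrow> 'w \<Rightarrow> real^'m^'m"
    and \<nu> :: "nat \<Rightarrow> (real^'m^'m) measure"
  assumes chain: "markov_chain P X k \<xi>"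
    and meas: "\<And>n. n \<ge> 1 \<Longrightarrow> \<gg> n \<in> X \<rightarrow>\<^sub>M restrict_space borel SL"
    and \<mu>_def: "\<And>n. \<mu> n = distr P X (\<xi> n)"
    and g_def: "\<And>n \<omega>. g n \<omega> = \<gg> n (\<xi> n \<omega>)"
    and \<nu>_def: "\<And>n. \<nu> n = distr P (restrict_space borel SL) (g n)"
    and I: "\<exists>c::real. c < 1 \<and> (\<forall>n\<ge>1. L2_0_onorm (\<mu> (Suc n)) (\<mu> n) (kernel_op (k n)) \<le> ereal c)"
    and II: "\<exists>M. compactin (weak_topology SL) M \<and> (\<forall>n\<ge>1. \<nu> n \<in> M) \<and>
               (\<forall>\<rho>\<in>M. \<not> (\<exists>\<kappa>\<in>space (prob_algebra sphere_borel). \<forall>h\<in>G_of \<rho>. preserves h \<kappa>))"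
  shows "\<exists>l::real. l > 0 \<and> (AE \<omega> in P.
           liminf (\<lambda>n. ereal (1 / real n * ln (onorm ((*v) (mat_prod (\<lambda>i. g i \<omega>) n))))) \<ge> ereal l)"
proof -
  interpret prob_space P using chain by (simp add: markov_chain_def)
  have \<xi>: "\<And>n. n \<ge> 1 \<Longrightarrow> \<xi> n \<in> P \<rightarrow>\<^sub>M X" using chain by (auto simp: markov_chain_def)
  obtain c0 where c0: "c0 < 1" "\<And>n. n \<ge> 1 \<Longrightarrow> L2_0_onorm (\<mu> (Suc n)) (\<mu> n) (kernel_op (k n)) \<le> ereal c0"
    using I by blast
  \<comment> \<open>The squares below need a nonnegative bound.\<close>
  define c where "c = max c0 0"
  have c: "0 \<le> c" "c < 1" using c0(1) by (auto simp: c_def)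
  have gap: "L2_0_onorm (\<mu> (Suc n)) (\<mu> n) (kernel_op (k n)) \<le> ereal c" if "n \<ge> 1" for n
    by (rule order_trans[OF c0(2)[OF that]]) (simp add: c_def)
  have step: "kernel_step X (\<mu> n) (k n) (\<mu> (Suc n)) c" if "n \<ge> 1" for n
    by (rule markov_kernel_step[OF chain that \<mu>_def gap[OF that]])
  have c2: "0 \<le> c\<^sup>2" "c\<^sup>2 < 1" using c by (auto simp: power_less_one_iff)
  obtain M where M: "compactin (weak_topology SL) M" "\<And>n. n \<ge> 1 \<Longrightarrow> \<nu> n \<in> M"
      "\<forall>\<rho>\<in>M. \<not> (\<exists>\<kappa>\<in>space (prob_algebra sphere_borel). \<forall>h\<in>G_of \<rho>. preserves h \<kappa>)"
    using II by blast
  obtain \<eta> where \<eta>: "0 < \<eta>" "\<eta> < 1" "\<forall>\<rho>\<in>M. contracts \<rho> \<eta>"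
    using uniform_gap[OF M(1,3)] by blast
  have contr: "contracts (distr (\<mu> n) (restrict_space borel SL) (\<gg> n)) \<eta>" if n: "n \<ge> 1" for n
  proof -
    have "\<nu> n = distr (\<mu> n) (restrict_space borel SL) (\<gg> n)"
      unfolding \<nu>_def \<mu>_def
      by (subst distr_distr[OF meas[OF n] \<xi>[OF n]]) (simp add: comp_def g_def[abs_def])
    then show ?thesis using M(2)[OF n] \<eta>(3) by auto
  qed
  define q where "q = 1 - (1 - c\<^sup>2) * \<eta>\<^sup>2 / 4"
  have e2: "0 < \<eta>\<^sup>2" "\<eta>\<^sup>2 < 1" using \<eta> by (auto simp: power_less_one_iff)
  have "0 < (1 - c\<^sup>2) * \<eta>\<^sup>2" using c2 e2 by simp
  moreover have "(1 - c\<^sup>2) * \<eta>\<^sup>2 \<le> 1 * 1" using c2 e2 by (intro mult_mono) auto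
  ultimately have q: "0 < q" "q < 1" by (auto simp: q_def)
  \<comment> \<open>In two steps the energy decays by \<open>q = u ^ 8\<close> and the expected overlap by \<open>u ^ 4\<close>, so dividing the overlap by \<open>u ^ n\<close> leaves a convergent series.\<close>
  define u where "u = sqrt (sqrt (sqrt q))"
  have u: "0 < u" "u < 1" using q by (auto simp: u_def)
  have u8: "(u ^ 4)\<^sup>2 = q"
  proof -
    have "u\<^sup>2 = sqrt (sqrt q)" using q by (simp add: u_def)
    moreover have "u ^ 4 = (u\<^sup>2)\<^sup>2" by (simp flip: power_mult)
    ultimately have "u ^ 4 = sqrt q" using q by simp
    then show ?thesis using q by simp
  qed
  define V where "V = unit_ball_vol (real CARD('m))"
  have V: "V > 0" by (simp add: V_def)
  define A where "A n \<omega> = mat_prod (\<lambda>i. g i \<omega>) n" for n \<omega>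
  have A_eq: "A n \<omega> = mat_prod (\<lambda>i. \<gg> i (\<xi> i \<omega>)) n" for n \<omega> by (simp add: A_def g_def)
  have decay: "(\<integral>\<^sup>+\<omega>. overlap (A (Suc d) \<omega>) \<partial>P) \<le> ennreal (2 * (u ^ 4) ^ (d div 2) * V)" for d
    unfolding A_eq V_def
    by (rule expected_overlap_decay[where X = X and \<mu> = \<mu> and k = k and c = c and \<eta> = \<eta>])
       (use chain meas step c2 \<mu>_def contr \<eta> u u8 in \<open>auto simp: q_def\<close>)
  have overlap_meas [measurable]: "(\<lambda>\<omega>. overlap (A n \<omega>)) \<in> borel_measurable P" for n
  proof -
    have [measurable]: "(\<lambda>p. A n (fst p) *v snd p) \<in> P \<Otimes>\<^sub>M lborel \<rightarrow>\<^sub>M borel"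
      unfolding A_eq
      by (rule measurable_mat_prod_vec[where X = X and \<xi> = "\<lambda>i p. \<xi> i (fst p)"])
         (auto intro: measurable_compose[OF measurable_fst \<xi>] meas)
    have [measurable]: "(cball 0 1 :: (real^'m) set) \<in> sets borel" by (simp add: borel_closed)
    have "(\<lambda>p. indicator (cball 0 1) (snd p) * indicator (cball 0 1) (A n (fst p) *v snd p) :: ennreal)
        \<in> borel_measurable (P \<Otimes>\<^sub>M lborel)" by measurable
    then have "(\<lambda>(\<omega>, y). indicator (cball 0 1) y * indicator (cball 0 1) (A n \<omega> *v y) :: ennreal)
        \<in> borel_measurable (P \<Otimes>\<^sub>M lborel)" by (simp add: case_prod_beta')
    then show ?thesis
      unfolding overlap_def by (rule sigma_finite_measure.borel_measurable_nn_integral[OF sigma_finite_lborel])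
  qed
  define Y where "Y d \<omega> = overlap (A (Suc d) \<omega>) * ennreal (1 / u ^ Suc d)" for d \<omega>
  have Y_int: "(\<integral>\<^sup>+\<omega>. Y d \<omega> \<partial>P) \<le> ennreal ((2 * V / u ^ 3) * u ^ d)" for d
  proof -
    have "(\<integral>\<^sup>+\<omega>. Y d \<omega> \<partial>P) = (\<integral>\<^sup>+\<omega>. overlap (A (Suc d) \<omega>) \<partial>P) * ennreal (1 / u ^ Suc d)"
      unfolding Y_def by (rule nn_integral_multc) measurable
    also have "\<dots> \<le> ennreal (2 * (u ^ 4) ^ (d div 2) * V) * ennreal (1 / u ^ Suc d)"
      by (rule mult_right_mono[OF decay]) simp
    also have "\<dots> = ennreal (2 * (u ^ 4) ^ (d div 2) * V * (1 / u ^ Suc d))"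
      by (rule ennreal_mult[symmetric]) (use u V in auto)
    also have "\<dots> \<le> ennreal ((2 * V / u ^ 3) * u ^ d)"
    proof (rule ennreal_leI)
      have "u ^ (4 * (d div 2) + 3) \<le> u ^ (2 * d + 1)"
        using u by (intro power_decreasing) auto
      then have "u ^ (4 * (d div 2)) * u ^ 3 \<le> u ^ d * u ^ Suc d"
        by (simp add: power_add[symmetric] mult_2 del: power_Suc)
      then have "u ^ (4 * (d div 2)) / u ^ Suc d \<le> u ^ d / u ^ 3"
        using u by (simp add: divide_le_eq pos_le_divide_eq del: power_Suc)
      then have "2 * V * (u ^ (4 * (d div 2)) / u ^ Suc d) \<le> 2 * V * (u ^ d / u ^ 3)"
        using V by (intro mult_left_mono) auto
      then show "2 * (u ^ 4) ^ (d div 2) * V * (1 / u ^ Suc d) \<le> (2 * V / u ^ 3) * u ^ d"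
        by (simp add: power_mult[symmetric] mult_ac del: power_Suc)
    qed
    finally show ?thesis .
  qed
  have "(\<integral>\<^sup>+\<omega>. (\<Sum>d. Y d \<omega>) \<partial>P) = (\<Sum>d. \<integral>\<^sup>+\<omega>. Y d \<omega> \<partial>P)"
    unfolding Y_def by (rule nn_integral_suminf) measurable
  also have "\<dots> \<le> (\<Sum>d. ennreal ((2 * V / u ^ 3) * u ^ d))"
    by (intro suminf_le Y_int) auto
  also have "\<dots> = ennreal (\<Sum>d. (2 * V / u ^ 3) * u ^ d)"
    using u V by (intro suminf_ennreal2 summable_mult summable_geometric) auto
  also have "\<dots> < \<infinity>" by simp
  finally have "AE \<omega> in P. (\<Sum>d. Y d \<omega>) \<noteq> \<infinity>"
    by (intro nn_integral_PInf_AE) (auto simp: Y_def)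
  then have "AE \<omega> in P. liminf (\<lambda>n. ereal (1 / real n * ln (onorm ((*v) (A n \<omega>))))) \<ge> ereal (- ln u / real CARD('m))"
  proof eventually_elim
    fix \<omega> assume fin: "(\<Sum>d. Y d \<omega>) \<noteq> \<infinity>"
    have Y_fin: "Y d \<omega> < \<infinity>" for d
    proof -
      have "overlap (A (Suc d) \<omega>) < \<infinity>"
        by (rule le_less_trans[OF overlap_le]) simp
      then show ?thesis by (simp add: Y_def ennreal_mult_less_top del: power_Suc)
    qed
    have Y_real: "ennreal (enn2real (Y d \<omega>)) = Y d \<omega>" for d using Y_fin[of d] by simp
    have "summable (\<lambda>d. enn2real (Y d \<omega>))"
      by (rule summable_suminf_not_top) (use fin in \<open>simp_all add: Y_real\<close>)
    then have "(\<lambda>d. enn2real (Y d \<omega>)) \<longlonglongrightarrow> 0" by (rule summable_LIMSEQ_zero)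
    then have "\<forall>\<^sub>F d in sequentially. enn2real (Y d \<omega>) < V"
      using V by (rule order_tendstoD(2))
    then have "\<forall>\<^sub>F d in sequentially. - ln u / real CARD('m) \<le> 1 / real (Suc d) * ln (onorm ((*v) (A (Suc d) \<omega>)))"
    proof eventually_elim
      fix d assume "enn2real (Y d \<omega>) < V"
      then have "Y d \<omega> < ennreal V" by (subst Y_real[symmetric]) (simp add: ennreal_lessI V)
      have "overlap (A (Suc d) \<omega>) = Y d \<omega> * ennreal (u ^ Suc d)"
        using u by (simp add: Y_def mult.assoc ennreal_mult[symmetric] del: power_Suc)
      also have "\<dots> < ennreal V * ennreal (u ^ Suc d)"
        by (rule ennreal_mult_strict_right_mono) (use \<open>Y d \<omega> < ennreal V\<close> u in auto)
      also have "\<dots> = ennreal (V * u ^ Suc d)" using u V by (simp add: ennreal_mult del: power_Suc)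
      finally show "- ln u / real CARD('m) \<le> 1 / real (Suc d) * ln (onorm ((*v) (A (Suc d) \<omega>)))"
        unfolding V_def by (intro growth_of_small_overlap u) auto
    qed
    then have "\<forall>\<^sub>F n in sequentially. - ln u / real CARD('m) \<le> 1 / real n * ln (onorm ((*v) (A n \<omega>)))"
      using eventually_sequentially_Suc[of "\<lambda>n. - ln u / real CARD('m) \<le> 1 / real n * ln (onorm ((*v) (A n \<omega>)))"] by simp
    then show "liminf (\<lambda>n. ereal (1 / real n * ln (onorm ((*v) (A n \<omega>))))) \<ge> ereal (- ln u / real CARD('m))"
      by (intro Liminf_bounded) (simp add: eventually_mono)
  qed
  moreover have "- ln u / real CARD('m) > 0" using u by (simp add: divide_neg_pos)
  ultimately show ?thesis unfolding A_def by blast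
qed

end
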